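(* Let $\{X_i\}_{i\in\mathbb{N}}$ be a family of Banach spaces whose dual spaces $X_i^*$ are separable and uniformly convex with moduli of convexity $\delta_i(\varepsilon)$ such that $\inf_i\delta_i(\varepsilon)>0$ for all $0<\varepsilon<1$. Let $X=\left[\bigoplus X_i\right]_{c_0}$ or $X=\left[\bigoplus X_i\right]_{\ell_p}$ for some $1\le p<\infty$. Then $X^*$ admits a uniformly simultaneously continuous retraction.
   Context: Banach spaces are real or complex. $\left[\bigoplus X_i\right]_{c_0}$ and $\left[\bigoplus X_i\right]_{\ell_p}$ denote the $c_0$-sum and $\ell_p$-sum. $B_{X^*}$ is the closed unit ball of $X^*$. $X^*$ is said to admit a uniformly simultaneously continuous retraction if there is a map $r:X^*\to B_{X^*}$ which is the identity on $B_{X^*}$, is weak-$*$ continuous (weak-$*$ to weak-$*$), and is uniformly continuous in the norm. The modulus of convexity of a Banach space $Z$ with unit sphere $S_Z$ is $$\delta_Z(\varepsilon)=\inf\left\{1-\left\|\frac{x+y}{2}\right\| : x,y\in S_Z,\ \|x-y\|\ge\varepsilon\right\},$$ and $Z$ is uniformly convex if $\delta_Z(\varepsilon)>0$ for all $0<\varepsilon<1$. *)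

theory Defs
  imports "HOL-Analysis.Analysis" "HOL-Library.Function_Algebras"
begin

text \<open>
  Families of Banach spaces need spaces with explicit carriers. A space is a linear subspace
  of an ambient vector space \<open>'a\<close> together with a norm on it. This is no restriction: the
  members of any family of vector spaces are subspaces of their direct sum, and each member
  carries its own norm, which is meaningful on the carrier only.
\<close>

record ('k, 'a) nspace =
  scl :: "'k \<Rightarrow> 'a \<Rightarrow> 'a"
  carr :: "'a set"
  nrm :: "'a \<Rightarrow> real"

locale normed_space_on = vector_space "scl E"
  for E :: "('k::real_normed_field, 'a::ab_group_add) nspace" +
  assumes subspace_carr: "subspace (carr E)"
    and nrm_nonneg: "x \<in> carr E \<Longrightarrow> 0 \<le> nrm E x"
    and nrm_eq_0_iff: "x \<in> carr E \<Longrightarrow> nrm E x = 0 \<longleftrightarrow> x = 0"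
    and nrm_triangle: "x \<in> carr E \<Longrightarrow> y \<in> carr E \<Longrightarrow> nrm E (x + y) \<le> nrm E x + nrm E y"
    and nrm_scl: "x \<in> carr E \<Longrightarrow> nrm E (scl E c x) = norm c * nrm E x"

locale banach_space_on = normed_space_on +
  assumes complete_carr:
    "\<lbrakk>\<And>n. u n \<in> carr E;
      \<And>e. 0 < e \<Longrightarrow> \<exists>M. \<forall>m\<ge>M. \<forall>n\<ge>M. nrm E (u m - u n) < e\<rbrakk>
     \<Longrightarrow> \<exists>l\<in>carr E. (\<lambda>n. nrm E (u n - l)) \<longlonglongrightarrow> 0"

definition norm_separable :: "('k, 'a::ab_group_add) nspace \<Rightarrow> bool" where
  "norm_separable E \<longleftrightarrow>
     (\<exists>D. countable D \<and> D \<subseteq> carr E \<and>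
          (\<forall>x\<in>carr E. \<forall>e>0. \<exists>d\<in>D. nrm E (x - d) < e))"

text \<open>
  The infimum is taken in \<^typ>\<open>ereal\<close> so that it is \<open>\<infinity>\<close> when there are no admissible pairs,
  which happens for \<open>0 < \<epsilon> < 1\<close> only if the space is zero.
\<close>

definition modulus_of_convexity ::
    "('k::real_normed_field, 'a::ab_group_add) nspace \<Rightarrow> real \<Rightarrow> ereal" where
  "modulus_of_convexity E \<epsilon> =
     Inf {ereal (1 - nrm E (scl E (1/2) (x + y))) | x y.
            x \<in> carr E \<and> y \<in> carr E \<and> nrm E x = 1 \<and> nrm E y = 1 \<and> nrm E (x - y) \<ge> \<epsilon>}"

definition uniformly_convex :: "('k::real_normed_field, 'a::ab_group_add) nspace \<Rightarrow> bool" where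
  "uniformly_convex E \<longleftrightarrow> (\<forall>\<epsilon>. 0 < \<epsilon> \<and> \<epsilon> < 1 \<longrightarrow> 0 < modulus_of_convexity E \<epsilon>)"

text \<open>
  Functionals are functions on the ambient type that vanish off the carrier. This makes them
  determined by their values on the carrier, and the dual a linear subspace of
  \<open>'a \<Rightarrow> 'k\<close> with pointwise operations.
\<close>

definition dual :: "('k::real_normed_field, 'a::ab_group_add) nspace \<Rightarrow> ('k, 'a \<Rightarrow> 'k) nspace" where
  "dual E =
     \<lparr>scl = (\<lambda>c f x. c * f x),
      carr = {f. (\<forall>x\<in>carr E. \<forall>y\<in>carr E. f (x + y) = f x + f y) \<and>
                 (\<forall>c. \<forall>x\<in>carr E. f (scl E c x) = c * f x) \<and>
                 (\<exists>B. \<forall>x\<in>carr E. norm (f x) \<le> B * nrm E x) \<and>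
                 (\<forall>x. x \<notin> carr E \<longrightarrow> f x = 0)},
      nrm = (\<lambda>f. SUP x\<in>{x \<in> carr E. nrm E x \<le> 1}. norm (f x))\<rparr>"

definition unit_ball :: "('k, 'a) nspace \<Rightarrow> 'a set" where
  "unit_ball E = {x \<in> carr E. nrm E x \<le> 1}"

definition weak_star_topology ::
    "('k::real_normed_field, 'a::ab_group_add) nspace \<Rightarrow> ('a \<Rightarrow> 'k) topology" where
  "weak_star_topology E =
     topology_generated_by {{f \<in> carr (dual E). f x \<in> U} | x U. x \<in> carr E \<and> open U}"

definition dual_admits_usc_retraction ::
    "('k::real_normed_field, 'a::ab_group_add) nspace \<Rightarrow> bool" where
  "dual_admits_usc_retraction E \<longleftrightarrow>
     (\<exists>r. r ` carr (dual E) \<subseteq> unit_ball (dual E) \<and>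
          (\<forall>f\<in>unit_ball (dual E). r f = f) \<and>
          continuous_map (weak_star_topology E)
            (subtopology (weak_star_topology E) (unit_ball (dual E))) r \<and>
          (\<forall>e>0. \<exists>d>0. \<forall>f\<in>carr (dual E). \<forall>g\<in>carr (dual E).
             nrm (dual E) (f - g) < d \<longrightarrow> nrm (dual E) (r f - r g) < e))"

definition c0_sum ::
    "(nat \<Rightarrow> ('k::real_normed_field, 'a::ab_group_add) nspace) \<Rightarrow> ('k, nat \<Rightarrow> 'a) nspace" where
  "c0_sum X =
     \<lparr>scl = (\<lambda>c x i. scl (X i) c (x i)),
      carr = {x. (\<forall>i. x i \<in> carr (X i)) \<and> (\<lambda>i. nrm (X i) (x i)) \<longlonglongrightarrow> 0},
      nrm = (\<lambda>x. SUP i. nrm (X i) (x i))\<rparr>"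

definition lp_sum ::
    "real \<Rightarrow> (nat \<Rightarrow> ('k::real_normed_field, 'a::ab_group_add) nspace) \<Rightarrow> ('k, nat \<Rightarrow> 'a) nspace"
  where
  "lp_sum p X =
     \<lparr>scl = (\<lambda>c x i. scl (X i) c (x i)),
      carr = {x. (\<forall>i. x i \<in> carr (X i)) \<and> summable (\<lambda>i. nrm (X i) (x i) powr p)},
      nrm = (\<lambda>x. (\<Sum>i. nrm (X i) (x i) powr p) powr (1 / p))\<rparr>"

text \<open>
  The scalar field: \<^typ>\<open>real\<close> and \<^typ>\<open>complex\<close> are instances of
  \<open>{real_normed_field, euclidean_space}\<close>, and the only ones up to isometric isomorphism, since
  a finite-dimensional field extension of the reals is the reals or the complex numbers, and
  a multiplicative norm on it that extends the absolute value is the usual modulus.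
\<close>

end

theory Submission
  imports Defs
begin

text \<open>
  Let \<open>x\<^sub>0, x\<^sub>1, \<dots>\<close> be points that separate the functionals on a space, and read a functional \<open>f\<close> as
  the sequence \<open>\<phi>\<^sub>0 f, \<phi>\<^sub>1 f, \<dots>\<close> of the real coordinates of its values there. The retraction sends
  \<open>f\<close> to the element \<open>g\<close> of the dual ball that is lexicographically closest to \<open>f\<close>: \<open>\<phi>\<^sub>0 g\<close> is as close
  to \<open>\<phi>\<^sub>0 f\<close> as the ball permits, then \<open>\<phi>\<^sub>1 g\<close> is as close to \<open>\<phi>\<^sub>1 f\<close> as is possible with this value of
  \<open>\<phi>\<^sub>0 g\<close>, and so on. Weak-star compactness of the ball makes the choice possible. Elements of
  the ball are fixed, and \<open>\<phi>\<^sub>n g\<close> depends on finitely many coordinates of \<open>f\<close> only. The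
  coordinates are real so that each choice is a projection onto an interval, that is, a
  truncation, which is stable under small changes of the interval however far away \<open>f\<close> is.

  Both continuity properties come from one quantitative property of the dual, called
  rigidity below. Suppose that every functional with the same coordinates before \<open>n\<close> as the
  ball element \<open>g\<close> has norm at least \<open>1 - \<delta>\<close>; then any ball element whose coordinates before \<open>n\<close>
  differ from those of \<open>g\<close> by the coordinates of a functional of norm at most \<open>\<delta>\<close> is within \<open>\<epsilon>\<close> of \<open>g\<close>.
  At the first index \<open>i\<close> at which the retract \<open>g\<close> of \<open>f\<close> departs from \<open>f\<close>, every functional
  with the coordinates of \<open>g\<close> up to \<open>i\<close> has norm at least \<open>1\<close>, for otherwise \<open>g\<close> could be moved
  towards \<open>f\<close> inside the ball (\<open>lex_closest_norming\<close>). So the coordinates up to the departure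
  decide everything after it. For two functionals at small distance it remains to
  compare two truncations at one index: the intervals are close if the earlier coordinates
  leave room inside the ball, and rigidity applies already to the earlier coordinates if
  they do not (\<open>lex_closest_uniform\<close>). The same alternative gives weak-star continuity
  (\<open>lex_closest_continuous\<close>): the set of ball elements with given first coordinates either
  meets the interior of the ball or is a single point, and it varies continuously in both cases.

  Uniform convexity implies rigidity: if \<open>h + w\<close> has the coordinates of \<open>g\<close>, so has the midpoint of
  \<open>g\<close> and \<open>h + w\<close>, whose norm is therefore at least \<open>1 - \<delta>\<close>. In general, uniform convexity fails for the
  dual of a \<open>c\<^sub>0\<close>-sum, which is an \<open>\<ell>\<^sub>1\<close>-sum, but rigidity survives for all \<open>\<ell>\<^sub>q\<close>-sums with \<open>q < \<infinity>\<close>,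
  provided that each separating point lies in one summand (\<open>lq_rigid\<close>): replacing
  every component of \<open>g\<close> by the shortest of \<open>g\<^sub>k\<close>, \<open>h\<^sub>k + w\<^sub>k\<close> and their midpoint keeps the
  coordinates, so it costs almost no norm, and in all but a negligible part of the
  components the three norms are nearly equal. This covers the \<open>c\<^sub>0\<close>-sum with \<open>q = 1\<close> and the
  \<open>\<ell>\<^sub>p\<close>-sums with \<open>p > 1\<close> and the conjugate exponent \<open>q\<close>. The dual of an \<open>\<ell>\<^sub>1\<close>-sum is an
  \<open>\<ell>\<^sub>\<infinity>\<close>-sum; there the retractions of the summands, which share a modulus of uniform
  continuity, are applied componentwise (\<open>retraction_if_sup_dual\<close>).
\<close>

section \<open>Normed spaces with explicit carriers\<close>

context normed_space_on
begin

abbreviation rscl :: "real \<Rightarrow> 'a \<Rightarrow> 'a" where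
  "rscl c \<equiv> scl E (of_real c)"

lemma carr_zero [simp]: "0 \<in> carr E"
  using subspace_carr by (rule subspace_0)

lemma carr_add [simp]: "x \<in> carr E \<Longrightarrow> y \<in> carr E \<Longrightarrow> x + y \<in> carr E"
  using subspace_carr by (rule subspace_add)

lemma carr_scl [simp]: "x \<in> carr E \<Longrightarrow> scl E c x \<in> carr E"
  using subspace_carr by (rule subspace_scale)

lemma carr_diff [simp]: "x \<in> carr E \<Longrightarrow> y \<in> carr E \<Longrightarrow> x - y \<in> carr E"
  using subspace_carr by (rule subspace_diff)

lemma carr_uminus [simp]: "x \<in> carr E \<Longrightarrow> - x \<in> carr E"
  using subspace_carr by (rule subspace_neg)

lemma nrm_zero [simp]: "nrm E 0 = 0"
  using nrm_eq_0_iff[of 0] by simp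

lemma nrm_uminus [simp]: "x \<in> carr E \<Longrightarrow> nrm E (- x) = nrm E x"
  using nrm_scl[of x "-1"] by simp

lemma nrm_diff_le: "x \<in> carr E \<Longrightarrow> y \<in> carr E \<Longrightarrow> nrm E (x - y) \<le> nrm E x + nrm E y"
  using nrm_triangle[of x "- y"] by simp

lemma nrm_commute: "x \<in> carr E \<Longrightarrow> y \<in> carr E \<Longrightarrow> nrm E (x - y) = nrm E (y - x)"
  using nrm_uminus[of "x - y"] by simp

lemma nrm_le_add_diff: "x \<in> carr E \<Longrightarrow> y \<in> carr E \<Longrightarrow> nrm E x \<le> nrm E y + nrm E (x - y)"
  using nrm_triangle[of y "x - y"] by simp

lemma nrm_rscl [simp]: "x \<in> carr E \<Longrightarrow> nrm E (rscl c x) = \<bar>c\<bar> * nrm E x"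
  by (simp add: nrm_scl)

lemma nrm_convex_combination_le:
  assumes "x \<in> carr E" "y \<in> carr E" "0 \<le> t" "t \<le> 1" "nrm E x \<le> a" "nrm E y \<le> b"
  shows "nrm E (rscl (1 - t) x + rscl t y) \<le> (1 - t) * a + t * b"
proof -
  have "nrm E (rscl (1 - t) x + rscl t y) \<le> (1 - t) * nrm E x + t * nrm E y"
    using nrm_triangle[of "rscl (1 - t) x" "rscl t y"] assms nrm_rscl[of x "1 - t"] nrm_rscl[of y t]
    by simp
  also have "\<dots> \<le> (1 - t) * a + t * b"
    using assms by (intro add_mono mult_left_mono) auto
  finally show ?thesis .
qed

end

text \<open>
  Homogeneity follows from its upper half, applied to \<open>c\<close> and to \<open>inverse c\<close>.
\<close>

lemma normed_space_onI:
  fixes E :: "('k::real_normed_field, 'a::ab_group_add) nspace"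
  assumes vs: "vector_space (scl E)" and zero: "0 \<in> carr E"
    and add: "\<And>x y. x \<in> carr E \<Longrightarrow> y \<in> carr E \<Longrightarrow> x + y \<in> carr E \<and> nrm E (x + y) \<le> nrm E x + nrm E y"
    and scl: "\<And>c x. x \<in> carr E \<Longrightarrow> scl E c x \<in> carr E \<and> nrm E (scl E c x) \<le> norm c * nrm E x"
    and nonneg: "\<And>x. x \<in> carr E \<Longrightarrow> 0 \<le> nrm E x"
    and eq_0: "\<And>x. x \<in> carr E \<Longrightarrow> nrm E x = 0 \<Longrightarrow> x = 0"
  shows "normed_space_on E"
proof -
  interpret vector_space "scl E" by (rule vs)
  have nrm_0: "nrm E 0 = 0"
    using scl[OF zero, of 0] nonneg[OF zero] by simp
  have nrm_scl: "nrm E (scl E c x) = norm c * nrm E x" if x: "x \<in> carr E" for c x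
  proof (cases "c = 0")
    case False
    have "nrm E (scl E (inverse c) (scl E c x)) \<le> norm (inverse c) * nrm E (scl E c x)"
      using scl x by blast
    then have "norm c * nrm E x \<le> nrm E (scl E c x)"
      using False by (simp add: norm_inverse norm_divide field_simps)
    then show ?thesis using scl[OF x, of c] by simp
  qed (simp add: nrm_0)
  show ?thesis
    by unfold_locales (use zero add scl nonneg eq_0 nrm_0 nrm_scl in \<open>auto simp: subspace_def\<close>)
qed

section \<open>Lexicographically closest points of the unit ball\<close>

lemma tendsto_if_subseq_tendsto:
  fixes X :: "nat \<Rightarrow> real"
  assumes "\<And>s :: nat \<Rightarrow> nat. strict_mono s \<Longrightarrow> \<exists>t :: nat \<Rightarrow> nat. strict_mono t \<and> (\<lambda>k. X (s (t k))) \<longlonglongrightarrow> L"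
  shows "X \<longlonglongrightarrow> L"
proof (rule ccontr)
  assume "\<not> X \<longlonglongrightarrow> L"
  then obtain e where e: "e > 0" "\<And>N. \<exists>k\<ge>N. e \<le> dist (X k) L"
    unfolding LIMSEQ_def by (meson not_le)
  then have "infinite {k. e \<le> dist (X k) L}"
    by (metis (mono_tags, lifting) infinite_nat_iff_unbounded_le mem_Collect_eq)
  then obtain s :: "nat \<Rightarrow> nat" where s: "strict_mono s" "\<And>n. e \<le> dist (X (s n)) L"
    using infinite_enumerate[of "{k. e \<le> dist (X k) L}"] by auto
  obtain t where "(\<lambda>k. X (s (t k))) \<longlonglongrightarrow> L"
    using assms[OF s(1)] by blast
  then obtain k where "dist (X (s (t k))) L < e"
    using e(1) unfolding LIMSEQ_def by blast
  then show False using s(2)[of "t k"] by simp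
qed

text \<open>
  The model is a dual space, with the real coordinates of the values at a separating
  sequence of points. Compactness is sequential and concerns coordinates only: this is how
  weak-star compactness of the ball enters.
\<close>

locale coordinatized_space = normed_space_on Y
  for Y :: "('k::real_normed_field, 'v::ab_group_add) nspace" +
  fixes \<phi> :: "nat \<Rightarrow> 'v \<Rightarrow> real"
  assumes \<phi>_add [simp]: "x \<in> carr Y \<Longrightarrow> y \<in> carr Y \<Longrightarrow> \<phi> n (x + y) = \<phi> n x + \<phi> n y"
    and \<phi>_rscl [simp]: "x \<in> carr Y \<Longrightarrow> \<phi> n (rscl c x) = c * \<phi> n x"
    and \<phi>_bounded: "\<exists>C. \<forall>x\<in>carr Y. \<bar>\<phi> n x\<bar> \<le> C * nrm Y x"
    and \<phi>_separates: "x \<in> carr Y \<Longrightarrow> (\<And>n. \<phi> n x = 0) \<Longrightarrow> x = 0"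
    and ball_compact: "(\<And>k. g k \<in> unit_ball Y) \<Longrightarrow>
      \<exists>s l. strict_mono s \<and> l \<in> unit_ball Y \<and> (\<forall>n. (\<lambda>k. \<phi> n (g (s k :: nat))) \<longlonglongrightarrow> \<phi> n l)"
begin

lemma \<phi>_zero [simp]: "\<phi> n 0 = 0"
  using \<phi>_rscl[of 0 n 0] by simp

lemma \<phi>_uminus [simp]: "x \<in> carr Y \<Longrightarrow> \<phi> n (- x) = - \<phi> n x"
  using \<phi>_add[of x "- x" n] by simp

lemma \<phi>_diff [simp]: "x \<in> carr Y \<Longrightarrow> y \<in> carr Y \<Longrightarrow> \<phi> n (x - y) = \<phi> n x - \<phi> n y"
  using \<phi>_add[of x "- y" n] by simp

lemma ball_carr: "x \<in> unit_ball Y \<Longrightarrow> x \<in> carr Y"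
  by (simp add: unit_ball_def)

lemma ball_nrm: "x \<in> unit_ball Y \<Longrightarrow> nrm Y x \<le> 1"
  by (simp add: unit_ball_def)

definition agree :: "nat \<Rightarrow> 'v \<Rightarrow> 'v \<Rightarrow> bool" where
  "agree n x y \<longleftrightarrow> (\<forall>l<n. \<phi> l x = \<phi> l y)"

text \<open>
  The projection of \<open>\<phi> j f\<close> onto the interval of the values \<open>\<phi> j u\<close>, where \<open>u\<close> runs through the ball
  elements with the coordinates of \<open>g\<close> before \<open>j\<close>. It is expressed by the variational inequality
  that characterizes the nearest point of a convex set, since competitors are easy to insert there
  and the inequality passes to limits.
\<close>

definition closest_at :: "nat \<Rightarrow> 'v \<Rightarrow> 'v \<Rightarrow> bool" where
  "closest_at j f g \<longleftrightarrow>
     (\<forall>u\<in>unit_ball Y. agree j u g \<longrightarrow> (\<phi> j f - \<phi> j g) * (\<phi> j u - \<phi> j g) \<le> 0)"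

definition lex_closest :: "'v \<Rightarrow> 'v \<Rightarrow> bool" where
  "lex_closest f g \<longleftrightarrow> g \<in> unit_ball Y \<and> (\<forall>j. closest_at j f g)"

lemma closest_at_cong:
  assumes "agree (Suc j) g h" "closest_at j f g"
  shows "closest_at j f h"
  using assms by (auto simp: closest_at_def agree_def)

lemma closest_at_exists:
  assumes g: "g \<in> unit_ball Y"
  shows "\<exists>h\<in>unit_ball Y. agree j h g \<and> closest_at j f h"
proof -
  define K where "K = \<phi> j ` {u \<in> unit_ball Y. agree j u g}"
  have "closed K"
    unfolding closed_sequential_limits
  proof (intro allI impI)
    fix y l assume yl: "(\<forall>n. y n \<in> K) \<and> y \<longlonglongrightarrow> l"
    then have "\<forall>n. \<exists>u. u \<in> unit_ball Y \<and> agree j u g \<and> y n = \<phi> j u"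
      by (auto simp: K_def)
    then obtain u where u: "\<And>n. u n \<in> unit_ball Y" "\<And>n. agree j (u n) g" "\<And>n. y n = \<phi> j (u n)"
      by metis
    obtain s v where s: "strict_mono s" and v: "v \<in> unit_ball Y"
      and lim: "\<And>n. (\<lambda>k. \<phi> n (u (s k))) \<longlonglongrightarrow> \<phi> n v"
      using ball_compact[of u] u(1) by blast
    have "agree j v g"
      unfolding agree_def
    proof (intro allI impI)
      fix i assume "i < j"
      then show "\<phi> i v = \<phi> i g"
        using lim[of i] u(2) by (simp add: agree_def LIMSEQ_const_iff)
    qed
    moreover have "l = \<phi> j v"
      using LIMSEQ_subseq_LIMSEQ[of y l s] yl s lim[of j] u(3)
      by (auto simp: o_def intro: LIMSEQ_unique)
    ultimately show "l \<in> K"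
      using v by (auto simp: K_def)
  qed
  have "convex K"
  proof (rule convexI)
    fix x y a b :: real
    assume "x \<in> K" "y \<in> K" and ab: "0 \<le> a" "0 \<le> b" "a + b = 1"
    then obtain u v where u: "u \<in> unit_ball Y" "agree j u g" "x = \<phi> j u"
      and v: "v \<in> unit_ball Y" "agree j v g" "y = \<phi> j v"
      by (auto simp: K_def)
    have a: "a = 1 - b" using ab by simp
    have uv: "u \<in> carr Y" "v \<in> carr Y"
      using u v by (auto simp: ball_carr)
    let ?w = "rscl a u + rscl b v"
    have "nrm Y ?w \<le> (1 - b) * 1 + b * 1"
      unfolding a using u v uv ab by (intro nrm_convex_combination_le) (auto simp: ball_nrm)
    then have "?w \<in> unit_ball Y"
      using uv by (simp add: unit_ball_def)
    moreover have "agree j ?w g"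
      using u(2) v(2) uv ab by (auto simp: agree_def distrib_right[symmetric])
    ultimately show "a *\<^sub>R x + b *\<^sub>R y \<in> K"
      using u(3) v(3) uv by (auto simp: K_def intro!: image_eqI[where x = ?w])
  qed
  have "K \<noteq> {}" using g by (auto simp: K_def agree_def)
  then obtain z where z: "z \<in> K" "\<forall>y\<in>K. dist (\<phi> j f) z \<le> dist (\<phi> j f) y"
    using distance_attains_inf[OF \<open>closed K\<close>] by metis
  then obtain h where h: "h \<in> unit_ball Y" "agree j h g" "z = \<phi> j h"
    by (auto simp: K_def)
  have "closest_at j f h"
    unfolding closest_at_def
  proof (intro ballI impI)
    fix u assume u: "u \<in> unit_ball Y" "agree j u h"
    then have "\<phi> j u \<in> K"
      using h by (auto simp: K_def agree_def)
    then show "(\<phi> j f - \<phi> j h) * (\<phi> j u - \<phi> j h) \<le> 0"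
      using any_closest_point_dot[OF \<open>convex K\<close> \<open>closed K\<close> z(1) _ z(2)] h(3) by simp
  qed
  then show ?thesis using h by blast
qed

text \<open>
  Choosing one coordinate at a time gives ball elements \<open>G n\<close> that are correct before
  \<open>n\<close> and agree there with all later ones; a limit point has all the coordinates so obtained.
\<close>

lemma lex_closest_exists: "\<exists>g. lex_closest f g"
proof -
  have "\<exists>G. \<forall>n. (G n \<in> unit_ball Y \<and> (\<forall>j<n. closest_at j f (G n))) \<and> agree n (G (Suc n)) (G n)"
  proof (rule dependent_nat_choice)
    show "\<exists>x. x \<in> unit_ball Y \<and> (\<forall>j<0. closest_at j f x)"
      by (rule exI[of _ 0]) (simp add: unit_ball_def)
  next
    fix x n assume x: "x \<in> unit_ball Y \<and> (\<forall>j<n. closest_at j f x)"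
    obtain h where h: "h \<in> unit_ball Y" "agree n h x" "closest_at n f h"
      using closest_at_exists[of x n f] x by blast
    have "closest_at j f h" if "j < Suc n" for j
    proof (cases "j = n")
      case False
      then have "agree (Suc j) x h"
        using that h(2) by (auto simp: agree_def)
      then show ?thesis
        using closest_at_cong x that False by auto
    qed (use h in simp)
    then show "\<exists>y. (y \<in> unit_ball Y \<and> (\<forall>j<Suc n. closest_at j f y)) \<and> agree n y x"
      using h by blast
  qed
  then obtain G where G: "\<And>n. G n \<in> unit_ball Y" "\<And>n j. j < n \<Longrightarrow> closest_at j f (G n)"
    "\<And>n. agree n (G (Suc n)) (G n)"
    by blast
  have const: "\<phi> l (G (Suc l + k)) = \<phi> l (G (Suc l))" for l k
    by (induction k) (use G(3) in \<open>auto simp: agree_def\<close>)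
  have ev: "\<phi> l (G n) = \<phi> l (G (Suc l))" if "l < n" for l n
    using const[of l "n - Suc l"] that by simp
  obtain s g where s: "strict_mono s" and g: "g \<in> unit_ball Y"
    and lim: "\<And>n. (\<lambda>k. \<phi> n (G (s k))) \<longlonglongrightarrow> \<phi> n g"
    using ball_compact[of G] G(1) by blast
  have eq: "\<phi> l g = \<phi> l (G (Suc l))" for l
  proof -
    have "\<forall>\<^sub>F k in sequentially. \<phi> l (G (s k)) = \<phi> l (G (Suc l))"
      using eventually_gt_at_top[of l]
    proof eventually_elim
      case (elim k)
      then have "l < s k" using seq_suble[OF s, of k] by simp
      then show ?case by (rule ev)
    qed
    then have "(\<lambda>k. \<phi> l (G (s k))) \<longlonglongrightarrow> \<phi> l (G (Suc l))"
      by (rule tendsto_eventually)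
    then show ?thesis using lim LIMSEQ_unique by blast
  qed
  have "closest_at j f g" for j
  proof (rule closest_at_cong)
    show "agree (Suc j) (G (Suc j)) g"
      using eq ev[of _ "Suc j"] by (simp add: agree_def)
  qed (simp add: G(2))
  then show ?thesis using g by (auto simp: lex_closest_def)
qed

text \<open>
  The element \<open>f\<close> itself competes at every index, so no coordinate is ever changed.
\<close>

lemma lex_closest_ball:
  assumes f: "f \<in> unit_ball Y" and fg: "lex_closest f g"
  shows "g = f"
proof -
  have "\<phi> j f = \<phi> j g" for j
  proof (induction j rule: less_induct)
    case (less j)
    then have "agree j f g" by (simp add: agree_def)
    then have "(\<phi> j f - \<phi> j g) * (\<phi> j f - \<phi> j g) \<le> 0"
      using fg f by (auto simp: lex_closest_def closest_at_def)
    then show ?case by (metis eq_iff_diff_eq_0 mult_eq_0_iff order_antisym zero_le_square)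
  qed
  then have "g - f = 0"
    using f fg by (intro \<phi>_separates) (auto simp: ball_carr lex_closest_def)
  then show ?thesis by simp
qed

text \<open>
  This is the equivalence of the quotient norm and the maximum norm on the finite-dimensional
  space of the first \<open>n\<close> coordinates. The induction adds one coordinate; either it is determined by the
  earlier ones, or some \<open>v\<close> annihilates the earlier ones and corrects it.
\<close>

lemma bounded_lift:
  "\<exists>C\<ge>0. \<forall>x\<in>carr Y. \<forall>M. (\<forall>l<n. \<bar>\<phi> l x\<bar> \<le> M) \<and> 0 \<le> M \<longrightarrow> (\<exists>e\<in>carr Y. agree n e x \<and> nrm Y e \<le> C * M)"
proof (induction n)
  case 0
  show ?case
    by (rule exI[of _ 0]) (auto simp: agree_def intro!: bexI[of _ 0])
next
  case (Suc n)
  then obtain C where C: "C \<ge> 0"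
    "\<And>x M. x \<in> carr Y \<Longrightarrow> (\<And>l. l < n \<Longrightarrow> \<bar>\<phi> l x\<bar> \<le> M) \<Longrightarrow> 0 \<le> M \<Longrightarrow> \<exists>e\<in>carr Y. agree n e x \<and> nrm Y e \<le> C * M"
    by blast
  show ?case
  proof (cases "\<exists>v\<in>carr Y. agree n v 0 \<and> \<phi> n v \<noteq> 0")
    case False
    show ?thesis
    proof (intro exI[of _ C] conjI ballI allI impI)
      fix x M assume x: "x \<in> carr Y" and M: "(\<forall>l<Suc n. \<bar>\<phi> l x\<bar> \<le> M) \<and> 0 \<le> M"
      then obtain e where e: "e \<in> carr Y" "agree n e x" "nrm Y e \<le> C * M"
        using C(2)[of x M] by force
      have "agree n (e - x) 0" using e x by (simp add: agree_def)
      then have "\<phi> n e = \<phi> n x" using False e x by force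
      then have "agree (Suc n) e x" using e by (auto simp: agree_def less_Suc_eq)
      then show "\<exists>e\<in>carr Y. agree (Suc n) e x \<and> nrm Y e \<le> C * M" using e by blast
    qed (use C in auto)
  next
    case True
    then obtain v where v: "v \<in> carr Y" "agree n v 0" "\<phi> n v \<noteq> 0" by blast
    obtain b where b: "\<And>x. x \<in> carr Y \<Longrightarrow> \<bar>\<phi> n x\<bar> \<le> b * nrm Y x"
      using \<phi>_bounded by blast
    define D where "D = C + (1 + \<bar>b\<bar> * C) / \<bar>\<phi> n v\<bar> * nrm Y v"
    show ?thesis
    proof (intro exI[of _ D] conjI ballI allI impI)
      show "0 \<le> D" using C v by (simp add: D_def nrm_nonneg)
      fix x M assume x: "x \<in> carr Y" and M: "(\<forall>l<Suc n. \<bar>\<phi> l x\<bar> \<le> M) \<and> 0 \<le> M"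
      then obtain e where e: "e \<in> carr Y" "agree n e x" "nrm Y e \<le> C * M"
        using C(2)[of x M] by force
      define t where "t = (\<phi> n x - \<phi> n e) / \<phi> n v"
      then have tv: "t * \<phi> n v = \<phi> n x - \<phi> n e" using v by simp
      have "\<bar>\<phi> n e\<bar> \<le> \<bar>b\<bar> * (C * M)"
      proof -
        have "\<bar>\<phi> n e\<bar> \<le> b * nrm Y e" by (rule b) fact
        also have "\<dots> \<le> \<bar>b\<bar> * nrm Y e" using e by (intro mult_right_mono) (auto simp: nrm_nonneg)
        also have "\<dots> \<le> \<bar>b\<bar> * (C * M)" using e by (intro mult_left_mono) auto
        finally show ?thesis .
      qed
      moreover have "\<bar>\<phi> n x\<bar> \<le> M" using M by blast
      ultimately have "\<bar>\<phi> n x - \<phi> n e\<bar> \<le> (1 + \<bar>b\<bar> * C) * M"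
        by (simp add: algebra_simps)
      then have "\<bar>t\<bar> \<le> (1 + \<bar>b\<bar> * C) / \<bar>\<phi> n v\<bar> * M"
        by (simp add: t_def abs_divide divide_right_mono)
      then have "\<bar>t\<bar> * nrm Y v \<le> (1 + \<bar>b\<bar> * C) / \<bar>\<phi> n v\<bar> * M * nrm Y v"
        using v by (intro mult_right_mono) (auto simp: nrm_nonneg)
      then have "nrm Y (e + rscl t v) \<le> D * M"
        using nrm_triangle[of e "rscl t v"] e v by (simp add: D_def algebra_simps)
      moreover have "agree (Suc n) (e + rscl t v) x"
        using e v tv by (auto simp: agree_def less_Suc_eq)
      ultimately show "\<exists>e\<in>carr Y. agree (Suc n) e x \<and> nrm Y e \<le> D * M"
        using e v by (intro bexI[of _ "e + rscl t v"]) auto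
    qed
  qed
qed

lemma null_lift:
  assumes "\<And>k. x k \<in> carr Y" "\<And>l. l < n \<Longrightarrow> (\<lambda>k. \<phi> l (x k)) \<longlonglongrightarrow> 0"
  shows "\<exists>e. (\<forall>k. e k \<in> carr Y \<and> agree n (e k) (x k)) \<and> (\<lambda>k. nrm Y (e k)) \<longlonglongrightarrow> 0"
proof -
  obtain C where C: "C \<ge> 0"
    "\<And>x M. x \<in> carr Y \<Longrightarrow> (\<And>l. l < n \<Longrightarrow> \<bar>\<phi> l x\<bar> \<le> M) \<Longrightarrow> 0 \<le> M \<Longrightarrow> \<exists>e\<in>carr Y. agree n e x \<and> nrm Y e \<le> C * M"
    using bounded_lift[of n] by blast
  define M where "M k = (\<Sum>l<n. \<bar>\<phi> l (x k)\<bar>)" for k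
  have "\<exists>e\<in>carr Y. agree n e (x k) \<and> nrm Y e \<le> C * M k" for k
    using assms(1) by (intro C(2)) (auto simp: M_def intro!: member_le_sum sum_nonneg)
  then obtain e where e: "\<And>k. e k \<in> carr Y" "\<And>k. agree n (e k) (x k)" "\<And>k. nrm Y (e k) \<le> C * M k"
    by metis
  have "M \<longlonglongrightarrow> (\<Sum>l<n. \<bar>0\<bar>)"
    unfolding M_def using assms(2) by (intro tendsto_sum tendsto_rabs) auto
  then have "(\<lambda>k. C * M k) \<longlonglongrightarrow> 0"
    using tendsto_mult_left[of M 0 sequentially C] by simp
  then have "(\<lambda>k. nrm Y (e k)) \<longlonglongrightarrow> 0"
    by (rule Lim_null_comparison[rotated]) (use e nrm_nonneg in auto)
  then show ?thesis using e by blast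
qed

text \<open>
  The condition on \<open>u\<close> says that the quotient norm of \<open>g\<close> in the space of the first \<open>n\<close>
  coordinates is at least \<open>1 - \<delta>\<close>, and the conditions on \<open>w\<close> bound the quotient norm of \<open>g - h\<close>.
\<close>

definition rigid :: "real \<Rightarrow> real \<Rightarrow> bool" where
  "rigid \<epsilon> \<delta> \<longleftrightarrow> (\<forall>n. \<forall>g\<in>unit_ball Y. \<forall>h\<in>unit_ball Y. \<forall>w\<in>carr Y.
     agree n w (g - h) \<and> nrm Y w \<le> \<delta> \<and> (\<forall>u\<in>carr Y. agree n u g \<longrightarrow> 1 - \<delta> \<le> nrm Y u)
       \<longrightarrow> nrm Y (g - h) \<le> \<epsilon>)"

lemma rigidD:
  assumes "rigid \<epsilon> \<delta>" "g \<in> unit_ball Y" "h \<in> unit_ball Y" "w \<in> carr Y"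
    "agree n w (g - h)" "nrm Y w \<le> \<delta>" "\<And>u. u \<in> carr Y \<Longrightarrow> agree n u g \<Longrightarrow> 1 - \<delta> \<le> nrm Y u"
  shows "nrm Y (g - h) \<le> \<epsilon>"
  using assms unfolding rigid_def by blast

text \<open>
  Rigidity with \<open>w = 0\<close>, for all \<open>\<epsilon>\<close>: first coordinates of quotient norm \<open>1\<close> determine the ball element.
\<close>

lemma rigid_unique:
  assumes rigid: "\<And>\<epsilon>. 0 < \<epsilon> \<Longrightarrow> \<exists>\<delta>>0. rigid \<epsilon> \<delta>"
    and "g \<in> unit_ball Y" "h \<in> unit_ball Y" "agree n h g"
    and "\<And>u. u \<in> carr Y \<Longrightarrow> agree n u g \<Longrightarrow> 1 \<le> nrm Y u"
  shows "h = g"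
proof -
  have "nrm Y (g - h) \<le> \<epsilon>" if pos: "0 < \<epsilon>" for \<epsilon>
  proof -
    obtain \<delta> where "\<delta> > 0" "rigid \<epsilon> \<delta>" using rigid[OF pos] by blast
    then show ?thesis
    proof (intro rigidD[of \<epsilon> \<delta> g h 0 n])
      show "agree n 0 (g - h)"
        using assms(2-4) by (simp add: agree_def ball_carr)
      show "1 - \<delta> \<le> nrm Y u" if "u \<in> carr Y" "agree n u g" for u
        using assms(5)[OF that] \<open>\<delta> > 0\<close> by simp
    qed (use assms in auto)
  qed
  then have "nrm Y (g - h) \<le> 0"
    using field_le_epsilon[of "nrm Y (g - h)" 0] by simp
  then have "g - h = 0"
    using assms(2,3) nrm_eq_0_iff[of "g - h"] nrm_nonneg[of "g - h"] by (simp add: ball_carr)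
  then show ?thesis by simp
qed

text \<open>
  A limit point \<open>h\<close> of the retracts \<open>G k\<close> has the coordinates of \<open>g\<close> before \<open>n\<close>. If these force
  the norm to be at least \<open>1\<close>, then \<open>h = g\<close> by rigidity. Otherwise they are shared by some \<open>u\<close> in the interior
  of the ball. Points of the segment from \<open>g\<close> to \<open>u\<close> can be shifted by small amounts to have
  the first coordinates of \<open>G k\<close>, so they compete with \<open>G k\<close>; in the limit, \<open>g\<close>
  competes with \<open>h\<close> just as \<open>h\<close> competes with \<open>g\<close>, and nearest points are unique.
\<close>

lemma lex_closest_subseq:
  assumes rigid: "\<And>\<epsilon>. 0 < \<epsilon> \<Longrightarrow> \<exists>\<delta>>0. rigid \<epsilon> \<delta>"
    and F: "(\<lambda>k. \<phi> n (F k)) \<longlonglongrightarrow> \<phi> n f"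
    and G: "\<And>k. lex_closest (F k) (G k)" "lex_closest f g"
    and lim: "\<And>l. l < n \<Longrightarrow> (\<lambda>k. \<phi> l (G k)) \<longlonglongrightarrow> \<phi> l g"
  shows "\<exists>s. strict_mono s \<and> (\<lambda>k. \<phi> n (G (s k))) \<longlonglongrightarrow> \<phi> n g"
proof -
  have ball: "G k \<in> unit_ball Y" "g \<in> unit_ball Y" for k
    using G by (auto simp: lex_closest_def)
  then have carr: "G k \<in> carr Y" "g \<in> carr Y" for k
    by (auto simp: ball_carr)
  obtain s h where s: "strict_mono s" and h: "h \<in> unit_ball Y"
    and hlim: "\<And>n. (\<lambda>k. \<phi> n (G (s k))) \<longlonglongrightarrow> \<phi> n h"
    using ball_compact[of G] ball by blast
  have sub: "(\<lambda>k. X (s k)) \<longlonglongrightarrow> L" if "X \<longlonglongrightarrow> L" for X :: "nat \<Rightarrow> real" and L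
    using LIMSEQ_subseq_LIMSEQ[OF that s] by (simp add: o_def)
  have agree: "agree n h g"
    unfolding agree_def using sub[OF lim] hlim LIMSEQ_unique by blast
  have "\<phi> n h = \<phi> n g"
  proof (cases "\<exists>u\<in>carr Y. agree n u g \<and> nrm Y u < 1")
    case False
    then have "h = g"
      using ball h agree by (intro rigid_unique[OF rigid, of g h n]) force+
    then show ?thesis by simp
  next
    case True
    then obtain u where u: "u \<in> carr Y" "agree n u g" "nrm Y u < 1" by blast
    have "(\<lambda>k. \<phi> l (G (s k) - g)) \<longlonglongrightarrow> 0" if "l < n" for l
      using tendsto_diff[OF sub[OF lim[OF that]] tendsto_const[of "\<phi> l g"]] carr by simp
    then obtain e where e: "\<And>k. e k \<in> carr Y" "\<And>k. agree n (e k) (G (s k) - g)"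
      "(\<lambda>k. nrm Y (e k)) \<longlonglongrightarrow> 0"
      using null_lift[of "\<lambda>k. G (s k) - g" n] carr by auto
    obtain b where b: "\<And>x. x \<in> carr Y \<Longrightarrow> \<bar>\<phi> n x\<bar> \<le> b * nrm Y x"
      using \<phi>_bounded by blast
    have "(\<lambda>k. b * nrm Y (e k)) \<longlonglongrightarrow> 0"
      using tendsto_mult_left[OF e(3), of b] by simp
    then have en: "(\<lambda>k. \<phi> n (e k)) \<longlonglongrightarrow> 0"
      by (rule Lim_null_comparison[rotated]) (use b e(1) in auto)
    have ineq: "(\<phi> n f - \<phi> n h) * ((1 - t) * \<phi> n g + t * \<phi> n u - \<phi> n h) \<le> 0" if t: "0 < t" "t \<le> 1" for t
    proof -
      define v where "v = rscl (1 - t) g + rscl t u"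
      have v: "v \<in> carr Y" using u carr by (simp add: v_def)
      have "nrm Y v \<le> (1 - t) * 1 + t * nrm Y u"
        unfolding v_def using u carr t ball by (intro nrm_convex_combination_le) (auto simp: ball_nrm)
      also have "\<dots> < 1" using t u by (simp add: algebra_simps)
      finally have "0 < 1 - nrm Y v" by simp
      then have "\<forall>\<^sub>F k in sequentially. nrm Y (e k) < 1 - nrm Y v"
        using e(3) by (rule order_tendstoD(2)[rotated])
      then have "\<forall>\<^sub>F k in sequentially.
        (\<phi> n (F (s k)) - \<phi> n (G (s k))) * (\<phi> n v + \<phi> n (e k) - \<phi> n (G (s k))) \<le> 0"
      proof eventually_elim
        case (elim k)
        then have "v + e k \<in> unit_ball Y"
          using nrm_triangle[of v "e k"] v e(1) by (simp add: unit_ball_def)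
        moreover have "agree n (v + e k) (G (s k))"
          unfolding agree_def
        proof (intro allI impI)
          fix l assume "l < n"
          then have "\<phi> l (e k) = \<phi> l (G (s k)) - \<phi> l g" "\<phi> l u = \<phi> l g"
            using e(2)[of k] u(2) carr by (auto simp: agree_def)
          moreover have "\<phi> l v = (1 - t) * \<phi> l g + t * \<phi> l u"
            unfolding v_def using u carr by (simp del: of_real_diff)
          ultimately show "\<phi> l (v + e k) = \<phi> l (G (s k))"
            using v e(1) by (simp add: algebra_simps)
        qed
        ultimately show ?case
          using G(1)[of "s k"] v e(1) by (force simp: lex_closest_def closest_at_def)
      qed
      moreover have "(\<lambda>k. (\<phi> n (F (s k)) - \<phi> n (G (s k))) * (\<phi> n v + \<phi> n (e k) - \<phi> n (G (s k))))
        \<longlonglongrightarrow> (\<phi> n f - \<phi> n h) * (\<phi> n v + 0 - \<phi> n h)"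
        by (intro tendsto_intros hlim sub[OF F] en)
      ultimately have "(\<phi> n f - \<phi> n h) * (\<phi> n v + 0 - \<phi> n h) \<le> 0"
        by (intro tendsto_upperbound) auto
      then show ?thesis
        using u carr by (simp add: v_def del: of_real_diff)
    qed
    have "((\<lambda>t. (\<phi> n f - \<phi> n h) * ((1 - t) * \<phi> n g + t * \<phi> n u - \<phi> n h)) \<longlongrightarrow>
        (\<phi> n f - \<phi> n h) * ((1 - 0) * \<phi> n g + 0 * \<phi> n u - \<phi> n h)) (at_right 0)"
      by (intro tendsto_intros)
    moreover have "\<forall>\<^sub>F t in at_right 0. (\<phi> n f - \<phi> n h) * ((1 - t) * \<phi> n g + t * \<phi> n u - \<phi> n h) \<le> 0"
      using eventually_at_right_less[of 0] eventually_at_right[of 0 1]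
      by (auto simp: eventually_at_right_field intro!: exI[of _ 1] ineq)
    ultimately have "(\<phi> n f - \<phi> n h) * (\<phi> n g - \<phi> n h) \<le> 0"
      using tendsto_upperbound[of _ _ "at_right (0::real)" 0] by force
    moreover have "(\<phi> n f - \<phi> n g) * (\<phi> n h - \<phi> n g) \<le> 0"
      using G(2) h agree by (auto simp: lex_closest_def closest_at_def)
    ultimately have "(\<phi> n h - \<phi> n g) * (\<phi> n h - \<phi> n g) \<le> 0"
      by (simp add: algebra_simps)
    then show ?thesis
      by (metis eq_iff_diff_eq_0 mult_eq_0_iff order_antisym zero_le_square)
  qed
  then show ?thesis using s hlim by metis
qed

lemma lex_closest_sequential:
  assumes rigid: "\<And>\<epsilon>. 0 < \<epsilon> \<Longrightarrow> \<exists>\<delta>>0. rigid \<epsilon> \<delta>"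
    and G: "\<And>k. lex_closest (F k) (G k)" "lex_closest f g"
    and F: "\<And>l. l \<le> n \<Longrightarrow> (\<lambda>k. \<phi> l (F k)) \<longlonglongrightarrow> \<phi> l f"
  shows "(\<lambda>k. \<phi> n (G k)) \<longlonglongrightarrow> \<phi> n g"
  using F
proof (induction n rule: less_induct)
  case (less n)
  have lim: "(\<lambda>k. \<phi> l (G k)) \<longlonglongrightarrow> \<phi> l g" if "l < n" for l
    using less that by simp
  show ?case
  proof (rule tendsto_if_subseq_tendsto)
    fix s :: "nat \<Rightarrow> nat" assume s: "strict_mono s"
    have sub: "(\<lambda>k. X (s k)) \<longlonglongrightarrow> L" if "X \<longlonglongrightarrow> L" for X :: "nat \<Rightarrow> real" and L
      using LIMSEQ_subseq_LIMSEQ[OF that s] by (simp add: o_def)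
    show "\<exists>t. strict_mono t \<and> (\<lambda>k. \<phi> n (G (s (t k)))) \<longlonglongrightarrow> \<phi> n g"
      by (rule lex_closest_subseq[OF rigid, where F = "\<lambda>k. F (s k)" and f = f])
        (use G less.prems[of n] sub lim in auto)
  qed
qed

lemma lex_closest_continuous:
  assumes rigid: "\<And>\<epsilon>. 0 < \<epsilon> \<Longrightarrow> \<exists>\<delta>>0. rigid \<epsilon> \<delta>"
    and g: "lex_closest f g" and e: "0 < e"
  shows "\<exists>d>0. \<forall>f' g'. lex_closest f' g' \<longrightarrow> (\<forall>l\<le>n. \<bar>\<phi> l f' - \<phi> l f\<bar> < d) \<longrightarrow> \<bar>\<phi> n g' - \<phi> n g\<bar> < e"
proof (rule ccontr)
  assume neg: "\<not> ?thesis"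
  have "\<exists>f' g'. lex_closest f' g' \<and> (\<forall>l\<le>n. \<bar>\<phi> l f' - \<phi> l f\<bar> < inverse (real (Suc k))) \<and>
      e \<le> \<bar>\<phi> n g' - \<phi> n g\<bar>" for k
  proof -
    have "0 < inverse (real (Suc k))" by simp
    then show ?thesis using neg by (meson not_le)
  qed
  then obtain F G where G: "\<And>k. lex_closest (F k) (G k)"
    and F: "\<And>k l. l \<le> n \<Longrightarrow> \<bar>\<phi> l (F k) - \<phi> l f\<bar> < inverse (real (Suc k))"
    and far: "\<And>k. e \<le> \<bar>\<phi> n (G k) - \<phi> n g\<bar>"
    by metis
  have "(\<lambda>k. \<phi> l (F k)) \<longlonglongrightarrow> \<phi> l f" if "l \<le> n" for l
  proof -
    have "(\<lambda>k. \<phi> l (F k) - \<phi> l f) \<longlonglongrightarrow> 0"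
      by (rule Lim_null_comparison[OF _ LIMSEQ_inverse_real_of_nat])
        (use F[OF that] in \<open>auto intro!: always_eventually less_imp_le\<close>)
    then show ?thesis by (rule LIM_zero_cancel)
  qed
  then have "(\<lambda>k. \<phi> n (G k)) \<longlonglongrightarrow> \<phi> n g"
    by (intro lex_closest_sequential[OF rigid G g]) auto
  then obtain k where "\<bar>\<phi> n (G k) - \<phi> n g\<bar> < e"
    using e unfolding LIMSEQ_def dist_real_def by blast
  then show False using far[of k] by simp
qed

text \<open>
  The numbers \<open>0\<close> and \<open>d\<close> are the projections of \<open>Z\<close> onto two intervals, of which the first contains \<open>d + b\<close> and the
  second contains \<open>a\<close>. So \<open>a\<close> and \<open>b\<close> measure how far the intervals are from containing each other's
  projection, and the projections differ by no more than that, independently of the size of \<open>Z\<close>.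
\<close>

lemma clamp_displacement:
  fixes Z d a b :: real
  assumes "Z \<noteq> 0" "(Z - d) * (a - d) \<le> 0" "Z * (d + b) \<le> 0"
  shows "\<bar>d\<bar> \<le> \<bar>a\<bar> \<or> \<bar>d\<bar> \<le> \<bar>b\<bar>"
proof (cases "Z > 0")
  case True
  then have "d \<le> - b" using assms(3) by (simp add: mult_le_0_iff)
  moreover have "a \<le> d" if "d < 0" using assms(2) True that by (simp add: mult_le_0_iff)
  ultimately show ?thesis by linarith
next
  case False
  then have "Z < 0" using assms(1) by simp
  then have "- b \<le> d" using assms(3) by (simp add: mult_le_0_iff)
  moreover have "d \<le> a" if "0 < d" using assms(2) \<open>Z < 0\<close> that by (simp add: mult_le_0_iff)
  ultimately show ?thesis by linarith
qed

text \<open>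
  If \<open>u\<close> were an interior point of the ball, then so would be \<open>u + t (f - g)\<close> for small \<open>t\<close>, which
  agrees with \<open>g\<close> before \<open>i\<close> and is closer to \<open>f\<close> at \<open>i\<close>.
\<close>

lemma lex_closest_norming:
  assumes f: "f \<in> carr Y" and g: "lex_closest f g" "agree i g f" "\<phi> i g \<noteq> \<phi> i f"
    and u: "u \<in> carr Y" "agree (Suc i) u g"
  shows "1 \<le> nrm Y u"
proof (rule ccontr)
  assume "\<not> 1 \<le> nrm Y u"
  then have u1: "nrm Y u < 1" by simp
  have gc: "g \<in> carr Y" using g by (simp add: lex_closest_def ball_carr)
  define m where "m = nrm Y (f - g)"
  have m: "m \<ge> 0" using f gc by (simp add: m_def nrm_nonneg)
  define t where "t = (1 - nrm Y u) / (1 + m)"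
  have t: "t > 0" using u1 m by (simp add: t_def)
  have "t * m \<le> 1 - nrm Y u"
    using u1 m by (simp add: t_def divide_simps mult_left_mono)
  then have "nrm Y (u + rscl t (f - g)) \<le> 1"
    using nrm_triangle[of u "rscl t (f - g)"] u f gc t by (simp add: m_def)
  then have "u + rscl t (f - g) \<in> unit_ball Y"
    using u f gc by (simp add: unit_ball_def)
  moreover have "agree i (u + rscl t (f - g)) g"
    using u f gc g(2) by (simp add: agree_def)
  ultimately have "(\<phi> i f - \<phi> i g) * (\<phi> i (u + rscl t (f - g)) - \<phi> i g) \<le> 0"
    using g(1) by (auto simp: lex_closest_def closest_at_def)
  moreover have "\<phi> i (u + rscl t (f - g)) - \<phi> i g = t * (\<phi> i f - \<phi> i g)"
    using u f gc by (simp add: agree_def)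
  ultimately have "t * (\<phi> i f - \<phi> i g)\<^sup>2 \<le> 0"
    by (simp add: power2_eq_square mult.left_commute)
  then show False
    using t g(3) by (simp add: mult_le_0_iff)
qed

text \<open>
  At \<open>i\<close>, the first of the two functionals is changed; before \<open>i\<close>, neither is. If the
  coordinates before \<open>i\<close> force the norm to be at least \<open>1 - \<delta>\<close>, rigidity applies with \<open>w = f - f'\<close>.
  Otherwise some \<open>u\<close> of norm below \<open>1 - \<delta>\<close> has these coordinates. Moving from \<open>g\<close> by
  \<open>f' - f\<close> leaves the ball by at most \<open>\<delta>\<^sup>2 / 4\<close>, which the proportion \<open>s = \<delta> / 4\<close> of \<open>u\<close> compensates; this gives a
  competitor for \<open>g'\<close>, and in the same way \<open>g'\<close> gives one for \<open>g\<close>. So the truncations at \<open>i\<close> differ by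
  little, measured in the norm, and rigidity applies to the coordinates up to \<open>i\<close>.
\<close>

lemma lex_closest_close_at_exit:
  assumes rigid: "rigid \<epsilon> \<delta>" and \<delta>: "0 < \<delta>" "\<delta> \<le> 1"
    and f: "f \<in> carr Y" "f' \<in> carr Y" "nrm Y (f - f') \<le> \<delta>\<^sup>2 / 4"
    and g: "lex_closest f g" "lex_closest f' g'"
    and i: "agree i g f" "agree i g' f'" "\<phi> i g \<noteq> \<phi> i f"
  shows "nrm Y (g - g') \<le> \<epsilon>"
proof -
  define s where "s = \<delta> / 4"
  have s: "0 \<le> s" "s \<le> 1" "s * \<delta> = \<delta>\<^sup>2 / 4" using \<delta> by (auto simp: s_def power2_eq_square)
  have \<delta>2: "\<delta>\<^sup>2 \<le> \<delta>" using \<delta> by (simp add: power2_eq_square mult_left_le_one_le)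
  have gb: "g \<in> unit_ball Y" "g' \<in> unit_ball Y" using g by (auto simp: lex_closest_def)
  then have gc: "g \<in> carr Y" "g' \<in> carr Y" and g1: "nrm Y g \<le> 1" "nrm Y g' \<le> 1"
    by (auto simp: ball_carr ball_nrm)
  show ?thesis
  proof (cases "\<forall>u\<in>carr Y. agree i u g \<longrightarrow> 1 - \<delta> \<le> nrm Y u")
    case True
    show ?thesis
    proof (rule rigidD[OF rigid gb, of "f - f'" i])
      show "agree i (f - f') (g - g')" using i f gc by (simp add: agree_def)
      show "nrm Y (f - f') \<le> \<delta>" using f(3) \<delta>2 \<delta>(1) by linarith
    qed (use f True in auto)
  next
    case False
    then obtain u where u: "u \<in> carr Y" "agree i u g" "nrm Y u \<le> 1 - \<delta>" by force
    define T where "T = f' - f"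
    have T: "T \<in> carr Y" "nrm Y T \<le> \<delta>\<^sup>2 / 4"
      using f nrm_commute[of f f'] by (auto simp: T_def)
    have \<phi>T: "\<phi> l T = \<phi> l f' - \<phi> l f" for l using f by (simp add: T_def)
    have comb: "\<phi> l (rscl (1 - s) x + rscl s y) = (1 - s) * \<phi> l x + s * \<phi> l y"
      if "x \<in> carr Y" "y \<in> carr Y" for x y l
      using that by (simp del: of_real_diff)
    \<comment> \<open>The competitor for \<open>g'\<close>.\<close>
    define x where "x = (rscl (1 - s) g + rscl s u) + T"
    have "nrm Y (rscl (1 - s) g + rscl s u) \<le> (1 - s) * 1 + s * (1 - \<delta>)"
      using gc u g1 s by (intro nrm_convex_combination_le) auto
    then have "nrm Y x \<le> 1"
      using nrm_triangle[of "rscl (1 - s) g + rscl s u" T] gc u T s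
      by (simp add: x_def algebra_simps del: of_real_diff)
    then have "x \<in> unit_ball Y" using gc u T by (simp add: x_def unit_ball_def)
    moreover have \<phi>x: "\<phi> l x = (1 - s) * \<phi> l g + s * \<phi> l u + \<phi> l T" for l
      using gc u T by (simp add: x_def comb del: of_real_diff)
    have "agree i x g'"
      using i u(2) by (simp add: agree_def \<phi>x \<phi>T algebra_simps)
    ultimately have x: "(\<phi> i f' - \<phi> i g') * (\<phi> i x - \<phi> i g') \<le> 0"
      using g(2) by (auto simp: lex_closest_def closest_at_def)
    \<comment> \<open>The competitor for \<open>g\<close>.\<close>
    define y where "y = rscl (1 - s) (g' - T) + rscl s u"
    have "nrm Y (g' - T) \<le> 1 + \<delta>\<^sup>2 / 4"
      using nrm_diff_le[of g' T] gc T g1 by simp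
    then have "nrm Y y \<le> (1 - s) * (1 + \<delta>\<^sup>2 / 4) + s * (1 - \<delta>)"
      unfolding y_def using gc u T s by (intro nrm_convex_combination_le) auto
    also have "\<dots> \<le> 1"
      using s mult_nonneg_nonneg[OF s(1), of "\<delta>\<^sup>2 / 4"] by (simp add: algebra_simps)
    finally have "y \<in> unit_ball Y" using gc u T by (simp add: y_def unit_ball_def)
    moreover have \<phi>y: "\<phi> l y = (1 - s) * (\<phi> l g' - \<phi> l T) + s * \<phi> l u" for l
      using gc u T by (simp add: y_def comb del: of_real_diff)
    have "agree i y g"
      using i u(2) by (simp add: agree_def \<phi>y \<phi>T algebra_simps)
    ultimately have y: "(\<phi> i f - \<phi> i g) * (\<phi> i y - \<phi> i g) \<le> 0"
      using g(1) by (auto simp: lex_closest_def closest_at_def)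
    \<comment> \<open>The difference of the truncations, after the translation by \<open>T\<close>.\<close>
    define d where "d = \<phi> i g' - \<phi> i g - \<phi> i T"
    have alt: "\<bar>d\<bar> \<le> \<bar>s * \<phi> i (u - g)\<bar> \<or> \<bar>d\<bar> \<le> \<bar>s * \<phi> i (u - g' + T)\<bar>"
    proof (rule clamp_displacement)
      show "\<phi> i f - \<phi> i g \<noteq> 0" using i by simp
      show "(\<phi> i f - \<phi> i g - d) * (s * \<phi> i (u - g) - d) \<le> 0"
        using x gc u by (simp add: \<phi>x \<phi>T d_def algebra_simps)
      show "(\<phi> i f - \<phi> i g) * (d + s * \<phi> i (u - g' + T)) \<le> 0"
        using y gc u T by (simp add: \<phi>y \<phi>T d_def algebra_simps)
    qed
    have "\<exists>v\<in>carr Y. agree i v 0 \<and> nrm Y v \<le> 3 \<and> \<bar>d\<bar> \<le> s * \<bar>\<phi> i v\<bar>"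
    proof (rule disjE[OF alt])
      assume "\<bar>d\<bar> \<le> \<bar>s * \<phi> i (u - g)\<bar>"
      moreover have "nrm Y (u - g) \<le> 3"
        using nrm_diff_le[of u g] u gc g1 \<delta> by simp
      moreover have "agree i (u - g) 0"
        using u gc by (simp add: agree_def)
      ultimately show ?thesis
        using u gc s by (intro bexI[of _ "u - g"]) (simp_all add: abs_mult del: \<phi>_diff)
    next
      assume "\<bar>d\<bar> \<le> \<bar>s * \<phi> i (u - g' + T)\<bar>"
      moreover have "nrm Y (u - g' + T) \<le> 3"
        using nrm_triangle[of "u - g'" T] nrm_diff_le[of u g'] u gc g1 \<delta> \<delta>2 T by simp
      moreover have "agree i (u - g' + T) 0"
        using u gc T i by (simp add: agree_def \<phi>T)
      ultimately show ?thesis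
        using u gc T s by (intro bexI[of _ "u - g' + T"]) (simp_all add: abs_mult del: \<phi>_diff \<phi>_add)
    qed
    then obtain v where v: "v \<in> carr Y" "agree i v 0" "nrm Y v \<le> 3" "\<bar>d\<bar> \<le> s * \<bar>\<phi> i v\<bar>"
      by blast
    \<comment> \<open>A multiple of \<open>v\<close> accounts for \<open>d\<close> and does not touch the coordinates before \<open>i\<close>.\<close>
    define \<kappa> where "\<kappa> = (if \<phi> i v = 0 then 0 else d / \<phi> i v)"
    have \<kappa>: "\<kappa> * \<phi> i v = d" "\<bar>\<kappa>\<bar> \<le> s"
      using v(4) s by (auto simp: \<kappa>_def abs_divide divide_le_eq)
    define w where "w = - (T + rscl \<kappa> v)"
    show ?thesis
    proof (rule rigidD[OF rigid gb, of w "Suc i"])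
      show "w \<in> carr Y" using T v by (simp add: w_def)
      show "agree (Suc i) w (g - g')"
        using T v i gc \<kappa> by (auto simp: agree_def w_def \<phi>T less_Suc_eq d_def)
      have "nrm Y w \<le> nrm Y T + \<bar>\<kappa>\<bar> * nrm Y v"
        using nrm_triangle[of T "rscl \<kappa> v"] T v by (simp add: w_def del: minus_add_distrib)
      also have "\<dots> \<le> \<delta>\<^sup>2 / 4 + s * 3"
        using T v \<kappa> s by (intro add_mono mult_mono) (auto simp: nrm_nonneg)
      also have "\<dots> \<le> \<delta>" using \<delta>2 by (simp add: s_def)
      finally show "nrm Y w \<le> \<delta>" .
      show "1 - \<delta> \<le> nrm Y u" if "u \<in> carr Y" "agree (Suc i) u g" for u
        using lex_closest_norming[OF f(1) g(1) i(1,3) that] \<delta> by simp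
    qed
  qed
qed

lemma lex_closest_uniform:
  assumes rigid: "rigid \<epsilon> \<delta>" and \<delta>: "0 < \<delta>" "\<delta> \<le> 1" "\<delta> \<le> \<epsilon>"
    and f: "f \<in> carr Y" "f' \<in> carr Y" "nrm Y (f - f') \<le> \<delta>\<^sup>2 / 4"
    and g: "lex_closest f g" "lex_closest f' g'"
  shows "nrm Y (g - g') \<le> \<epsilon>"
proof (cases "\<exists>i. \<phi> i g \<noteq> \<phi> i f \<or> \<phi> i g' \<noteq> \<phi> i f'")
  case False
  have gc: "g \<in> carr Y" "g' \<in> carr Y" using g by (auto simp: lex_closest_def ball_carr)
  have "g - f = 0" "g' - f' = 0"
    by (rule \<phi>_separates; use False f gc in simp)+
  then have "nrm Y (g - g') \<le> \<delta>\<^sup>2 / 4" using f by simp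
  also have "\<dots> \<le> \<delta>"
    using \<delta> mult_left_le_one_le[of \<delta> \<delta>] by (simp add: power2_eq_square)
  finally show ?thesis using \<delta> by simp
next
  case True
  define i where "i = (LEAST i. \<phi> i g \<noteq> \<phi> i f \<or> \<phi> i g' \<noteq> \<phi> i f')"
  have exit: "\<phi> i g \<noteq> \<phi> i f \<or> \<phi> i g' \<noteq> \<phi> i f'"
    unfolding i_def using True by (rule LeastI_ex)
  have "\<phi> l g = \<phi> l f \<and> \<phi> l g' = \<phi> l f'" if "l < i" for l
    using not_less_Least[OF that[unfolded i_def]] by simp
  then have agree: "agree i g f" "agree i g' f'"
    by (auto simp: agree_def)
  have gc: "g \<in> carr Y" "g' \<in> carr Y" using g by (auto simp: lex_closest_def ball_carr)
  from exit show ?thesis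
  proof
    assume "\<phi> i g \<noteq> \<phi> i f"
    then show ?thesis
      using lex_closest_close_at_exit[OF rigid \<delta>(1,2) f g agree] by simp
  next
    assume "\<phi> i g' \<noteq> \<phi> i f'"
    then show ?thesis
      using lex_closest_close_at_exit[OF rigid \<delta>(1,2) f(2,1) _ g(2,1) agree(2,1)] f
        nrm_commute[of f f'] nrm_commute[of g g'] gc by simp
  qed
qed

end

section \<open>Dual spaces and the weak-star topology\<close>

lemma dual_simps:
  "scl (dual E) = (\<lambda>c f x. c * f x)"
  "nrm (dual E) f = (SUP x\<in>{x \<in> carr E. nrm E x \<le> 1}. norm (f x))"
  by (simp_all add: dual_def)

lemma mem_dual:
  "f \<in> carr (dual E) \<longleftrightarrow> (\<forall>x\<in>carr E. \<forall>y\<in>carr E. f (x + y) = f x + f y) \<and>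
     (\<forall>c. \<forall>x\<in>carr E. f (scl E c x) = c * f x) \<and>
     (\<exists>B. \<forall>x\<in>carr E. norm (f x) \<le> B * nrm E x) \<and> (\<forall>x. x \<notin> carr E \<longrightarrow> f x = 0)"
  by (simp add: dual_def)

context normed_space_on
begin

lemma dual_add: "f \<in> carr (dual E) \<Longrightarrow> x \<in> carr E \<Longrightarrow> y \<in> carr E \<Longrightarrow> f (x + y) = f x + f y"
  by (simp add: mem_dual)

lemma dual_scl: "f \<in> carr (dual E) \<Longrightarrow> x \<in> carr E \<Longrightarrow> f (scl E c x) = c * f x"
  by (simp add: mem_dual)

lemma dual_off: "f \<in> carr (dual E) \<Longrightarrow> x \<notin> carr E \<Longrightarrow> f x = 0"
  by (simp add: mem_dual)

lemma dual_zero [simp]: "f \<in> carr (dual E) \<Longrightarrow> f 0 = 0"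
  using dual_scl[of f 0 0] by simp

lemma dual_diff: "f \<in> carr (dual E) \<Longrightarrow> x \<in> carr E \<Longrightarrow> y \<in> carr E \<Longrightarrow> f (x - y) = f x - f y"
  using dual_add[of f "x - y" y] by simp

lemma dual_bdd:
  assumes "f \<in> carr (dual E)"
  shows "bdd_above ((\<lambda>x. norm (f x)) ` {x \<in> carr E. nrm E x \<le> 1})"
proof -
  obtain B where B: "\<And>x. x \<in> carr E \<Longrightarrow> norm (f x) \<le> B * nrm E x"
    using assms unfolding mem_dual by blast
  show ?thesis
  proof (rule bdd_aboveI[of _ "\<bar>B\<bar>"], clarsimp)
    fix x assume x: "x \<in> carr E" "nrm E x \<le> 1"
    have "B * nrm E x \<le> \<bar>B\<bar> * nrm E x"
      using x by (intro mult_right_mono) (auto simp: nrm_nonneg)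
    also have "\<dots> \<le> \<bar>B\<bar>" using x by (simp add: mult_left_le)
    finally show "norm (f x) \<le> \<bar>B\<bar>" using B[of x] x by simp
  qed
qed

lemma dual_ball_bound:
  assumes "f \<in> carr (dual E)" "x \<in> carr E" "nrm E x \<le> 1"
  shows "norm (f x) \<le> nrm (dual E) f"
  unfolding dual_simps by (rule cSUP_upper2[OF dual_bdd]) (use assms in auto)

lemma dual_nrm_nonneg: "f \<in> carr (dual E) \<Longrightarrow> 0 \<le> nrm (dual E) f"
  using dual_ball_bound[of f 0] by simp

lemma dual_bound:
  assumes f: "f \<in> carr (dual E)" and x: "x \<in> carr E"
  shows "norm (f x) \<le> nrm (dual E) f * nrm E x"
proof (cases "nrm E x = 0")
  case True
  then show ?thesis using f x by (simp add: nrm_eq_0_iff)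
next
  case False
  then have pos: "nrm E x > 0" using nrm_nonneg[OF x] by simp
  then have "norm (f (rscl (inverse (nrm E x)) x)) \<le> nrm (dual E) f"
    using x nrm_rscl[of x "inverse (nrm E x)"] by (intro dual_ball_bound[OF f]) auto
  then show ?thesis
    using pos f x by (simp add: dual_scl norm_divide norm_mult norm_inverse field_simps)
qed

lemma dual_nrm_le:
  assumes "0 \<le> B" "\<And>x. x \<in> carr E \<Longrightarrow> norm (f x) \<le> B * nrm E x"
  shows "nrm (dual E) f \<le> B"
  unfolding dual_simps
proof (rule cSUP_least)
  show "{x \<in> carr E. nrm E x \<le> 1} \<noteq> {}" by (auto intro!: exI[of _ 0])
  fix x assume "x \<in> {x \<in> carr E. nrm E x \<le> 1}"
  then show "norm (f x) \<le> B"
    using assms(2)[of x] assms(1) mult_left_le[of "nrm E x" B] by auto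
qed

lemma dual_norming:
  assumes "c < nrm (dual E) f"
  obtains x where "x \<in> carr E" "nrm E x \<le> 1" "c < norm (f x)"
proof -
  have "\<not> (\<forall>x\<in>{x \<in> carr E. nrm E x \<le> 1}. norm (f x) \<le> c)"
  proof
    assume *: "\<forall>x\<in>{x \<in> carr E. nrm E x \<le> 1}. norm (f x) \<le> c"
    have "nrm (dual E) f \<le> c"
      unfolding dual_simps
      by (rule cSUP_least) (use * in \<open>auto intro!: exI[of _ 0]\<close>)
    then show False using assms by simp
  qed
  then show ?thesis using that by force
qed

lemma normed_space_on_dual: "normed_space_on (dual E)"
proof -
  have vs: "vector_space (scl (dual E))"
    by unfold_locales (auto simp: dual_simps algebra_simps)
  have add: "f + g \<in> carr (dual E) \<and> nrm (dual E) (f + g) \<le> nrm (dual E) f + nrm (dual E) g"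
    if fg: "f \<in> carr (dual E)" "g \<in> carr (dual E)" for f g
  proof -
    have bound: "norm ((f + g) x) \<le> (nrm (dual E) f + nrm (dual E) g) * nrm E x" if "x \<in> carr E" for x
      using norm_triangle_ineq[of "f x" "g x"] dual_bound[OF fg(1) that] dual_bound[OF fg(2) that]
      by (simp add: algebra_simps)
    then have "\<exists>B. \<forall>x\<in>carr E. norm ((f + g) x) \<le> B * nrm E x" by blast
    then have "f + g \<in> carr (dual E)"
      using fg by (simp add: mem_dual algebra_simps)
    moreover have "nrm (dual E) (f + g) \<le> nrm (dual E) f + nrm (dual E) g"
      using bound fg by (intro dual_nrm_le) (auto simp: dual_nrm_nonneg)
    ultimately show ?thesis ..
  qed
  have scl: "scl (dual E) c f \<in> carr (dual E) \<and> nrm (dual E) (scl (dual E) c f) \<le> norm c * nrm (dual E) f"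
    if f: "f \<in> carr (dual E)" for c f
  proof -
    have bound: "norm (scl (dual E) c f x) \<le> (norm c * nrm (dual E) f) * nrm E x" if "x \<in> carr E" for x
      using dual_bound[OF f that] by (simp add: dual_simps(1) norm_mult mult_left_mono mult.assoc)
    then have "\<exists>B. \<forall>x\<in>carr E. norm (c * f x) \<le> B * nrm E x" by (auto simp: dual_simps(1))
    then have "scl (dual E) c f \<in> carr (dual E)"
      using f by (simp add: mem_dual dual_simps(1) algebra_simps)
    moreover have "nrm (dual E) (scl (dual E) c f) \<le> norm c * nrm (dual E) f"
      using bound f by (intro dual_nrm_le) (auto simp: dual_nrm_nonneg)
    ultimately show ?thesis ..
  qed
  show ?thesis
  proof (rule normed_space_onI[OF vs])
    show "0 \<in> carr (dual E)" by (auto simp: mem_dual intro!: exI[of _ 0])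
    show "f = 0" if f: "f \<in> carr (dual E)" and "nrm (dual E) f = 0" for f
    proof
      fix x
      show "f x = 0 x"
        using dual_bound[OF f, of x] dual_off[OF f, of x] that(2) by (cases "x \<in> carr E") auto
    qed
  qed (use add scl dual_nrm_nonneg in blast)+
qed

text \<open>
  Functionals vanish off the carrier, so evaluation at the remaining points of the ambient type
  imposes nothing, and the weak-star topology is the topology of pointwise convergence on all of it.
\<close>

lemma weak_star_topology_eq: "weak_star_topology E = top_of_set (carr (dual E))"
proof -
  let ?V = "carr (dual E)"
  let ?S = "{{f \<in> ?V. f x \<in> U} | x U. x \<in> carr E \<and> open U}"
  have "?V \<in> ?S" by (auto intro!: exI[of _ 0] exI[of _ UNIV])
  then have union: "\<Union> ?S = ?V" by auto
  then have top: "topspace (weak_star_topology E) = ?V"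
    by (simp add: weak_star_topology_def)
  have fun_to_ws: "continuous_map (top_of_set ?V) (weak_star_topology E) (\<lambda>f. f)"
    unfolding weak_star_topology_def
  proof (rule continuous_on_generated_topo)
    fix W assume "W \<in> ?S"
    then obtain x U where W: "W = {f \<in> ?V. f x \<in> U}" and "open U" by blast
    have "open ((\<lambda>f. f x) -` U)"
      using \<open>open U\<close> by (intro open_vimage) auto
    then show "openin (top_of_set ?V) ((\<lambda>f. f) -` W \<inter> topspace (top_of_set ?V))"
      by (force simp: W openin_open vimage_def)
  qed (use union in auto)
  have ws_to_fun: "continuous_map (weak_star_topology E) (top_of_set ?V) (\<lambda>f. f)"
  proof -
    have "continuous_map (weak_star_topology E) euclidean (\<lambda>f. f x)" for x
      unfolding continuous_map_def
    proof (intro conjI allI impI)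
      fix U :: "'k set" assume U: "openin euclidean U"
      show "openin (weak_star_topology E) {f \<in> topspace (weak_star_topology E). f x \<in> U}"
      proof (cases "x \<in> carr E")
        case True
        then show ?thesis
          unfolding top using U
          unfolding weak_star_topology_def by (intro topology_generated_by_Basis) auto
      next
        case False
        have "f \<in> ?V \<and> f x \<in> U \<longleftrightarrow> f \<in> (if 0 \<in> U then ?V else {})" for f
          using dual_off[of f x] False by (cases "f \<in> ?V") auto
        then have "{f \<in> topspace (weak_star_topology E). f x \<in> U}
            = (if 0 \<in> U then topspace (weak_star_topology E) else {})"
          unfolding top by blast
        then show ?thesis by simp
      qed
    qed simp
    then have "continuous_map (weak_star_topology E) euclidean (\<lambda>f. f)"
      using continuous_map_componentwise_UNIV[of "weak_star_topology E" "\<lambda>_. euclidean" "\<lambda>f. f"]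
      by (simp add: euclidean_product_topology)
    then show ?thesis by (simp add: continuous_map_in_subtopology top)
  qed
  show ?thesis
    unfolding topology_eq
  proof (intro allI iffI)
    fix W
    show "openin (top_of_set ?V) W" if "openin (weak_star_topology E) W"
    proof -
      have "W \<subseteq> ?V" using openin_subset[OF that] top by simp
      then have "{f \<in> topspace (top_of_set ?V). f \<in> W} = W" by auto
      then show ?thesis using openin_continuous_map_preimage[OF fun_to_ws that] by simp
    qed
    show "openin (weak_star_topology E) W" if "openin (top_of_set ?V) W"
    proof -
      have "W \<subseteq> ?V" using openin_subset[OF that] by simp
      then have "{f \<in> topspace (weak_star_topology E). f \<in> W} = W" using top by auto
      then show ?thesis using openin_continuous_map_preimage[OF ws_to_fun that] by simp
    qed
  qed
qed

end

text \<open>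
  The Banach--Alaoglu theorem: the ball is a closed subset of a product of compact balls.
\<close>

lemma compact_unit_ball_dual:
  fixes E :: "('k::{real_normed_field, euclidean_space}, 'a::ab_group_add) nspace"
  assumes "normed_space_on E"
  shows "compact (unit_ball (dual E))"
proof -
  interpret normed_space_on E by fact
  define Q where "Q x = (if x \<in> carr E then cball (0::'k) (nrm E x) else {0})" for x
  let ?A = "\<Inter>x\<in>carr E. \<Inter>y\<in>carr E. {f :: 'a \<Rightarrow> 'k. f (x + y) = f x + f y}"
  let ?S = "\<Inter>c. \<Inter>x\<in>carr E. {f :: 'a \<Rightarrow> 'k. f (scl E c x) = c * f x}"
  have "compactin (product_topology (\<lambda>_. euclidean) UNIV) (PiE UNIV Q)"
    unfolding compactin_PiE by (auto simp: Q_def)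
  then have "compact (PiE UNIV Q)"
    by (simp add: euclidean_product_topology)
  moreover have "closed ?A" "closed ?S"
    by (intro closed_INT ballI closed_Collect_eq continuous_intros continuous_on_product_coordinates)+
  ultimately have "compact (PiE UNIV Q \<inter> (?A \<inter> ?S))"
    by (intro compact_Int_closed closed_Int)
  moreover have "PiE UNIV Q \<inter> (?A \<inter> ?S) = unit_ball (dual E)"
  proof (intro equalityI subsetI)
    fix f assume f: "f \<in> PiE UNIV Q \<inter> (?A \<inter> ?S)"
    have Q: "f x \<in> Q x" for x using f by auto
    have bound: "norm (f x) \<le> 1 * nrm E x" if "x \<in> carr E" for x
      using Q[of x] that by (simp add: Q_def)
    have off: "f x = 0" if "x \<notin> carr E" for x
      using Q[of x] that by (simp add: Q_def)
    have "f \<in> carr (dual E)"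
      unfolding mem_dual using f bound off by blast
    moreover have "nrm (dual E) f \<le> 1"
      using bound by (intro dual_nrm_le) auto
    ultimately show "f \<in> unit_ball (dual E)" by (simp add: unit_ball_def)
  next
    fix f assume "f \<in> unit_ball (dual E)"
    then have f: "f \<in> carr (dual E)" "nrm (dual E) f \<le> 1" by (auto simp: unit_ball_def)
    have "f x \<in> Q x" for x
    proof (cases "x \<in> carr E")
      case True
      then have "norm (f x) \<le> nrm (dual E) f * nrm E x" by (rule dual_bound[OF f(1)])
      also have "\<dots> \<le> 1 * nrm E x" using True f by (intro mult_right_mono) (auto simp: nrm_nonneg)
      finally show ?thesis using True by (simp add: Q_def)
    qed (simp add: Q_def dual_off[OF f(1)])
    then show "f \<in> PiE UNIV Q \<inter> (?A \<inter> ?S)"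
      using f by (auto simp: mem_dual)
  qed
  ultimately show ?thesis by simp
qed

definition separates_dual :: "('k::real_normed_field, 'a::ab_group_add) nspace \<Rightarrow> 'a set \<Rightarrow> bool" where
  "separates_dual E D \<longleftrightarrow> D \<subseteq> carr E \<and> (\<forall>f\<in>carr (dual E). (\<forall>x\<in>D. f x = 0) \<longrightarrow> f = 0)"

text \<open>
  Evaluation on a countable separating set is a continuous injection of the compact ball into a
  Hausdorff space, hence a homeomorphism onto its image. Continuity into the ball can therefore be
  tested on that set.
\<close>

lemma continuous_on_if_separating:
  fixes E :: "('k::{real_normed_field, euclidean_space}, 'a::ab_group_add) nspace"
  assumes E: "normed_space_on E" and D: "countable D" "separates_dual E D"
    and r: "\<And>z. z \<in> Z \<Longrightarrow> r z \<in> unit_ball (dual E)"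
    and cont: "\<And>x. x \<in> D \<Longrightarrow> continuous_on Z (\<lambda>z. r z x)"
  shows "continuous_on Z r"
proof -
  interpret normed_space_on E by fact
  interpret dual: normed_space_on "dual E" by (rule normed_space_on_dual)
  let ?B = "unit_ball (dual E)"
  define \<psi> :: "('a \<Rightarrow> 'k) \<Rightarrow> nat \<Rightarrow> 'k" where "\<psi> f n = (if D = {} then 0 else f (from_nat_into D n))" for f n
  have \<psi>: "continuous_on S \<psi>" for S
    unfolding \<psi>_def
    by (cases "D = {}") (auto intro!: continuous_on_coordinatewise_then_product continuous_on_subset[OF continuous_on_product_coordinates])
  have inj: "inj_on \<psi> ?B"
  proof (rule inj_onI)
    fix f g assume fg: "f \<in> ?B" "g \<in> ?B" "\<psi> f = \<psi> g"
    have "f x = g x" if "x \<in> D" for x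
    proof -
      obtain n where "x = from_nat_into D n"
        using from_nat_into_surj[OF D(1) \<open>x \<in> D\<close>] by metis
      then show ?thesis using fun_cong[OF fg(3), of n] \<open>x \<in> D\<close> by (auto simp: \<psi>_def split: if_splits)
    qed
    then have "\<forall>x\<in>D. (f - g) x = 0" by simp
    then have "f - g = 0"
      using D(2) fg dual.carr_diff[of f g] unfolding separates_dual_def unit_ball_def by blast
    then show "f = g" by simp
  qed
  have inv: "continuous_on (\<psi> ` ?B) (the_inv_into ?B \<psi>)"
    by (rule continuous_on_inv_into[OF \<psi> compact_unit_ball_dual[OF E] inj])
  have "continuous_on Z (\<lambda>z. \<psi> (r z))"
  proof (rule continuous_on_coordinatewise_then_product)
    fix n
    show "continuous_on Z (\<lambda>z. \<psi> (r z) n)"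
      using cont[OF from_nat_into] by (cases "D = {}") (simp_all add: \<psi>_def)
  qed
  then have "continuous_on Z (\<lambda>z. the_inv_into ?B \<psi> (\<psi> (r z)))"
    by (rule continuous_on_compose2[OF inv]) (use r in auto)
  then show ?thesis
    by (rule continuous_on_eq) (use r in \<open>simp add: the_inv_into_f_f[OF inj]\<close>)
qed

text \<open>
  Take points at which the members of a countable dense set of functionals attain half of their
  norms. A functional that vanishes at all of them is close to a member of this set, which then has small norm.
\<close>

lemma separable_dual_imp_separating:
  fixes E :: "('k::real_normed_field, 'a::ab_group_add) nspace"
  assumes E: "normed_space_on E" and sep: "norm_separable (dual E)"
  obtains D where "countable D" "separates_dual E D"
proof -
  interpret normed_space_on E by fact
  interpret dual: normed_space_on "dual E" by (rule normed_space_on_dual)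
  obtain F where F: "countable F" "F \<subseteq> carr (dual E)"
    and dense: "\<And>f e. f \<in> carr (dual E) \<Longrightarrow> e > 0 \<Longrightarrow> \<exists>d\<in>F. nrm (dual E) (f - d) < e"
    using sep unfolding norm_separable_def by blast
  have "\<exists>x. x \<in> carr E \<and> nrm E x \<le> 1 \<and> nrm (dual E) f / 2 \<le> norm (f x)" if "f \<in> F" for f
  proof (cases "nrm (dual E) f = 0")
    case True
    then show ?thesis by (intro exI[of _ 0]) auto
  next
    case False
    then have "nrm (dual E) f / 2 < nrm (dual E) f"
      using F that dual.nrm_nonneg[of f] by auto
    then show ?thesis by (meson dual_norming less_imp_le)
  qed
  then obtain x where x: "\<And>f. f \<in> F \<Longrightarrow> x f \<in> carr E" "\<And>f. f \<in> F \<Longrightarrow> nrm E (x f) \<le> 1"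
    "\<And>f. f \<in> F \<Longrightarrow> nrm (dual E) f / 2 \<le> norm (f (x f))"
    by metis
  have "f = 0" if f: "f \<in> carr (dual E)" "\<forall>y\<in>x ` F. f y = 0" for f
  proof -
    have "nrm (dual E) f \<le> 0 + e" if "e > 0" for e
    proof -
      obtain d where d: "d \<in> F" "nrm (dual E) (f - d) < e / 3"
        using dense[OF f(1), of "e / 3"] \<open>e > 0\<close> by (metis divide_pos_pos zero_less_numeral)
      then have dc: "d \<in> carr (dual E)" using F by auto
      have "norm ((f - d) (x d)) \<le> nrm (dual E) (f - d)"
        using d x by (intro dual_ball_bound[OF dual.carr_diff[OF f(1) dc]]) auto
      then have "nrm (dual E) d / 2 \<le> nrm (dual E) (f - d)"
        using x(3)[OF d(1)] f(2) d(1) by simp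
      then show ?thesis
        using dual.nrm_le_add_diff[OF f(1) dc] d by simp
    qed
    then have "nrm (dual E) f \<le> 0" by (rule field_le_epsilon)
    then show ?thesis using dual.nrm_nonneg[OF f(1)] dual.nrm_eq_0_iff[OF f(1)] by simp
  qed
  then have "separates_dual E (x ` F)"
    using x(1) by (auto simp: separates_dual_def)
  then show ?thesis using that F(1) by blast
qed

section \<open>Retractions of rigid dual balls\<close>

definition agree_on :: "('a \<times> 'k::real_inner) set \<Rightarrow> ('a \<Rightarrow> 'k) \<Rightarrow> ('a \<Rightarrow> 'k) \<Rightarrow> bool" where
  "agree_on S f g \<longleftrightarrow> (\<forall>(x, b)\<in>S. f x \<bullet> b = g x \<bullet> b)"

text \<open>
  Rigidity of the dual with respect to the real coordinates at points of \<open>D\<close>. Arbitrary sets \<open>S\<close> of coordinates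
  are admitted in place of initial segments, so that the notion does not depend on an enumeration.
\<close>

definition weak_star_rigid ::
  "('k::{real_normed_field, euclidean_space}, 'a::ab_group_add) nspace \<Rightarrow> 'a set \<Rightarrow> real \<Rightarrow> real \<Rightarrow> bool" where
  "weak_star_rigid E D \<epsilon> \<delta> \<longleftrightarrow>
     (\<forall>S. \<forall>g\<in>unit_ball (dual E). \<forall>h\<in>unit_ball (dual E). \<forall>w\<in>carr (dual E).
        S \<subseteq> D \<times> Basis \<and> agree_on S w (g - h) \<and> nrm (dual E) w \<le> \<delta> \<and>
        (\<forall>u\<in>carr (dual E). agree_on S u g \<longrightarrow> 1 - \<delta> \<le> nrm (dual E) u)
          \<longrightarrow> nrm (dual E) (g - h) \<le> \<epsilon>)"

text \<open>
  The lexicographically closest point with respect to an enumeration of the coordinates at \<open>D\<close>. The last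
  conclusion gives a modulus of uniform continuity in terms of rigidity alone, so that it
  is common to all members of a uniformly rigid family. The point \<open>0\<close>, at which all
  functionals vanish, is added to \<open>D\<close> in the proof to have an enumeration if \<open>D\<close> is empty.
\<close>

lemma retraction_if_rigid:
  fixes E :: "('k::{real_normed_field, euclidean_space}, 'a::ab_group_add) nspace"
  assumes E: "normed_space_on E" and D: "countable D" "separates_dual E D"
    and rigid: "\<And>\<epsilon>. 0 < \<epsilon> \<Longrightarrow> \<exists>\<delta>>0. weak_star_rigid E D \<epsilon> \<delta>"
  obtains r where "\<And>f. r f \<in> unit_ball (dual E)" "\<And>f. f \<in> unit_ball (dual E) \<Longrightarrow> r f = f"
    "continuous_on (carr (dual E)) r"
    "\<And>\<epsilon> \<delta> f g. weak_star_rigid E D \<epsilon> \<delta> \<Longrightarrow> 0 < \<delta> \<Longrightarrow> \<delta> \<le> 1 \<Longrightarrow> \<delta> \<le> \<epsilon> \<Longrightarrow>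
       f \<in> carr (dual E) \<Longrightarrow> g \<in> carr (dual E) \<Longrightarrow> nrm (dual E) (f - g) \<le> \<delta>\<^sup>2 / 4 \<Longrightarrow>
       nrm (dual E) (r f - r g) \<le> \<epsilon>"
proof -
  interpret normed_space_on E by fact
  interpret dual: normed_space_on "dual E" by (rule normed_space_on_dual)
  define P where "P = (insert 0 D) \<times> (Basis :: 'k set)"
  have P: "countable P" "P \<noteq> {}"
    using D by (auto simp: P_def intro!: countable_SIGMA countable_insert countable_finite[OF finite_Basis])
  define c where "c = from_nat_into P"
  have cP: "c n \<in> P" for n unfolding c_def by (rule from_nat_into[OF P(2)])
  have surj: "\<exists>n. c n = xb" if "xb \<in> P" for xb
    unfolding c_def by (rule from_nat_into_surj[OF P(1) that])
  have c_carr: "fst (c n) \<in> carr E" and c_basis: "snd (c n) \<in> Basis" for n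
    using cP[of n] D by (auto simp: P_def separates_dual_def)
  define \<phi> where "\<phi> n f = f (fst (c n)) \<bullet> snd (c n)" for n and f :: "'a \<Rightarrow> 'k"
  have \<phi>_cont: "continuous_on S (\<phi> n)" for S n
    unfolding \<phi>_def
    by (intro continuous_on_inner continuous_on_const continuous_on_subset[OF continuous_on_product_coordinates]) auto
  interpret C: coordinatized_space "dual E" \<phi>
  proof unfold_locales
    fix f g n and a :: real assume f: "f \<in> carr (dual E)"
    show "\<phi> n (f + g) = \<phi> n f + \<phi> n g"
      by (simp add: \<phi>_def inner_add_left)
    show "\<phi> n (scl (dual E) (of_real a) f) = a * \<phi> n f"
      by (simp add: \<phi>_def dual_simps(1) scaleR_conv_of_real[symmetric])
  next
    fix n
    have "\<bar>\<phi> n f\<bar> \<le> nrm E (fst (c n)) * nrm (dual E) f" if "f \<in> carr (dual E)" for f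
      using Basis_le_norm[OF c_basis[of n], of "f (fst (c n))"] dual_bound[OF that c_carr[of n]]
      by (simp add: \<phi>_def mult.commute)
    then show "\<exists>C. \<forall>f\<in>carr (dual E). \<bar>\<phi> n f\<bar> \<le> C * nrm (dual E) f" by blast
  next
    fix f assume f: "f \<in> carr (dual E)" "\<And>n. \<phi> n f = 0"
    have "f x = 0" if "x \<in> D" for x
    proof (rule euclidean_eqI)
      fix b :: 'k assume "b \<in> Basis"
      then have "(x, b) \<in> P" using \<open>x \<in> D\<close> by (simp add: P_def)
      then obtain n where "c n = (x, b)" using surj by blast
      then show "f x \<bullet> b = 0 \<bullet> b" using f(2)[of n] by (simp add: \<phi>_def)
    qed
    then show "f = 0" using D f by (auto simp: separates_dual_def)
  next
    fix g :: "nat \<Rightarrow> 'a \<Rightarrow> 'k" assume g: "\<And>k. g k \<in> unit_ball (dual E)"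
    let ?\<Phi> = "\<lambda>f n. \<phi> n f"
    have "compact (?\<Phi> ` unit_ball (dual E))"
      by (intro compact_continuous_image compact_unit_ball_dual[OF E]
          continuous_on_coordinatewise_then_product \<phi>_cont)
    then have "seq_compact (?\<Phi> ` unit_ball (dual E))" by (rule compact_imp_seq_compact)
    moreover have "\<forall>k. ?\<Phi> (g k) \<in> ?\<Phi> ` unit_ball (dual E)" using g by blast
    ultimately obtain L s where L: "L \<in> ?\<Phi> ` unit_ball (dual E)" "strict_mono s"
      "((\<lambda>k. ?\<Phi> (g k)) \<circ> s) \<longlonglongrightarrow> L"
      by (rule seq_compactE)
    then obtain l where l: "l \<in> unit_ball (dual E)" "L = ?\<Phi> l" by blast
    have "(\<lambda>k. \<phi> n (g (s k))) \<longlonglongrightarrow> \<phi> n l" for n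
    proof -
      have "continuous_on UNIV (\<lambda>z :: nat \<Rightarrow> real. z n)"
        by (rule continuous_on_product_coordinates)
      then have "isCont (\<lambda>z :: nat \<Rightarrow> real. z n) (?\<Phi> l)"
        by (simp only: continuous_on_eq_continuous_at[OF open_UNIV] UNIV_I)
      then show ?thesis
        using isCont_tendsto_compose[of "?\<Phi> l" "\<lambda>z. z n" _ sequentially] L(3) l(2) by (auto simp: o_def)
    qed
    then show "\<exists>s l. strict_mono s \<and> l \<in> unit_ball (dual E) \<and> (\<forall>n. (\<lambda>k. \<phi> n (g (s k))) \<longlonglongrightarrow> \<phi> n l)"
      using L(2) l(1) by blast
  qed
  have agree: "C.agree n f g \<longleftrightarrow> agree_on (c ` {..<n} \<inter> D \<times> Basis) f g"
    if "f \<in> carr (dual E)" "g \<in> carr (dual E)" for n f g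
  proof
    assume a: "agree_on (c ` {..<n} \<inter> D \<times> Basis) f g"
    have "\<phi> l f = \<phi> l g" if "l < n" for l
    proof (cases "c l \<in> D \<times> Basis")
      case True
      then have "c l \<in> c ` {..<n} \<inter> D \<times> Basis" using that by blast
      then show ?thesis
        using bspec[OF a[unfolded agree_on_def]] by (simp add: \<phi>_def case_prod_beta)
    next
      case False
      then have "fst (c l) = 0" using cP[of l] by (auto simp: P_def)
      then show ?thesis using \<open>f \<in> carr (dual E)\<close> \<open>g \<in> carr (dual E)\<close> by (simp add: \<phi>_def)
    qed
    then show "C.agree n f g" by (simp add: C.agree_def)
  qed (auto simp: C.agree_def agree_on_def \<phi>_def case_prod_beta)
  have C_rigid: "C.rigid \<epsilon> \<delta>" if r: "weak_star_rigid E D \<epsilon> \<delta>" for \<epsilon> \<delta>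
    unfolding C.rigid_def
  proof (intro allI ballI impI, elim conjE)
    fix n g h w
    assume gh: "g \<in> unit_ball (dual E)" "h \<in> unit_ball (dual E)" and w: "w \<in> carr (dual E)"
      "C.agree n w (g - h)" "nrm (dual E) w \<le> \<delta>"
      and u: "\<forall>u\<in>carr (dual E). C.agree n u g \<longrightarrow> 1 - \<delta> \<le> nrm (dual E) u"
    have c: "g \<in> carr (dual E)" "h \<in> carr (dual E)" using gh by (auto simp: unit_ball_def)
    show "nrm (dual E) (g - h) \<le> \<epsilon>"
      using r[unfolded weak_star_rigid_def, rule_format, of g h w "c ` {..<n} \<inter> D \<times> Basis"] gh c w u
      by (auto simp: agree)
  qed
  then have C_rigid_ex: "\<exists>\<delta>>0. C.rigid \<epsilon> \<delta>" if "0 < \<epsilon>" for \<epsilon>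
    using rigid[OF that] by blast
  define r where "r f = (SOME g. C.lex_closest f g)" for f
  have r: "C.lex_closest f (r f)" for f
    unfolding r_def by (rule someI_ex[OF C.lex_closest_exists])
  then have r_ball: "r f \<in> unit_ball (dual E)" for f
    by (simp add: C.lex_closest_def)
  have \<phi>r: "continuous_on (carr (dual E)) (\<lambda>f. \<phi> n (r f))" for n
    unfolding continuous_on_def tendsto_iff
  proof (intro ballI allI impI)
    fix f and e :: real assume f: "f \<in> carr (dual E)" and e: "0 < e"
    obtain d where d: "d > 0" "\<And>f' g'. C.lex_closest f' g' \<Longrightarrow> (\<forall>l\<le>n. \<bar>\<phi> l f' - \<phi> l f\<bar> < d) \<Longrightarrow>
        \<bar>\<phi> n g' - \<phi> n (r f)\<bar> < e"
      using C.lex_closest_continuous[OF C_rigid_ex r e] by metis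
    have "\<forall>\<^sub>F f' in at f within carr (dual E). dist (\<phi> l f') (\<phi> l f) < d" for l
      using \<phi>_cont[of "carr (dual E)" l] f d(1) unfolding continuous_on_def tendsto_iff by blast
    then have "\<forall>\<^sub>F f' in at f within carr (dual E). \<forall>l\<in>{..n}. dist (\<phi> l f') (\<phi> l f) < d"
      by (intro eventually_ball_finite) auto
    then show "\<forall>\<^sub>F f' in at f within carr (dual E). dist (\<phi> n (r f')) (\<phi> n (r f)) < e"
      by eventually_elim (use d(2)[OF r] in \<open>auto simp: dist_real_def\<close>)
  qed
  have "continuous_on (carr (dual E)) (\<lambda>f. r f x)" if x: "x \<in> D" for x
  proof -
    have "continuous_on (carr (dual E)) (\<lambda>f. r f x \<bullet> b)" if b: "b \<in> Basis" for b
    proof -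
      have "(x, b) \<in> P" using x b by (simp add: P_def)
      then obtain n where "c n = (x, b)" using surj by blast
      then show ?thesis using \<phi>r[of n] by (simp add: \<phi>_def)
    qed
    then have "continuous_on (carr (dual E)) (\<lambda>f. \<Sum>b\<in>Basis. (r f x \<bullet> b) *\<^sub>R b)"
      by (intro continuous_on_sum continuous_on_scaleR continuous_on_const)
    then show ?thesis by (simp add: euclidean_representation)
  qed
  then have "continuous_on (carr (dual E)) r"
    by (intro continuous_on_if_separating[OF E D r_ball])
  moreover have "r f = f" if "f \<in> unit_ball (dual E)" for f
    by (rule C.lex_closest_ball[OF that r])
  moreover have "nrm (dual E) (r f - r g) \<le> \<epsilon>"
    if "weak_star_rigid E D \<epsilon> \<delta>" "0 < \<delta>" "\<delta> \<le> 1" "\<delta> \<le> \<epsilon>" "f \<in> carr (dual E)" "g \<in> carr (dual E)"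
      "nrm (dual E) (f - g) \<le> \<delta>\<^sup>2 / 4" for \<epsilon> \<delta> f g
    using C.lex_closest_uniform[OF C_rigid[OF that(1)] that(2-7) r r] .
  ultimately show ?thesis using that r_ball by blast
qed

lemma usc_retractionI:
  fixes E :: "('k::real_normed_field, 'a::ab_group_add) nspace"
  assumes E: "normed_space_on E"
    and r: "\<And>f. f \<in> carr (dual E) \<Longrightarrow> r f \<in> unit_ball (dual E)" "\<And>f. f \<in> unit_ball (dual E) \<Longrightarrow> r f = f"
    "continuous_on (carr (dual E)) r"
    and unif: "\<And>\<epsilon>. 0 < \<epsilon> \<Longrightarrow> \<exists>d>0. \<forall>f\<in>carr (dual E). \<forall>g\<in>carr (dual E).
      nrm (dual E) (f - g) < d \<longrightarrow> nrm (dual E) (r f - r g) \<le> \<epsilon>"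
  shows "dual_admits_usc_retraction E"
proof -
  interpret normed_space_on E by fact
  have B: "unit_ball (dual E) \<subseteq> carr (dual E)" by (auto simp: unit_ball_def)
  have "continuous_map (weak_star_topology E) (subtopology (weak_star_topology E) (unit_ball (dual E))) r"
    unfolding weak_star_topology_eq using r B
    by (auto simp: continuous_map_in_subtopology subtopology_subtopology)
  moreover have "\<exists>d>0. \<forall>f\<in>carr (dual E). \<forall>g\<in>carr (dual E).
      nrm (dual E) (f - g) < d \<longrightarrow> nrm (dual E) (r f - r g) < \<epsilon>" if "0 < \<epsilon>" for \<epsilon>
    using unif[of "\<epsilon> / 2"] that by (smt (verit) field_sum_of_halves half_gt_zero)
  ultimately show ?thesis
    unfolding dual_admits_usc_retraction_def using r by blast
qed

section \<open>Uniform convexity and rigidity\<close>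

text \<open>
  Uniform convexity in the form in which it is used: for pairs in a ball of any radius \<open>M\<close>, and not only for
  pairs of unit vectors.
\<close>

definition convex_at :: "('k::real_normed_field, 'v::ab_group_add) nspace \<Rightarrow> real \<Rightarrow> real \<Rightarrow> bool" where
  "convex_at Y \<epsilon> \<tau> \<longleftrightarrow> (\<forall>f\<in>carr Y. \<forall>g\<in>carr Y. \<forall>M.
     nrm Y f \<le> M \<and> nrm Y g \<le> M \<and> (1 - \<tau>) * M \<le> nrm Y (scl Y (1/2) (f + g)) \<longrightarrow> nrm Y (f - g) \<le> \<epsilon> * M)"

lemma (in normed_space_on) nrm_half: "x \<in> carr E \<Longrightarrow> nrm E (scl E (1/2) x) = nrm E x / 2"
  using nrm_scl[of x "1/2"] by (simp add: norm_divide)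

text \<open>
  If the midpoint of \<open>f\<close> and \<open>g\<close> has norm at least \<open>(1 - \<tau>) M\<close>, both norms are at least \<open>(1 - 2 \<tau>) M\<close>, so that
  normalizing \<open>f\<close> and \<open>g\<close> to norm \<open>M\<close> moves each by at most \<open>2 \<tau> M\<close>. The modulus applies to the normalized pair.
\<close>

lemma convex_at_if_modulus:
  fixes Y :: "('k::real_normed_field, 'v::ab_group_add) nspace"
  assumes Y: "normed_space_on Y" and \<epsilon>: "0 < \<epsilon>" and \<tau>: "0 < \<tau>" "\<tau> \<le> \<epsilon> / 8" "\<tau> \<le> 1 / 8"
    and mod: "ereal (4 * \<tau>) \<le> modulus_of_convexity Y (min (\<epsilon> / 2) (1/2))"
  shows "convex_at Y \<epsilon> \<tau>"
  unfolding convex_at_def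
proof (intro ballI allI impI, elim conjE)
  interpret normed_space_on Y by fact
  fix f g M assume f: "f \<in> carr Y" "nrm Y f \<le> M" and g: "g \<in> carr Y" "nrm Y g \<le> M"
    and mid: "(1 - \<tau>) * M \<le> nrm Y (scl Y (1/2) (f + g))"
  have M: "M \<ge> 0" using f nrm_nonneg[OF f(1)] by simp
  show "nrm Y (f - g) \<le> \<epsilon> * M"
  proof (cases "M = 0")
    case True
    then show ?thesis using nrm_diff_le[OF f(1) g(1)] f g by simp
  next
    case False
    then have Mpos: "M > 0" using M by simp
    define a where "a = nrm Y f"
    define b where "b = nrm Y g"
    have "(1 - \<tau>) * M \<le> (a + b) / 2"
      using mid nrm_triangle[OF f(1) g(1)] f g by (simp add: nrm_half a_def b_def)
    then have ab: "(1 - 2 * \<tau>) * M \<le> a" "(1 - 2 * \<tau>) * M \<le> b"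
      using f g by (simp_all add: a_def b_def algebra_simps)
    moreover have "0 < (1 - 2 * \<tau>) * M" using Mpos \<tau> by simp
    ultimately have pos: "a > 0" "b > 0" by linarith+
    define x where "x = rscl (1 / a) f"
    define y where "y = rscl (1 / b) g"
    have x: "x \<in> carr Y" "nrm Y x = 1" using f pos nrm_rscl[of f "1 / a"] by (simp_all add: x_def a_def)
    have y: "y \<in> carr Y" "nrm Y y = 1" using g pos nrm_rscl[of g "1 / b"] by (simp_all add: y_def b_def)
    have near: "nrm Y (z - rscl M (rscl (1 / c) z)) \<le> 2 * \<tau> * M"
      if z: "z \<in> carr Y" "nrm Y z = c" "c > 0" "c \<le> M" "(1 - 2 * \<tau>) * M \<le> c" for z c
    proof -
      have "z - rscl M (rscl (1 / c) z) = rscl (1 - M / c) z"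
        by (simp add: scale_left_diff_distrib)
      then have "nrm Y (z - rscl M (rscl (1 / c) z)) = \<bar>1 - M / c\<bar> * c"
        using z nrm_rscl[of z "1 - M / c"] by (simp del: of_real_diff)
      also have "\<dots> = M - c" using z by (simp add: abs_if field_simps)
      finally show ?thesis using z by (simp add: algebra_simps)
    qed
    have fx: "nrm Y (f - rscl M x) \<le> 2 * \<tau> * M"
      unfolding x_def by (rule near) (use f pos ab a_def in auto)
    have gy: "nrm Y (g - rscl M y) \<le> 2 * \<tau> * M"
      unfolding y_def by (rule near) (use g pos ab b_def in auto)
    have tri: "nrm Y p \<le> nrm Y q + (nrm Y u + nrm Y v)"
      if "p = q + (u + v)" "q \<in> carr Y" "u \<in> carr Y" "v \<in> carr Y" for p q u v
      using nrm_triangle[of q "u + v"] nrm_triangle[of u v] that by simp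
    have "nrm Y (f + g) \<le> nrm Y (rscl M (x + y)) + (nrm Y (f - rscl M x) + nrm Y (g - rscl M y))"
      by (rule tri) (use f g x y in \<open>simp_all add: scale_right_distrib\<close>)
    also have "nrm Y (rscl M (x + y)) = M * nrm Y (x + y)"
      using Mpos x y nrm_rscl[of "x + y" M] by simp
    finally have "(1 - \<tau>) * M \<le> (M * nrm Y (x + y) + 4 * \<tau> * M) / 2"
      using mid fx gy f g by (simp add: nrm_half)
    then have "M * (1 - 3 * \<tau>) \<le> M * (nrm Y (x + y) / 2)" by (simp add: algebra_simps)
    then have big: "1 - 3 * \<tau> \<le> nrm Y (scl Y (1/2) (x + y))"
      using Mpos x y by (simp add: nrm_half)
    have "nrm Y (x - y) < min (\<epsilon> / 2) (1/2)"
    proof (rule ccontr)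
      assume "\<not> nrm Y (x - y) < min (\<epsilon> / 2) (1/2)"
      then have "modulus_of_convexity Y (min (\<epsilon> / 2) (1/2)) \<le> ereal (1 - nrm Y (scl Y (1/2) (x + y)))"
        unfolding modulus_of_convexity_def using x y by (intro Inf_lower) force
      with mod have "ereal (4 * \<tau>) \<le> ereal (1 - nrm Y (scl Y (1/2) (x + y)))" by (rule order_trans)
      then show False using big \<tau> by simp
    qed
    then have xy: "M * nrm Y (x - y) \<le> M * (\<epsilon> / 2)"
      using Mpos by (intro mult_left_mono) auto
    have "nrm Y (f - g) \<le> nrm Y (rscl M (x - y)) + (nrm Y (f - rscl M x) + nrm Y (rscl M y - g))"
      by (rule tri) (use f g x y in \<open>simp_all add: scale_right_diff_distrib\<close>)
    also have "nrm Y (rscl M y - g) = nrm Y (g - rscl M y)"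
      using g y by (intro nrm_commute) auto
    also have "nrm Y (rscl M (x - y)) = M * nrm Y (x - y)"
      using Mpos x y nrm_rscl[of "x - y" M] by simp
    also have "M * nrm Y (x - y) + (nrm Y (f - rscl M x) + nrm Y (g - rscl M y)) \<le> M * (\<epsilon> / 2) + 4 * \<tau> * M"
      using xy fx gy by simp
    also have "\<dots> \<le> M * (\<epsilon> / 2) + 4 * (\<epsilon> / 8) * M"
      using \<tau> Mpos by (intro add_left_mono mult_right_mono) auto
    also have "\<dots> = \<epsilon> * M" by (simp add: algebra_simps)
    finally show ?thesis .
  qed
qed

lemma uniformly_convex_at:
  fixes Y :: "'i \<Rightarrow> ('k::real_normed_field, 'v::ab_group_add) nspace"
  assumes Y: "\<And>i. normed_space_on (Y i)"
    and mod: "\<And>\<epsilon>. 0 < \<epsilon> \<Longrightarrow> \<epsilon> < 1 \<Longrightarrow> 0 < (INF i. modulus_of_convexity (Y i) \<epsilon>)"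
    and \<epsilon>: "0 < \<epsilon>"
  shows "\<exists>\<tau>>0. \<tau> < 1 \<and> (\<forall>i. convex_at (Y i) \<epsilon> \<tau>)"
proof -
  \<comment> \<open>The modulus is controlled for arguments below \<open>1\<close> only.\<close>
  let ?e = "min (\<epsilon> / 2) (1/2)"
  have "0 < (INF i. modulus_of_convexity (Y i) ?e)" using \<epsilon> by (intro mod) auto
  then obtain c where c: "0 < ereal c" "ereal c < (INF i. modulus_of_convexity (Y i) ?e)"
    using ereal_dense2 by blast
  define \<tau> where "\<tau> = min (c / 4) (min (\<epsilon> / 8) (1 / 8))"
  have \<tau>: "0 < \<tau>" "\<tau> \<le> \<epsilon> / 8" "\<tau> \<le> 1 / 8" "4 * \<tau> \<le> c" using c(1) \<epsilon> by (auto simp: \<tau>_def)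
  have "convex_at (Y i) \<epsilon> \<tau>" for i
  proof (rule convex_at_if_modulus[OF Y \<epsilon> \<tau>(1-3)])
    have "ereal (4 * \<tau>) \<le> ereal c" using \<tau> by simp
    also have "\<dots> \<le> (INF i. modulus_of_convexity (Y i) ?e)" using c by simp
    also have "\<dots> \<le> modulus_of_convexity (Y i) ?e" by (rule INF_lower) simp
    finally show "ereal (4 * \<tau>) \<le> modulus_of_convexity (Y i) ?e" .
  qed
  then show ?thesis using \<tau> by (intro exI[of _ \<tau>]) auto
qed

text \<open>
  The midpoint of \<open>g\<close> and \<open>h + w\<close> has the coordinates of \<open>g\<close>, so its norm is at least \<open>1 - \<delta>\<close>, while both end
  points lie in the ball of radius \<open>1 + \<delta>\<close>.
\<close>

lemma rigid_if_convex_at: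
  fixes E :: "('k::{real_normed_field, euclidean_space}, 'a::ab_group_add) nspace"
  assumes E: "normed_space_on E" and conv: "convex_at (dual E) \<epsilon>' \<tau>"
    and \<epsilon>': "0 < \<epsilon>'" and \<delta>: "0 < \<delta>" "\<delta> \<le> 1" "2 * \<delta> \<le> \<tau>" "2 * \<epsilon>' + \<delta> \<le> \<epsilon>" and \<tau>: "\<tau> < 1"
  shows "weak_star_rigid E D \<epsilon> \<delta>"
  unfolding weak_star_rigid_def
proof (intro allI ballI impI, elim conjE)
  interpret E: normed_space_on E by fact
  interpret dual: normed_space_on "dual E" by (rule E.normed_space_on_dual)
  fix S g h w
  assume g: "g \<in> unit_ball (dual E)" and h: "h \<in> unit_ball (dual E)" and w: "w \<in> carr (dual E)"
    and S: "agree_on S w (g - h)" "nrm (dual E) w \<le> \<delta>"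
    and u: "\<forall>u\<in>carr (dual E). agree_on S u g \<longrightarrow> 1 - \<delta> \<le> nrm (dual E) u"
  have gh: "g \<in> carr (dual E)" "h \<in> carr (dual E)" "nrm (dual E) g \<le> 1" "nrm (dual E) h \<le> 1"
    using g h by (auto simp: unit_ball_def)
  have N: "nrm (dual E) g \<le> 1 + \<delta>" "nrm (dual E) (h + w) \<le> 1 + \<delta>"
    using gh \<delta> dual.nrm_triangle[OF gh(2) w] S by auto
  have half: "scl (dual E) (1/2) z x \<bullet> b = z x \<bullet> b / 2" for z x b
    using inner_scaleR_left[of "1/2" "z x" b] by (simp add: dual_simps(1) scaleR_conv_of_real)
  have "agree_on S (scl (dual E) (1/2) (g + (h + w))) g"
    using S(1) by (auto simp: agree_on_def half inner_add_left inner_diff_left)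
  then have "1 - \<delta> \<le> nrm (dual E) (scl (dual E) (1/2) (g + (h + w)))"
    using gh w by (intro u[rule_format] dual.carr_scl dual.carr_add)
  moreover have "(1 - \<tau>) * (1 + \<delta>) \<le> 1 - \<delta>"
  proof -
    have "0 \<le> \<tau> * \<delta>" using \<delta> by simp
    then show ?thesis using \<delta>(3) by (simp add: algebra_simps)
  qed
  ultimately have "(1 - \<tau>) * (1 + \<delta>) \<le> nrm (dual E) (scl (dual E) (1/2) (g + (h + w)))"
    by (rule order_trans[rotated])
  then have "nrm (dual E) (g - (h + w)) \<le> \<epsilon>' * (1 + \<delta>)"
    using conv[unfolded convex_at_def, rule_format, of g "h + w" "1 + \<delta>"] N gh(1) dual.carr_add[OF gh(2) w]
    by blast
  also have "\<dots> \<le> \<epsilon>' * 2" using \<epsilon>' \<delta> by (intro mult_left_mono) auto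
  finally have "nrm (dual E) (g - (h + w)) \<le> 2 * \<epsilon>'" by simp
  then show "nrm (dual E) (g - h) \<le> \<epsilon>"
    using dual.nrm_triangle[of "g - (h + w)" w] gh w S \<delta> by simp
qed

lemma uniformly_rigid:
  fixes X :: "'i \<Rightarrow> ('k::{real_normed_field, euclidean_space}, 'a::ab_group_add) nspace"
  assumes X: "\<And>i. normed_space_on (X i)"
    and conv: "\<And>\<epsilon>. 0 < \<epsilon> \<Longrightarrow> \<exists>\<tau>>0. \<tau> < 1 \<and> (\<forall>i. convex_at (dual (X i)) \<epsilon> \<tau>)"
    and \<epsilon>: "0 < \<epsilon>"
  shows "\<exists>\<delta>>0. \<delta> \<le> 1 \<and> \<delta> \<le> \<epsilon> \<and> (\<forall>i. weak_star_rigid (X i) (D i) \<epsilon> \<delta>)"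
proof -
  obtain \<tau> where \<tau>: "0 < \<tau>" "\<tau> < 1" "\<And>i. convex_at (dual (X i)) (\<epsilon> / 4) \<tau>"
    using conv[of "\<epsilon> / 4"] \<epsilon> by auto
  define \<delta> where "\<delta> = min (\<tau> / 2) (\<epsilon> / 2)"
  have \<delta>: "0 < \<delta>" "\<delta> \<le> 1" "2 * \<delta> \<le> \<tau>" "2 * (\<epsilon> / 4) + \<delta> \<le> \<epsilon>" "\<delta> \<le> \<epsilon>"
    using \<tau> \<epsilon> by (auto simp: \<delta>_def)
  have "weak_star_rigid (X i) (D i) \<epsilon> \<delta>" for i
    by (rule rigid_if_convex_at[OF X \<tau>(3)]) (use \<delta> \<tau> \<epsilon> in auto)
  then show ?thesis using \<delta> by blast
qed

section \<open>Functionals on direct sums\<close>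

definition single :: "nat \<Rightarrow> 'a::zero \<Rightarrow> nat \<Rightarrow> 'a" where
  "single k x = (\<lambda>i. if i = k then x else 0)"

definition component ::
  "(nat \<Rightarrow> ('k::real_normed_field, 'a::ab_group_add) nspace) \<Rightarrow> ((nat \<Rightarrow> 'a) \<Rightarrow> 'k) \<Rightarrow> nat \<Rightarrow> 'a \<Rightarrow> 'k" where
  "component X F k = (\<lambda>x. if x \<in> carr (X k) then F (single k x) else 0)"

lemma component_minus: "component X (F - G) k = component X F k - component X G k"
  by (auto simp: component_def fun_eq_iff)

text \<open>
  What \<open>c\<^sub>0\<close>-sums and \<open>\<ell>\<^sub>p\<close>-sums with \<open>p < \<infinity>\<close> have in common: the summands are embedded isometrically, and
  finitely supported families are dense, so that functionals are determined by their components.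
\<close>

locale sum_space = E: normed_space_on E
  for E :: "('k::{real_normed_field, euclidean_space}, nat \<Rightarrow> 'a::ab_group_add) nspace" +
  fixes X :: "nat \<Rightarrow> ('k, 'a) nspace"
  assumes X: "\<And>k. normed_space_on (X k)"
    and scl_eq: "scl E = (\<lambda>c x i. scl (X i) c (x i))"
    and carr_component: "x \<in> carr E \<Longrightarrow> x k \<in> carr (X k)"
    and carr_single: "y \<in> carr (X k) \<Longrightarrow> single k y \<in> carr E"
    and nrm_single: "y \<in> carr (X k) \<Longrightarrow> nrm E (single k y) = nrm (X k) y"
    and truncation: "x \<in> carr E \<Longrightarrow> (\<lambda>n. nrm E (x - (\<Sum>k<n. single k (x k)))) \<longlonglongrightarrow> 0"
begin

lemma normed_space_duals: "normed_space_on (dual E)" "normed_space_on (dual (X k))"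
  by (rule E.normed_space_on_dual normed_space_on.normed_space_on_dual[OF X])+

lemma component_dual:
  assumes F: "F \<in> carr (dual E)"
  shows "component X F k \<in> carr (dual (X k))" "nrm (dual (X k)) (component X F k) \<le> nrm (dual E) F"
proof -
  interpret X: normed_space_on "X k" by (rule X)
  have add: "single k (x + y) = single k x + single k y" for x y :: 'a
    by (auto simp: single_def)
  have scl: "single k (scl (X k) c x) = scl E c (single k x)" for c x
  proof
    fix i
    interpret Xi: normed_space_on "X i" by (rule X)
    show "single k (scl (X k) c x) i = scl E c (single k x) i"
      by (auto simp: single_def scl_eq)
  qed
  have bound: "norm (component X F k x) \<le> nrm (dual E) F * nrm (X k) x" if "x \<in> carr (X k)" for x
    using E.dual_bound[OF F carr_single[OF that]] that by (simp add: component_def nrm_single)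
  then have "\<exists>B. \<forall>x\<in>carr (X k). norm (component X F k x) \<le> B * nrm (X k) x" by blast
  then show "component X F k \<in> carr (dual (X k))"
    unfolding mem_dual
    by (auto simp: component_def add scl E.dual_add[OF F] E.dual_scl[OF F] carr_single)
  show "nrm (dual (X k)) (component X F k) \<le> nrm (dual E) F"
    using bound by (intro X.dual_nrm_le E.dual_nrm_nonneg[OF F])
qed

lemma sum_single_carr:
  assumes "\<And>k. k < n \<Longrightarrow> x k \<in> carr (X k)"
  shows "(\<Sum>k<n. single k (x k)) \<in> carr E"
  using assms by (induction n) (auto simp: carr_single)

lemma dual_sum_single:
  assumes F: "F \<in> carr (dual E)" and x: "\<And>k. k < n \<Longrightarrow> x k \<in> carr (X k)"
  shows "F (\<Sum>k<n. single k (x k)) = (\<Sum>k<n. component X F k (x k))"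
  using x by (induction n) (auto simp: F E.dual_add[OF F] carr_single sum_single_carr component_def)

lemma component_sums:
  assumes F: "F \<in> carr (dual E)" and x: "x \<in> carr E"
  shows "(\<lambda>k. component X F k (x k)) sums F x"
proof -
  have trunc: "(\<Sum>k<n. single k (x k)) \<in> carr E" for n
    using carr_component[OF x] by (intro sum_single_carr)
  have lim: "(\<lambda>n. nrm (dual E) F * nrm E (x - (\<Sum>k<n. single k (x k)))) \<longlonglongrightarrow> 0"
    using tendsto_mult_left[OF truncation[OF x], of "nrm (dual E) F"] by simp
  have bound: "norm ((\<Sum>k<n. component X F k (x k)) - F x) \<le> nrm (dual E) F * nrm E (x - (\<Sum>k<n. single k (x k)))" for n
    using E.dual_bound[OF F E.carr_diff[OF x trunc[of n]]] carr_component[OF x]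
    by (simp add: E.dual_diff[OF F x trunc] dual_sum_single[OF F] norm_minus_commute)
  have "(\<lambda>n. (\<Sum>k<n. component X F k (x k)) - F x) \<longlonglongrightarrow> 0"
    by (rule Lim_null_comparison[OF always_eventually[OF allI[OF bound]] lim])
  then show ?thesis unfolding sums_def by (rule LIM_zero_cancel)
qed

lemma dual_eqI:
  assumes "F \<in> carr (dual E)" "G \<in> carr (dual E)" "\<And>k. component X F k = component X G k"
  shows "F = G"
proof
  fix x
  show "F x = G x"
  proof (cases "x \<in> carr E")
    case True
    have "(\<lambda>k. component X G k (x k)) sums F x"
      using component_sums[OF assms(1) True] by (simp only: assms(3))
    then show ?thesis
      using component_sums[OF assms(2) True] by (rule sums_unique2)
  qed (simp add: assms E.dual_off)
qed

lemma separates_dual_sum: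
  assumes D: "\<And>k. separates_dual (X k) (D k)"
  shows "separates_dual E (\<Union>k. single k ` D k)"
  unfolding separates_dual_def
proof (intro conjI ballI impI)
  show "(\<Union>k. single k ` D k) \<subseteq> carr E"
  proof clarify
    fix k y assume "y \<in> D k"
    then show "single k y \<in> carr E"
      using D[of k] by (intro carr_single) (auto simp: separates_dual_def)
  qed
  fix F assume F: "F \<in> carr (dual E)" "\<forall>x\<in>\<Union>k. single k ` D k. F x = 0"
  have 0: "0 \<in> carr (dual E)" using normed_space_duals(1) by (simp add: normed_space_on.carr_zero)
  show "F = 0"
  proof (rule dual_eqI[OF F(1) 0])
    fix k
    have "\<forall>x\<in>D k. component X F k x = 0" using F(2) by (auto simp: component_def)
    then have "component X F k = 0"
      using D[of k] component_dual(1)[OF F(1), of k] unfolding separates_dual_def by blast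
    then show "component X F k = component X 0 k" by (auto simp: component_def)
  qed
qed

text \<open>
  The functional is \<open>x \<mapsto> (\<Sum>k. G k (x k))\<close>.
\<close>

lemma functional_of_components:
  assumes G: "\<And>k. G k \<in> carr (dual (X k))" and M: "0 \<le> M"
    and bound: "\<And>x n. x \<in> carr E \<Longrightarrow> (\<Sum>k<n. norm (G k (x k))) \<le> M * nrm E x"
  shows "\<exists>F\<in>carr (dual E). (\<forall>k. component X F k = G k) \<and> nrm (dual E) F \<le> M"
proof -
  define F where "F x = (if x \<in> carr E then \<Sum>k. G k (x k) else 0)" for x
  have snorm: "summable (\<lambda>k. norm (G k (x k)))" if "x \<in> carr E" for x
  proof (rule bounded_imp_summable)
    show "(\<Sum>k\<le>n. norm (G k (x k))) \<le> M * nrm E x" for n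
      using bound[OF that, of "Suc n"] by (simp only: lessThan_Suc_atMost)
  qed simp
  have s: "summable (\<lambda>k. G k (x k))" if "x \<in> carr E" for x
    by (rule summable_norm_cancel[OF snorm[OF that]])
  have Fb: "norm (F x) \<le> M * nrm E x" if x: "x \<in> carr E" for x
  proof -
    have "norm (F x) \<le> (\<Sum>k. norm (G k (x k)))"
      using summable_norm[OF snorm[OF x]] x by (simp add: F_def)
    also have "\<dots> \<le> M * nrm E x"
      by (rule suminf_le_const[OF snorm[OF x] bound[OF x]])
    finally show ?thesis .
  qed
  have Gadd: "G k (x + y) = G k x + G k y" if "x \<in> carr (X k)" "y \<in> carr (X k)" for k x y
    using G[of k] that by (simp add: mem_dual)
  have Gscl: "G k (scl (X k) c x) = c * G k x" if "x \<in> carr (X k)" for k c x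
    using G[of k] that by (simp add: mem_dual)
  have "F \<in> carr (dual E)"
    unfolding mem_dual
  proof (intro conjI ballI allI impI)
    fix x y assume xy: "x \<in> carr E" "y \<in> carr E"
    show "F (x + y) = F x + F y"
      using xy suminf_add[OF s[OF xy(1)] s[OF xy(2)]]
      by (simp add: F_def Gadd carr_component)
  next
    fix c x assume x: "x \<in> carr E"
    show "F (scl E c x) = c * F x"
      using x E.carr_scl[OF x, of c] suminf_mult[OF s[OF x], of c] 
      by (simp add: F_def scl_eq Gscl carr_component)
  next
    show "\<exists>B. \<forall>x\<in>carr E. norm (F x) \<le> B * nrm E x" using Fb by blast
  qed (simp add: F_def)
  moreover have "component X F k = G k" for k
  proof
    fix x
    show "component X F k x = G k x"
    proof (cases "x \<in> carr (X k)")
      case True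
      have "G i (single k x i) = (if i = k then G k x else 0)" for i
        using normed_space_on.dual_zero[OF X G, of i] by (simp add: single_def)
      then have "(\<Sum>i. G i (single k x i)) = G k x"
        using suminf_finite[of "{k}" "\<lambda>i. G i (single k x i)"] by simp
      then show ?thesis using True by (simp add: component_def F_def carr_single)
    next
      case False
      then show ?thesis using G[of k] by (simp add: component_def mem_dual)
    qed
  qed
  moreover have "nrm (dual E) F \<le> M" by (rule E.dual_nrm_le[OF M Fb])
  ultimately show ?thesis by blast
qed

text \<open>
  Test \<open>F\<close> on a family whose \<open>k\<close>-th member has norm at most \<open>t k\<close>, nearly norms the \<open>k\<close>-th component and is
  rotated to make its value there nonnegative. This is the converse of the Hoelder inequality, with the norm of
  the sum entering through \<open>L\<close> only.
\<close>

lemma sum_component_norms_le: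
  assumes F: "F \<in> carr (dual E)" and t: "\<And>k. k < n \<Longrightarrow> 0 \<le> t k"
    and L: "\<And>x. (\<And>k. x k \<in> carr (X k)) \<Longrightarrow> (\<And>k. k < n \<Longrightarrow> nrm (X k) (x k) \<le> t k) \<Longrightarrow>
      nrm E (\<Sum>k<n. single k (x k)) \<le> L"
  shows "(\<Sum>k<n. t k * nrm (dual (X k)) (component X F k)) \<le> nrm (dual E) F * L"
proof (rule field_le_epsilon)
  fix e :: real assume e: "e > 0"
  define T where "T = (\<Sum>k<n. t k)"
  have T: "0 \<le> T" unfolding T_def by (intro sum_nonneg t) simp
  define \<eta> where "\<eta> = e / (1 + T)"
  have \<eta>: "\<eta> > 0" "T * \<eta> \<le> e" using e T by (simp_all add: \<eta>_def field_simps)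
  have "\<exists>x. x \<in> carr (X k) \<and> nrm (X k) x \<le> 1 \<and>
      component X F k x = of_real (norm (component X F k x)) \<and>
      nrm (dual (X k)) (component X F k) - \<eta> \<le> norm (component X F k x)" for k
  proof -
    interpret X: normed_space_on "X k" by (rule X)
    let ?f = "component X F k"
    have f: "?f \<in> carr (dual (X k))" by (rule component_dual(1)[OF F])
    obtain y where y: "y \<in> carr (X k)" "nrm (X k) y \<le> 1" "nrm (dual (X k)) ?f - \<eta> < norm (?f y)"
      using X.dual_norming[of "nrm (dual (X k)) ?f - \<eta>" ?f] \<eta> by auto
    define c where "c = (if ?f y = 0 then 1 else of_real (norm (?f y)) / ?f y)"
    have c: "norm c = 1" "c * ?f y = of_real (norm (?f y))"
      by (auto simp: c_def norm_divide)
    show ?thesis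
      using y c X.nrm_scl[OF y(1), of c]
      by (intro exI[of _ "scl (X k) c y"]) (simp add: X.dual_scl[OF f])
  qed
  then obtain x where x: "\<And>k. x k \<in> carr (X k)" "\<And>k. nrm (X k) (x k) \<le> 1"
    "\<And>k. component X F k (x k) = of_real (norm (component X F k (x k)))"
    "\<And>k. nrm (dual (X k)) (component X F k) - \<eta> \<le> norm (component X F k (x k))"
    by metis
  define y where "y k = scl (X k) (of_real (t k)) (x k)" for k
  have y: "y k \<in> carr (X k)" for k
    using x(1)[of k] normed_space_on.carr_scl[OF X] by (simp add: y_def)
  have yt: "nrm (X k) (y k) \<le> t k" if "k < n" for k
  proof -
    have "nrm (X k) (y k) = t k * nrm (X k) (x k)"
      using t[OF that] normed_space_on.nrm_scl[OF X x(1), of k] by (simp add: y_def)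
    also have "\<dots> \<le> t k" using t[OF that] x(2) by (simp add: mult_left_le)
    finally show ?thesis .
  qed
  have "F (\<Sum>k<n. single k (y k)) = (\<Sum>k<n. component X F k (y k))"
    using y by (intro dual_sum_single[OF F])
  also have "\<dots> = (\<Sum>k<n. of_real (t k * norm (component X F k (x k))))"
  proof (rule sum.cong[OF refl])
    fix k
    show "component X F k (y k) = of_real (t k * norm (component X F k (x k)))"
      using normed_space_on.dual_scl[OF X component_dual(1)[OF F] x(1), of k "of_real (t k)"] x(3)[of k]
      by (simp add: y_def)
  qed
  also have "\<dots> = of_real (\<Sum>k<n. t k * norm (component X F k (x k)))" by simp
  finally have "norm (F (\<Sum>k<n. single k (y k))) = (\<Sum>k<n. t k * norm (component X F k (x k)))"
    by (simp only: norm_of_real) (auto intro!: abs_of_nonneg sum_nonneg t mult_nonneg_nonneg)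
  then have "(\<Sum>k<n. t k * norm (component X F k (x k))) \<le> nrm (dual E) F * nrm E (\<Sum>k<n. single k (y k))"
    using E.dual_bound[OF F sum_single_carr[of n y]] y by simp
  also have "\<dots> \<le> nrm (dual E) F * L"
    using y yt by (intro mult_left_mono L E.dual_nrm_nonneg[OF F])
  finally have *: "(\<Sum>k<n. t k * norm (component X F k (x k))) \<le> nrm (dual E) F * L" .
  have "(\<Sum>k<n. t k * nrm (dual (X k)) (component X F k)) \<le> (\<Sum>k<n. t k * (norm (component X F k (x k)) + \<eta>))"
    using t x(4) by (intro sum_mono mult_left_mono) (auto simp: algebra_simps)
  also have "\<dots> = (\<Sum>k<n. t k * norm (component X F k (x k))) + T * \<eta>"
    by (simp add: T_def algebra_simps sum.distrib sum_distrib_left)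
  finally show "(\<Sum>k<n. t k * nrm (dual (X k)) (component X F k)) \<le> nrm (dual E) F * L + e"
    using * \<eta> by simp
qed

end

section \<open>Duals that are sup-sums or l_q-sums\<close>

text \<open>
  The dual is the \<open>\<ell>\<^sub>\<infinity>\<close>-sum of the duals of the summands, and the retraction acts on every
  component separately. The common modulus of the components is what makes it uniformly continuous.
\<close>

lemma (in sum_space) retraction_if_sup_dual:
  assumes sup_dual: "\<And>G M. (\<And>k. G k \<in> carr (dual (X k))) \<Longrightarrow> 0 \<le> M \<Longrightarrow> (\<And>k. nrm (dual (X k)) (G k) \<le> M) \<Longrightarrow>
      \<exists>F\<in>carr (dual E). (\<forall>k. component X F k = G k) \<and> nrm (dual E) F \<le> M"
    and D: "\<And>k. countable (D k)" "\<And>k. separates_dual (X k) (D k)"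
    and rigid: "\<And>\<epsilon>. 0 < \<epsilon> \<Longrightarrow> \<exists>\<delta>>0. \<delta> \<le> 1 \<and> \<delta> \<le> \<epsilon> \<and> (\<forall>k. weak_star_rigid (X k) (D k) \<epsilon> \<delta>)"
  shows "dual_admits_usc_retraction E"
proof -
  interpret dual: normed_space_on "dual E" by (rule E.normed_space_on_dual)
  let ?P = "\<lambda>k r. (\<forall>f. r f \<in> unit_ball (dual (X k))) \<and> (\<forall>f\<in>unit_ball (dual (X k)). r f = f) \<and>
    continuous_on (carr (dual (X k))) r \<and>
    (\<forall>\<epsilon> \<delta> f g. weak_star_rigid (X k) (D k) \<epsilon> \<delta> \<longrightarrow> 0 < \<delta> \<longrightarrow> \<delta> \<le> 1 \<longrightarrow> \<delta> \<le> \<epsilon> \<longrightarrow>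
       f \<in> carr (dual (X k)) \<longrightarrow> g \<in> carr (dual (X k)) \<longrightarrow> nrm (dual (X k)) (f - g) \<le> \<delta>\<^sup>2 / 4 \<longrightarrow>
       nrm (dual (X k)) (r f - r g) \<le> \<epsilon>)"
  have "\<exists>r. ?P k r" for k
  proof -
    have "\<exists>\<delta>>0. weak_star_rigid (X k) (D k) \<epsilon> \<delta>" if "0 < \<epsilon>" for \<epsilon>
      using rigid[OF that] by blast
    then obtain r where "\<And>f. r f \<in> unit_ball (dual (X k))" "\<And>f. f \<in> unit_ball (dual (X k)) \<Longrightarrow> r f = f"
      "continuous_on (carr (dual (X k))) r"
      "\<And>\<epsilon> \<delta> f g. weak_star_rigid (X k) (D k) \<epsilon> \<delta> \<Longrightarrow> 0 < \<delta> \<Longrightarrow> \<delta> \<le> 1 \<Longrightarrow> \<delta> \<le> \<epsilon> \<Longrightarrow>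
        f \<in> carr (dual (X k)) \<Longrightarrow> g \<in> carr (dual (X k)) \<Longrightarrow> nrm (dual (X k)) (f - g) \<le> \<delta>\<^sup>2 / 4 \<Longrightarrow>
        nrm (dual (X k)) (r f - r g) \<le> \<epsilon>"
      using retraction_if_rigid[OF X D(1) D(2), of k] by blast
    then show ?thesis by (intro exI[of _ r]) blast
  qed
  then obtain r where r: "\<And>k. ?P k (r k)" by metis
  have r_ball: "r k f \<in> carr (dual (X k))" "nrm (dual (X k)) (r k f) \<le> 1" for k f
    using r[of k] by (auto simp: unit_ball_def)
  define R where "R F = (SOME F'. F' \<in> carr (dual E) \<and> (\<forall>k. component X F' k = r k (component X F k)) \<and>
    nrm (dual E) F' \<le> 1)" for F
  have "\<exists>F'. F' \<in> carr (dual E) \<and> (\<forall>k. component X F' k = r k (component X F k)) \<and> nrm (dual E) F' \<le> 1" for F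
    using sup_dual[of "\<lambda>k. r k (component X F k)" 1] r_ball by auto
  then have "R F \<in> carr (dual E) \<and> (\<forall>k. component X (R F) k = r k (component X F k)) \<and> nrm (dual E) (R F) \<le> 1" for F
    unfolding R_def by (rule someI_ex)
  then have R: "R F \<in> unit_ball (dual E)" "R F \<in> carr (dual E)" "component X (R F) k = r k (component X F k)" for F k
    by (auto simp: unit_ball_def)
  show ?thesis
  proof (rule usc_retractionI[OF E.normed_space_on_axioms])
    show "R F \<in> unit_ball (dual E)" for F by (rule R)
    show "R F = F" if "F \<in> unit_ball (dual E)" for F
    proof (rule dual_eqI)
      show F: "F \<in> carr (dual E)" using that by (simp add: unit_ball_def)
      fix k
      have "component X F k \<in> unit_ball (dual (X k))"
        using component_dual[OF F, of k] that by (auto simp: unit_ball_def)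
      then show "component X (R F) k = component X F k"
        using r[of k] R(3) by simp
    qed (rule R)
    show "continuous_on (carr (dual E)) R"
    proof (rule continuous_on_if_separating[OF E.normed_space_on_axioms _ separates_dual_sum[OF D(2)] R(1)])
      show "countable (\<Union>k. single k ` D k)" using D(1) by auto
      fix x assume "x \<in> (\<Union>k. single k ` D k)"
      then obtain k y where y: "x = single k y" "y \<in> D k" by auto
      then have yc: "y \<in> carr (X k)" using D(2)[of k] by (auto simp: separates_dual_def)
      have rk: "continuous_on (carr (dual (X k))) (r k)" using r[of k] by blast
      have "continuous_on (carr (dual E)) (\<lambda>F. component X F k)"
      proof (rule continuous_on_coordinatewise_then_product)
        fix z
        show "continuous_on (carr (dual E)) (\<lambda>F. component X F k z)"
          by (cases "z \<in> carr (X k)")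
            (auto simp: component_def intro: continuous_on_subset[OF continuous_on_product_coordinates])
      qed
      then have "continuous_on (carr (dual E)) (\<lambda>F. r k (component X F k))"
        by (rule continuous_on_compose2[OF rk]) (use component_dual(1) in blast)
      then have "continuous_on (carr (dual E)) (\<lambda>F. r k (component X F k) y)"
        by (rule continuous_on_product_then_coordinatewise)
      moreover have "R F x = r k (component X F k) y" for F
        using fun_cong[OF R(3)[of F k], of y] y yc by (simp add: component_def)
      ultimately show "continuous_on (carr (dual E)) (\<lambda>F. R F x)" by simp
    qed
    fix \<epsilon> :: real assume \<epsilon>: "0 < \<epsilon>"
    obtain \<delta> where \<delta>: "0 < \<delta>" "\<delta> \<le> 1" "\<delta> \<le> \<epsilon>" "\<And>k. weak_star_rigid (X k) (D k) \<epsilon> \<delta>"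
      using rigid[OF \<epsilon>] by blast
    have "nrm (dual E) (R F - R G) \<le> \<epsilon>"
      if FG: "F \<in> carr (dual E)" "G \<in> carr (dual E)" "nrm (dual E) (F - G) < \<delta>\<^sup>2 / 4" for F G
    proof -
      have "nrm (dual (X k)) (r k (component X F k) - r k (component X G k)) \<le> \<epsilon>" for k
      proof -
        have "nrm (dual (X k)) (component X F k - component X G k) \<le> \<delta>\<^sup>2 / 4"
          using component_dual(2)[OF dual.carr_diff[OF FG(1,2)], of k] FG(3) by (simp add: component_minus)
        then show ?thesis
          using r[of k] \<delta> component_dual(1)[OF FG(1), of k] component_dual(1)[OF FG(2), of k] by blast
      qed
      then have "\<exists>H\<in>carr (dual E). (\<forall>k. component X H k = r k (component X F k) - r k (component X G k)) \<and>
          nrm (dual E) H \<le> \<epsilon>"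
        using \<epsilon> r_ball normed_space_on.carr_diff[OF normed_space_duals(2)] by (intro sup_dual) auto
      then obtain H where H: "H \<in> carr (dual E)" "\<And>k. component X H k = r k (component X F k) - r k (component X G k)"
        "nrm (dual E) H \<le> \<epsilon>" by blast
      have "H = R F - R G"
        by (rule dual_eqI) (use H R in \<open>auto simp: component_minus simp del: fun_diff_def\<close>)
      then show ?thesis using H(3) by simp
    qed
    then show "\<exists>d>0. \<forall>F\<in>carr (dual E). \<forall>G\<in>carr (dual E).
        nrm (dual E) (F - G) < d \<longrightarrow> nrm (dual E) (R F - R G) \<le> \<epsilon>"
      using \<delta>(1) by (intro exI[of _ "\<delta>\<^sup>2 / 4"]) auto
  qed
qed

text \<open>
  The dual is the \<open>\<ell>\<^sub>q\<close>-sum of the duals of the summands, by an isometry. Bounds on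
  the partial sums express summability and the value of the norm at once.
\<close>

locale lq_dual_sum_space = sum_space E X
  for E :: "('k::{real_normed_field, euclidean_space}, nat \<Rightarrow> 'a::ab_group_add) nspace" and X +
  fixes q :: real
  assumes q: "1 \<le> q"
    and lq_lower: "F \<in> carr (dual E) \<Longrightarrow>
      (\<Sum>k<n. nrm (dual (X k)) (component X F k) powr q) \<le> nrm (dual E) F powr q"
    and lq_upper: "(\<And>k. G k \<in> carr (dual (X k))) \<Longrightarrow> 0 \<le> M \<Longrightarrow>
      (\<And>n. (\<Sum>k<n. nrm (dual (X k)) (G k) powr q) \<le> M powr q) \<Longrightarrow>
      \<exists>F\<in>carr (dual E). (\<forall>k. component X F k = G k) \<and> nrm (dual E) F \<le> M"
begin

lemma lq_norm:
  assumes F: "F \<in> carr (dual E)"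
  shows "(\<lambda>k. nrm (dual (X k)) (component X F k) powr q) sums (nrm (dual E) F powr q)"
proof -
  let ?a = "\<lambda>k. nrm (dual (X k)) (component X F k) powr q"
  have s: "summable ?a"
  proof (rule bounded_imp_summable)
    show "(\<Sum>k\<le>n. ?a k) \<le> nrm (dual E) F powr q" for n
      using lq_lower[OF F, of "Suc n"] by (simp only: lessThan_Suc_atMost)
  qed simp
  have le: "suminf ?a \<le> nrm (dual E) F powr q"
    by (rule suminf_le_const[OF s lq_lower[OF F]])
  have nn: "0 \<le> suminf ?a" by (rule suminf_nonneg[OF s]) simp
  define M where "M = suminf ?a powr (1 / q)"
  have Mq: "M powr q = suminf ?a" using q nn by (simp add: M_def powr_powr)
  have "(\<Sum>k<n. ?a k) \<le> M powr q" for n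
    unfolding Mq by (rule sum_le_suminf[OF s]) auto
  then obtain F' where F': "F' \<in> carr (dual E)" "\<And>k. component X F' k = component X F k" "nrm (dual E) F' \<le> M"
    using lq_upper[of "component X F" M] component_dual(1)[OF F] by (auto simp: M_def)
  have "F' = F" by (rule dual_eqI[OF F'(1) F F'(2)])
  then have "nrm (dual E) F \<le> M" using F' by simp
  then have "nrm (dual E) F powr q \<le> suminf ?a"
    unfolding Mq[symmetric] using q E.dual_nrm_nonneg[OF F] by (intro powr_mono2) auto
  then show ?thesis using le summable_sums[OF s] by simp
qed

end

text \<open>
  In the application \<open>A\<close>, \<open>B\<close> and \<open>C\<close> are the norms of two vectors and of their midpoint, \<open>D\<close> is the norm of their
  difference, and \<open>m\<close> is the least of the first three. With \<open>M = max A B\<close>, either \<open>C\<close> is at least \<open>(1 - \<tau>) M\<close>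
  and \<open>D\<close> is small by convexity, or \<open>m\<close> is so much smaller than \<open>M\<close> that the gap
  \<open>M powr q - m powr q\<close> dominates a multiple of \<open>M powr q\<close>. The right-hand side is the sum of both bounds
  and can be summed over the components.
\<close>

lemma powr_gap:
  fixes A B C D m e q \<tau> :: real
  assumes q: "1 \<le> q" and \<tau>: "0 < \<tau>" "\<tau> < 1" and m: "0 \<le> m" "m \<le> A" "m \<le> B" "m \<le> C"
    and D: "0 \<le> D" "D \<le> A + B" and e: "0 \<le> e"
    and conv: "\<And>M. A \<le> M \<Longrightarrow> B \<le> M \<Longrightarrow> (1 - \<tau>) * M \<le> C \<Longrightarrow> D \<le> e * M"
  shows "D powr q \<le> e powr q * (A powr q + B powr q) +
    2 powr q / (1 - (1 - \<tau>) powr q) * ((A powr q - m powr q) + (B powr q - m powr q))"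
proof -
  define M where "M = max A B"
  have M: "A \<le> M" "B \<le> M" "0 \<le> M" using m by (auto simp: M_def)
  have mono: "m powr q \<le> A powr q" "m powr q \<le> B powr q" using m q by (auto intro: powr_mono2)
  have MA: "M powr q \<le> A powr q + B powr q"
    and gap: "M powr q - m powr q \<le> (A powr q - m powr q) + (B powr q - m powr q)"
    using mono by (auto simp: M_def max_def)
  have "(1 - \<tau>) powr q < 1 powr q" using \<tau> q by (intro powr_less_mono2) auto
  then have \<kappa>: "0 < 1 - (1 - \<tau>) powr q" by simp
  show ?thesis
  proof (cases "(1 - \<tau>) * M \<le> C")
    case True
    then have "D powr q \<le> (e * M) powr q" using conv M D q by (intro powr_mono2) auto
    also have "\<dots> = e powr q * M powr q" using e M by (simp add: powr_mult)
    also have "\<dots> \<le> e powr q * (A powr q + B powr q)" using MA by (intro mult_left_mono) auto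
    finally show ?thesis
      using \<kappa> mono by (smt (verit) divide_nonneg_pos mult_nonneg_nonneg powr_ge_zero)
  next
    case False
    then have "m \<le> (1 - \<tau>) * M" using m by simp
    then have "m powr q \<le> ((1 - \<tau>) * M) powr q" using m q by (intro powr_mono2) auto
    also have "\<dots> = (1 - \<tau>) powr q * M powr q" using \<tau> M by (simp add: powr_mult)
    finally have "(1 - (1 - \<tau>) powr q) * M powr q \<le> M powr q - m powr q" by (simp add: algebra_simps)
    also note gap
    finally have "M powr q \<le> ((A powr q - m powr q) + (B powr q - m powr q)) / (1 - (1 - \<tau>) powr q)"
      using \<kappa> by (simp add: pos_le_divide_eq mult.commute)
    then have "2 powr q * M powr q \<le> 2 powr q * (((A powr q - m powr q) + (B powr q - m powr q)) / (1 - (1 - \<tau>) powr q))"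
      by (intro mult_left_mono) auto
    moreover have "D powr q \<le> (2 * M) powr q" using D M q by (intro powr_mono2) auto
    moreover have "(2 * M) powr q = 2 powr q * M powr q" using M by (simp add: powr_mult)
    moreover have "0 \<le> e powr q * (A powr q + B powr q)" by simp
    ultimately show ?thesis
      unfolding times_divide_eq_right times_divide_eq_left by linarith
  qed
qed

lemma powr_gap_vanishes:
  fixes K c q :: real
  assumes "0 < c" "1 \<le> q" "0 < b"
  shows "\<exists>\<delta>>0. \<delta> < b \<and> K * (1 + (1 + \<delta>) powr q - 2 * (1 - \<delta>) powr q) \<le> c"
proof -
  have "((\<lambda>\<delta>. K * (1 + (1 + \<delta>) powr q - 2 * (1 - \<delta>) powr q)) \<longlongrightarrow>
      K * (1 + (1 + 0) powr q - 2 * (1 - 0) powr q)) (at_right 0)"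
    using assms by (intro tendsto_intros) auto
  then have "\<forall>\<^sub>F \<delta> in at_right 0. K * (1 + (1 + \<delta>) powr q - 2 * (1 - \<delta>) powr q) < c"
    using assms by (intro order_tendstoD(2)[where a = c]) auto
  moreover have "\<forall>\<^sub>F \<delta> in at_right 0. \<delta> \<in> {0<..<b}"
    using assms by (intro eventually_at_right_real) auto
  ultimately have "\<forall>\<^sub>F \<delta> in at_right (0::real). 0 < \<delta> \<and> \<delta> < b \<and> K * (1 + (1 + \<delta>) powr q - 2 * (1 - \<delta>) powr q) \<le> c"
    by eventually_elim auto
  then show ?thesis
    using eventually_happens'[OF trivial_limit_at_right_real] by blast
qed

context lq_dual_sum_space
begin

text \<open>
  Since every coordinate in \<open>S\<close> belongs to one summand, replacing each component of \<open>g\<close> by the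
  shortest of \<open>g\<^sub>k\<close>, \<open>H\<^sub>k\<close> and their midpoint, where \<open>H = h + w\<close>, gives a functional \<open>U\<close> with the coordinates of \<open>g\<close>. So \<open>U\<close>
  has norm at least \<open>1 - \<delta>\<close>, and the gaps between the \<open>q\<close>-th powers of the norms of \<open>g\<close> and \<open>H\<close> and that of \<open>U\<close> are
  small. Summing \<open>powr_gap\<close> over the components bounds the norm of \<open>g - H\<close>.
\<close>

lemma lq_rigid:
  assumes D: "\<And>k. D k \<subseteq> carr (X k)"
    and conv: "\<And>\<epsilon>. 0 < \<epsilon> \<Longrightarrow> \<exists>\<tau>>0. \<tau> < 1 \<and> (\<forall>k. convex_at (dual (X k)) \<epsilon> \<tau>)"
    and \<epsilon>: "0 < \<epsilon>"
  shows "\<exists>\<delta>>0. \<delta> \<le> 1 \<and> \<delta> \<le> \<epsilon> \<and> weak_star_rigid E (\<Union>k. single k ` D k) \<epsilon> \<delta>"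
proof -
  \<comment> \<open>The bound for each of the two sums that make up the \<open>q\<close>-th power of the norm of \<open>g - H\<close>.\<close>
  define c where "c = (\<epsilon> / 2) powr q / 2"
  have c: "0 < c" using \<epsilon> by (simp add: c_def)
  define e where "e = (c / (1 + 2 powr q)) powr (1 / q)"
  have two: "0 < 1 + (2::real) powr q" by (intro add_pos_nonneg) auto
  have e: "0 < e" "e powr q = c / (1 + 2 powr q)"
    using c q two by (simp_all add: e_def powr_powr)
  obtain \<tau> where \<tau>: "0 < \<tau>" "\<tau> < 1" "\<And>k. convex_at (dual (X k)) e \<tau>"
    using conv[OF e(1)] by blast
  define K where "K = 2 powr q / (1 - (1 - \<tau>) powr q)"
  obtain \<delta> where \<delta>: "0 < \<delta>" "\<delta> < min (\<epsilon> / 2) (1/2)" "K * (1 + (1 + \<delta>) powr q - 2 * (1 - \<delta>) powr q) \<le> c"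
    using powr_gap_vanishes[OF c q, of "min (\<epsilon> / 2) (1/2)" K] \<epsilon> by auto
  interpret dual: normed_space_on "dual E" by (rule E.normed_space_on_dual)
  have "weak_star_rigid E (\<Union>k. single k ` D k) \<epsilon> \<delta>"
    unfolding weak_star_rigid_def
  proof (intro allI ballI impI, elim conjE)
    fix S g h w
    assume g: "g \<in> unit_ball (dual E)" and h: "h \<in> unit_ball (dual E)" and w: "w \<in> carr (dual E)"
      and S: "S \<subseteq> (\<Union>k. single k ` D k) \<times> Basis" "agree_on S w (g - h)" "nrm (dual E) w \<le> \<delta>"
      and u: "\<forall>u\<in>carr (dual E). agree_on S u g \<longrightarrow> 1 - \<delta> \<le> nrm (dual E) u"
    have gc: "g \<in> carr (dual E)" "h \<in> carr (dual E)" "nrm (dual E) g \<le> 1" "nrm (dual E) h \<le> 1"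
      using g h by (auto simp: unit_ball_def)
    define H where "H = h + w"
    have H: "H \<in> carr (dual E)" "nrm (dual E) H \<le> 1 + \<delta>"
      using gc w S(3) dual.nrm_triangle[of h w] by (auto simp: H_def)
    have SH: "agree_on S H g"
      using S(2) by (auto simp: agree_on_def H_def inner_add_left inner_diff_left)
    define gk where "gk k = component X g k" for k
    define Hk where "Hk k = component X H k" for k
    define mid where "mid k = scl (dual (X k)) (1/2) (gk k + Hk k)" for k
    have comp: "gk k \<in> carr (dual (X k))" "Hk k \<in> carr (dual (X k))" "mid k \<in> carr (dual (X k))" for k
    proof -
      interpret Xk: normed_space_on "dual (X k)" by (rule normed_space_duals(2))
      show "gk k \<in> carr (dual (X k))" "Hk k \<in> carr (dual (X k))"
        unfolding gk_def Hk_def by (rule component_dual(1)[OF gc(1)] component_dual(1)[OF H(1)])+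
      then show "mid k \<in> carr (dual (X k))" unfolding mid_def by (intro Xk.carr_scl Xk.carr_add)
    qed
    have "\<exists>v\<in>{gk k, Hk k, mid k}. \<forall>v'\<in>{gk k, Hk k, mid k}. nrm (dual (X k)) v \<le> nrm (dual (X k)) v'" for k
      using ex_is_arg_min_if_finite[of "{gk k, Hk k, mid k}" "nrm (dual (X k))"]
      by (auto simp: is_arg_min_linorder)
    then obtain v where v: "\<And>k. v k \<in> {gk k, Hk k, mid k}"
      "\<And>k v'. v' \<in> {gk k, Hk k, mid k} \<Longrightarrow> nrm (dual (X k)) (v k) \<le> nrm (dual (X k)) v'"
      by metis
    have vc: "v k \<in> carr (dual (X k))" for k
      using v(1)[of k] comp[of k] by auto
    define m where "m k = nrm (dual (X k)) (v k)" for k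
    define A where "A k = nrm (dual (X k)) (gk k)" for k
    define B where "B k = nrm (dual (X k)) (Hk k)" for k
    define Df where "Df k = nrm (dual (X k)) (gk k - Hk k)" for k
    have m0: "0 \<le> m k" for k
      unfolding m_def by (rule normed_space_on.nrm_nonneg[OF normed_space_duals(2) vc])
    have mA: "m k \<le> A k" "m k \<le> B k" "m k \<le> nrm (dual (X k)) (mid k)" for k
      unfolding m_def A_def B_def by (rule v(2); simp)+
    have As: "(\<lambda>k. A k powr q) sums (nrm (dual E) g powr q)"
      unfolding A_def gk_def by (rule lq_norm[OF gc(1)])
    have Bs: "(\<lambda>k. B k powr q) sums (nrm (dual E) H powr q)"
      unfolding B_def Hk_def by (rule lq_norm[OF H(1)])
    have Ds: "(\<lambda>k. Df k powr q) sums (nrm (dual E) (g - H) powr q)"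
      using lq_norm[OF dual.carr_diff[OF gc(1) H(1)]] unfolding Df_def gk_def Hk_def component_minus .
    have "(\<Sum>k<n. m k powr q) \<le> nrm (dual E) g powr q" for n
    proof -
      have "(\<Sum>k<n. m k powr q) \<le> (\<Sum>k<n. A k powr q)"
        using mA m0 q by (intro sum_mono powr_mono2) auto
      also have "\<dots> \<le> nrm (dual E) g powr q" unfolding A_def gk_def by (rule lq_lower[OF gc(1)])
      finally show ?thesis .
    qed
    then obtain U where U: "U \<in> carr (dual E)" "\<And>k. component X U k = v k"
      using lq_upper[OF vc dual.nrm_nonneg[OF gc(1)]] unfolding m_def by blast
    have ms: "(\<lambda>k. m k powr q) sums (nrm (dual E) U powr q)"
      using lq_norm[OF U(1)] by (simp add: U(2) m_def)
    have "agree_on S U g"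
      unfolding agree_on_def
    proof clarify
      fix x b assume xb: "(x, b) \<in> S"
      then obtain k y where y: "x = single k y" "y \<in> carr (X k)" using S(1) D by blast
      have gk: "gk k y = g x" "Hk k y = H x" using y by (auto simp: gk_def Hk_def component_def)
      have Hg: "H x \<bullet> b = g x \<bullet> b" using SH xb by (auto simp: agree_on_def)
      have "mid k y \<bullet> b = g x \<bullet> b"
        using inner_scaleR_left[of "1/2" "g x + H x" b] Hg
        by (simp add: mid_def dual_simps(1) gk scaleR_conv_of_real inner_add_left)
      moreover have "U x = v k y" using fun_cong[OF U(2)[of k], of y] y by (simp add: component_def)
      ultimately show "U x \<bullet> b = g x \<bullet> b"
        using v(1)[of k] gk Hg by auto
    qed
    then have "1 - \<delta> \<le> nrm (dual E) U" using u U(1) by blast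
    then have Um: "(1 - \<delta>) powr q \<le> nrm (dual E) U powr q" using \<delta> q by (intro powr_mono2) auto
    have pw: "Df k powr q \<le> e powr q * (A k powr q + B k powr q) +
        K * ((A k powr q - m k powr q) + (B k powr q - m k powr q))" for k
      unfolding K_def
    proof (rule powr_gap[OF q \<tau>(1,2) m0 mA])
      interpret Xk: normed_space_on "dual (X k)" by (rule normed_space_duals(2))
      show "0 \<le> Df k" "Df k \<le> A k + B k"
        unfolding Df_def A_def B_def using comp[of k] by (intro Xk.nrm_nonneg Xk.nrm_diff_le Xk.carr_diff; simp)+
      show "0 \<le> e" using e by simp
      show "Df k \<le> e * M" if "A k \<le> M" "B k \<le> M" "(1 - \<tau>) * M \<le> nrm (dual (X k)) (mid k)" for M
        using \<tau>(3)[of k, unfolded convex_at_def, rule_format, of "gk k" "Hk k" M] comp[of k] that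
        by (simp add: A_def B_def Df_def mid_def)
    qed
    have "nrm (dual E) (g - H) powr q \<le>
        e powr q * (nrm (dual E) g powr q + nrm (dual E) H powr q) +
        K * ((nrm (dual E) g powr q - nrm (dual E) U powr q) + (nrm (dual E) H powr q - nrm (dual E) U powr q))"
      by (rule sums_le[OF pw Ds]) (intro sums_add sums_mult sums_diff As Bs ms)
    also have "\<dots> \<le> e powr q * (1 + 2 powr q) + K * (1 + (1 + \<delta>) powr q - 2 * (1 - \<delta>) powr q)"
    proof -
      have N: "nrm (dual E) g powr q \<le> 1" "nrm (dual E) H powr q \<le> (1 + \<delta>) powr q"
        using powr_mono2[of q "nrm (dual E) g" 1] powr_mono2[of q "nrm (dual E) H" "1 + \<delta>"] q
          dual.nrm_nonneg[OF gc(1)] dual.nrm_nonneg[OF H(1)] gc H by auto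
      moreover have "(1 + \<delta>) powr q \<le> 2 powr q" using \<delta> q by (intro powr_mono2) auto
      moreover have "0 \<le> K"
        using \<tau> q powr_mono2[of q "1 - \<tau>" 1] by (auto simp: K_def)
      ultimately show ?thesis
        using Um by (intro add_mono mult_left_mono) auto
    qed
    also have "\<dots> \<le> c + c"
      using \<delta>(3) two by (simp add: e(2))
    also have "\<dots> = (\<epsilon> / 2) powr q" by (simp add: c_def)
    finally have "nrm (dual E) (g - H) powr q \<le> (\<epsilon> / 2) powr q" .
    then have "nrm (dual E) (g - H) \<le> \<epsilon> / 2"
      using powr_less_mono2[of q "\<epsilon> / 2" "nrm (dual E) (g - H)"] q \<epsilon> by linarith
    moreover have "nrm (dual E) (g - h) \<le> nrm (dual E) (g - H) + nrm (dual E) w"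
      using dual.nrm_triangle[of "g - H" w] gc H w by (simp add: H_def)
    ultimately show "nrm (dual E) (g - h) \<le> \<epsilon>" using S(3) \<delta>(2) by simp
  qed
  then show ?thesis using \<delta> by (intro exI[of _ \<delta>]) auto
qed

lemma lq_retraction:
  assumes D: "\<And>k. countable (D k)" "\<And>k. separates_dual (X k) (D k)"
    and conv: "\<And>\<epsilon>. 0 < \<epsilon> \<Longrightarrow> \<exists>\<tau>>0. \<tau> < 1 \<and> (\<forall>k. convex_at (dual (X k)) \<epsilon> \<tau>)"
  shows "dual_admits_usc_retraction E"
proof -
  let ?D = "\<Union>k. single k ` D k"
  have rigid: "\<exists>\<delta>>0. \<delta> \<le> 1 \<and> \<delta> \<le> \<epsilon> \<and> weak_star_rigid E ?D \<epsilon> \<delta>" if "0 < \<epsilon>" for \<epsilon>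
    using D(2) by (intro lq_rigid[OF _ conv that]) (auto simp: separates_dual_def)
  have cD: "countable ?D" using D(1) by auto
  have ex: "\<exists>\<delta>>0. weak_star_rigid E ?D \<epsilon> \<delta>" if "0 < \<epsilon>" for \<epsilon>
    using rigid[OF that] by blast
  obtain r where r: "\<And>f. r f \<in> unit_ball (dual E)" "\<And>f. f \<in> unit_ball (dual E) \<Longrightarrow> r f = f"
    "continuous_on (carr (dual E)) r"
    "\<And>\<epsilon> \<delta> f g. weak_star_rigid E ?D \<epsilon> \<delta> \<Longrightarrow> 0 < \<delta> \<Longrightarrow> \<delta> \<le> 1 \<Longrightarrow> \<delta> \<le> \<epsilon> \<Longrightarrow>
       f \<in> carr (dual E) \<Longrightarrow> g \<in> carr (dual E) \<Longrightarrow> nrm (dual E) (f - g) \<le> \<delta>\<^sup>2 / 4 \<Longrightarrow>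
       nrm (dual E) (r f - r g) \<le> \<epsilon>"
    using retraction_if_rigid[OF E.normed_space_on_axioms cD separates_dual_sum[OF D(2)] ex] by blast
  show ?thesis
  proof (rule usc_retractionI[OF E.normed_space_on_axioms r(1-3)])
    fix \<epsilon> :: real assume "0 < \<epsilon>"
    then obtain \<delta> where "0 < \<delta>" "\<delta> \<le> 1" "\<delta> \<le> \<epsilon>" "weak_star_rigid E ?D \<epsilon> \<delta>"
      using rigid by blast
    then show "\<exists>d>0. \<forall>f\<in>carr (dual E). \<forall>g\<in>carr (dual E).
        nrm (dual E) (f - g) < d \<longrightarrow> nrm (dual E) (r f - r g) \<le> \<epsilon>"
      using r(4) by (intro exI[of _ "\<delta>\<^sup>2 / 4"]) auto
  qed
qed

end

section \<open>The c_0-sum\<close>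

lemma vector_space_componentwise:
  fixes X :: "nat \<Rightarrow> ('k::real_normed_field, 'a::ab_group_add) nspace"
  assumes "\<And>i. normed_space_on (X i)"
  shows "vector_space (\<lambda>c x i. scl (X i) c (x i))"
proof
  fix a b :: 'k and x y :: "nat \<Rightarrow> 'a"
  have V: "vector_space (scl (X i))" for i
    using assms[of i] by (rule normed_space_on.axioms)
  show "(\<lambda>i. scl (X i) a ((x + y) i)) = (\<lambda>i. scl (X i) a (x i)) + (\<lambda>i. scl (X i) a (y i))"
    using vector_space.vector_space_assms(1)[OF V] by (simp add: fun_eq_iff)
  show "(\<lambda>i. scl (X i) (a + b) (x i)) = (\<lambda>i. scl (X i) a (x i)) + (\<lambda>i. scl (X i) b (x i))"
    using vector_space.vector_space_assms(2)[OF V] by (simp add: fun_eq_iff)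
  show "(\<lambda>i. scl (X i) a (scl (X i) b (x i))) = (\<lambda>i. scl (X i) (a * b) (x i))"
    using vector_space.vector_space_assms(3)[OF V] by (simp add: fun_eq_iff)
  show "(\<lambda>i. scl (X i) 1 (x i)) = x"
    using vector_space.vector_space_assms(4)[OF V] by (simp add: fun_eq_iff)
qed

lemma sum_single_apply: "(\<Sum>k<n. single k (x k)) i = (if i < n then x i else (0::'a::comm_monoid_add))"
  by (induction n) (auto simp: single_def less_Suc_eq)

lemma dual_sum_bound:
  fixes X :: "nat \<Rightarrow> ('k::real_normed_field, 'a::ab_group_add) nspace"
  assumes X: "\<And>i. normed_space_on (X i)" and "\<And>k. G k \<in> carr (dual (X k))" "\<And>k. x k \<in> carr (X k)"
  shows "(\<Sum>k<n. norm (G k (x k))) \<le> (\<Sum>k<n. nrm (dual (X k)) (G k) * nrm (X k) (x k))"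
  using assms by (intro sum_mono normed_space_on.dual_bound) auto

context
  fixes X :: "nat \<Rightarrow> ('k::{real_normed_field, euclidean_space}, 'a::ab_group_add) nspace"
  assumes X: "\<And>i. normed_space_on (X i)"
begin

lemma c0_carr:
  "x \<in> carr (c0_sum X) \<longleftrightarrow> (\<forall>i. x i \<in> carr (X i)) \<and> (\<lambda>i. nrm (X i) (x i)) \<longlonglongrightarrow> 0"
  by (simp add: c0_sum_def)

lemma c0_component_le:
  assumes "x \<in> carr (c0_sum X)"
  shows "nrm (X i) (x i) \<le> nrm (c0_sum X) x"
proof -
  have "Bseq (\<lambda>i. nrm (X i) (x i))"
    using assms by (intro convergent_imp_Bseq) (auto simp: c0_carr convergent_def)
  then obtain K where "\<And>i. norm (nrm (X i) (x i)) \<le> K" by (auto simp: Bseq_def)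
  then have "bdd_above (range (\<lambda>i. nrm (X i) (x i)))"
    by (intro bdd_aboveI2[of _ _ K]) (metis real_norm_def abs_le_D1)
  then show ?thesis by (simp add: c0_sum_def) (rule cSUP_upper[OF UNIV_I])
qed

lemma c0_nrm_le: "(\<And>i. nrm (X i) (x i) \<le> B) \<Longrightarrow> nrm (c0_sum X) x \<le> B"
  by (simp add: c0_sum_def cSUP_least)

lemma normed_space_c0: "normed_space_on (c0_sum X)"
proof (rule normed_space_onI)
  note [simp] = normed_space_on.carr_zero[OF X] normed_space_on.nrm_zero[OF X]
    normed_space_on.carr_add[OF X] normed_space_on.carr_scl[OF X] normed_space_on.nrm_scl[OF X]
    normed_space_on.nrm_nonneg[OF X]
  have nn: "0 \<le> nrm (c0_sum X) x" if "x \<in> carr (c0_sum X)" for x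
    using c0_component_le[OF that, of 0] that by (simp add: c0_carr order_trans[of 0 "nrm (X 0) (x 0)"])
  have scl: "scl (c0_sum X) = (\<lambda>c x i. scl (X i) c (x i))" by (simp add: c0_sum_def)
  show "vector_space (scl (c0_sum X))"
    unfolding scl by (rule vector_space_componentwise[OF X])
  show "0 \<in> carr (c0_sum X)" by (simp add: c0_carr)
  fix x assume x: "x \<in> carr (c0_sum X)"
  show "0 \<le> nrm (c0_sum X) x" by (rule nn[OF x])
  show "x = 0" if "nrm (c0_sum X) x = 0"
  proof
    fix i
    have "nrm (X i) (x i) = 0"
      using c0_component_le[OF x, of i] that x by (simp add: c0_carr order_antisym)
    then show "x i = 0 i"
      using x normed_space_on.nrm_eq_0_iff[OF X, of "x i" i] by (simp add: c0_carr)
  qed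
  show "scl (c0_sum X) c x \<in> carr (c0_sum X) \<and> nrm (c0_sum X) (scl (c0_sum X) c x) \<le> norm c * nrm (c0_sum X) x" for c
  proof
    show "scl (c0_sum X) c x \<in> carr (c0_sum X)"
      using x by (auto simp: c0_carr scl intro: tendsto_mult_right_zero)
    show "nrm (c0_sum X) (scl (c0_sum X) c x) \<le> norm c * nrm (c0_sum X) x"
      using x c0_component_le[OF x] by (intro c0_nrm_le) (auto simp: c0_carr scl intro: mult_left_mono)
  qed
  fix y assume y: "y \<in> carr (c0_sum X)"
  have tri: "nrm (X i) (x i + y i) \<le> nrm (X i) (x i) + nrm (X i) (y i)" for i
    using x y by (intro normed_space_on.nrm_triangle[OF X]) (auto simp: c0_carr)
  have "(\<lambda>i. nrm (X i) (x i + y i)) \<longlonglongrightarrow> 0"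
  proof (rule tendsto_sandwich[OF _ _ tendsto_const])
    show "(\<lambda>i. nrm (X i) (x i) + nrm (X i) (y i)) \<longlonglongrightarrow> 0"
      using x y by (auto simp: c0_carr intro: tendsto_add_zero)
  qed (use x y tri in \<open>auto simp: c0_carr\<close>)
  then have "x + y \<in> carr (c0_sum X)" using x y by (simp add: c0_carr)
  moreover have "nrm (X i) ((x + y) i) \<le> nrm (c0_sum X) x + nrm (c0_sum X) y" for i
    using tri[of i] c0_component_le[OF x, of i] c0_component_le[OF y, of i] by simp
  ultimately show "x + y \<in> carr (c0_sum X) \<and> nrm (c0_sum X) (x + y) \<le> nrm (c0_sum X) x + nrm (c0_sum X) y"
    using c0_nrm_le by blast
qed

lemma sum_space_c0: "sum_space (c0_sum X) X"
proof -
  interpret E: normed_space_on "c0_sum X" by (rule normed_space_c0)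
  note [simp] = normed_space_on.carr_zero[OF X] normed_space_on.nrm_zero[OF X] normed_space_on.nrm_nonneg[OF X]
  have single: "single k y \<in> carr (c0_sum X)" if "y \<in> carr (X k)" for k y
  proof -
    have "\<forall>\<^sub>F i in sequentially. nrm (X i) (single k y i) = 0"
      using eventually_gt_at_top[of k] by eventually_elim (simp add: single_def)
    then show ?thesis
      using that by (auto simp: c0_carr single_def intro: tendsto_eventually)
  qed
  show ?thesis
  proof (rule sum_space.intro[OF normed_space_c0], rule sum_space_axioms.intro)
    show "normed_space_on (X k)" for k by (rule X)
    show "scl (c0_sum X) = (\<lambda>c x i. scl (X i) c (x i))" by (simp add: c0_sum_def)
    show "x k \<in> carr (X k)" if "x \<in> carr (c0_sum X)" for x k using that by (simp add: c0_carr)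
    fix k y assume y: "y \<in> carr (X k)"
    show "single k y \<in> carr (c0_sum X)" by (rule single[OF y])
    show "nrm (c0_sum X) (single k y) = nrm (X k) y"
    proof (rule antisym)
      show "nrm (c0_sum X) (single k y) \<le> nrm (X k) y"
        using y by (intro c0_nrm_le) (simp add: single_def)
      show "nrm (X k) y \<le> nrm (c0_sum X) (single k y)"
        using c0_component_le[OF single[OF y], of k] by (simp add: single_def)
    qed
  next
    fix x assume x: "x \<in> carr (c0_sum X)"
    let ?r = "\<lambda>n. x - (\<Sum>k<n. single k (x k))"
    have r: "?r n \<in> carr (c0_sum X)" for n
    proof (intro E.carr_diff x)
      show "(\<Sum>k<n. single k (x k)) \<in> carr (c0_sum X)"
        using x by (induction n) (auto simp: c0_carr[of x] intro: E.carr_add single)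
    qed
    show "(\<lambda>n. nrm (c0_sum X) (?r n)) \<longlonglongrightarrow> 0"
    proof (rule LIMSEQ_I)
      fix e :: real assume e: "0 < e"
      have "(\<lambda>i. nrm (X i) (x i)) \<longlonglongrightarrow> 0" using x by (simp add: c0_carr)
      from LIMSEQ_D[OF this half_gt_zero[OF e]]
      obtain n0 where n0: "\<And>i. i \<ge> n0 \<Longrightarrow> norm (nrm (X i) (x i) - 0) < e / 2"
        by blast
      have "norm (nrm (c0_sum X) (?r n) - 0) < e" if "n \<ge> n0" for n
      proof -
        have "nrm (c0_sum X) (?r n) \<le> e / 2"
        proof (rule c0_nrm_le)
          fix i
          show "nrm (X i) (?r n i) \<le> e / 2"
            using n0[of i] that e by (auto simp: sum_single_apply)
        qed
        then show ?thesis using E.nrm_nonneg[OF r[of n]] e by simp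
      qed
      then show "\<exists>n0. \<forall>n\<ge>n0. norm (nrm (c0_sum X) (?r n) - 0) < e" by blast
    qed
  qed
qed

lemma lq_dual_c0: "lq_dual_sum_space (c0_sum X) X 1"
proof -
  interpret sum_space "c0_sum X" X by (rule sum_space_c0)
  have nn: "0 \<le> nrm (dual (X k)) f" if "f \<in> carr (dual (X k))" for k f
    by (rule normed_space_on.dual_nrm_nonneg[OF X that])
  show ?thesis
  proof unfold_locales
    fix F n assume F: "F \<in> carr (dual (c0_sum X))"
    have "(\<Sum>k<n. 1 * nrm (dual (X k)) (component X F k)) \<le> nrm (dual (c0_sum X)) F * 1"
    proof (rule sum_component_norms_le[OF F])
      fix x assume x: "\<And>k. x k \<in> carr (X k)" "\<And>k. k < n \<Longrightarrow> nrm (X k) (x k) \<le> 1"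
      show "nrm (c0_sum X) (\<Sum>k<n. single k (x k)) \<le> 1"
        by (rule c0_nrm_le) (use x in \<open>simp add: sum_single_apply normed_space_on.nrm_zero[OF X]\<close>)
    qed simp
    then show "(\<Sum>k<n. nrm (dual (X k)) (component X F k) powr 1) \<le> nrm (dual (c0_sum X)) F powr 1"
      using nn component_dual(1)[OF F] E.dual_nrm_nonneg[OF F] by simp
  next
    fix G M assume G: "\<And>k. G k \<in> carr (dual (X k))" and M: "0 \<le> M"
      and b: "\<And>n. (\<Sum>k<n. nrm (dual (X k)) (G k) powr 1) \<le> M powr 1"
    show "\<exists>F\<in>carr (dual (c0_sum X)). (\<forall>k. component X F k = G k) \<and> nrm (dual (c0_sum X)) F \<le> M"
    proof (rule functional_of_components[OF G M])
      fix x n assume x: "x \<in> carr (c0_sum X)"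
      have "(\<Sum>k<n. norm (G k (x k))) \<le> (\<Sum>k<n. nrm (dual (X k)) (G k) * nrm (X k) (x k))"
        using x by (intro dual_sum_bound[OF X G]) (simp add: c0_carr)
      also have "\<dots> \<le> (\<Sum>k<n. nrm (dual (X k)) (G k) * nrm (c0_sum X) x)"
        using nn[OF G] c0_component_le[OF x] by (intro sum_mono mult_left_mono)
      also have "\<dots> = (\<Sum>k<n. nrm (dual (X k)) (G k)) * nrm (c0_sum X) x"
        by (simp add: sum_distrib_right)
      also have "\<dots> \<le> M * nrm (c0_sum X) x"
        using b[of n] M nn[OF G] E.nrm_nonneg[OF x] by (intro mult_right_mono) auto
      finally show "(\<Sum>k<n. norm (G k (x k))) \<le> M * nrm (c0_sum X) x" .
    qed
  qed simp
qed

end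

section \<open>The l_p-sums\<close>

text \<open>
  Young's inequality for the normalized terms.
\<close>

lemma finite_Hoelder:
  fixes a b :: "'i \<Rightarrow> real"
  assumes pq: "1 < p" "1 < q" "1 / p + 1 / q = 1" and I: "finite I"
    and nn: "\<And>i. i \<in> I \<Longrightarrow> 0 \<le> a i" "\<And>i. i \<in> I \<Longrightarrow> 0 \<le> b i" "0 \<le> A" "0 \<le> B"
    and le: "(\<Sum>i\<in>I. a i powr p) \<le> A powr p" "(\<Sum>i\<in>I. b i powr q) \<le> B powr q"
  shows "(\<Sum>i\<in>I. a i * b i) \<le> A * B"
proof (cases "A = 0 \<or> B = 0")
  case True
  have "a i = 0 \<or> b i = 0" if i: "i \<in> I" for i
  proof -
    have "a i powr p \<le> A powr p" "b i powr q \<le> B powr q"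
      using le member_le_sum[OF i, of "\<lambda>i. a i powr p"] member_le_sum[OF i, of "\<lambda>i. b i powr q"] I by auto
    then show ?thesis using True pq by (auto simp: powr_eq_0_iff[symmetric] simp del: powr_eq_0_iff)
  qed
  then have "(\<Sum>i\<in>I. a i * b i) = 0" by (intro sum.neutral) auto
  then show ?thesis using True by auto
next
  case False
  then have pos: "0 < A" "0 < B" using nn by auto
  have "(\<Sum>i\<in>I. (a i / A) * (b i / B)) \<le> (\<Sum>i\<in>I. (a i / A) powr p / p + (b i / B) powr q / q)"
    using nn pos pq by (intro sum_mono Youngs_inequality) auto
  also have "\<dots> = (\<Sum>i\<in>I. a i powr p) / A powr p / p + (\<Sum>i\<in>I. b i powr q) / B powr q / q"
    using nn pos by (simp add: sum.distrib sum_divide_distrib powr_divide)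
  also have "\<dots> \<le> 1 / p + 1 / q"
    using le pos pq by (intro add_mono divide_right_mono) (auto simp: divide_le_eq)
  finally have "(\<Sum>i\<in>I. a i * b i) / (A * B) \<le> 1"
    using pq by (simp add: sum_divide_distrib)
  then show ?thesis using pos by (simp add: divide_le_eq)
qed

text \<open>
  Convexity of \<open>x powr p\<close> up to the boundary point \<open>0\<close>, where it amounts to \<open>t powr p \<le> t\<close>.
\<close>

lemma convex_powr_le:
  fixes x y t p :: real
  assumes "1 \<le> p" "0 \<le> x" "0 \<le> y" "0 \<le> t" "t \<le> 1"
  shows "((1 - t) * x + t * y) powr p \<le> (1 - t) * x powr p + t * y powr p"
proof -
  have small: "s powr p \<le> s" if "0 \<le> s" "s \<le> 1" for s :: real
    using powr_mono'[of 1 p s] that assms(1) by simp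
  consider "x = 0" | "y = 0" | "0 < x" "0 < y" using assms by linarith
  then show ?thesis
  proof cases
    case 1
    then show ?thesis
      using small[of t] assms by (simp add: powr_mult mult_right_mono)
  next
    case 2
    then show ?thesis
      using small[of "1 - t"] assms by (simp add: powr_mult mult_right_mono)
  next
    case 3
    then show ?thesis
      using convex_onD[OF powr_convex[OF assms(1)], of t x y] assms by simp
  qed
qed

text \<open>
  Divided by \<open>A + B\<close>, the sum \<open>a i + b i\<close> is a convex combination of \<open>a i / A\<close> and \<open>b i / B\<close> with weights that do not
  depend on \<open>i\<close>; convexity of the power bounds its \<open>p\<close>-th power, and the sum of the bounds is at most \<open>1\<close>.
\<close>

lemma finite_Minkowski:
  fixes a b :: "'i \<Rightarrow> real"
  assumes p: "1 \<le> p" and I: "finite I"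
    and nn: "\<And>i. i \<in> I \<Longrightarrow> 0 \<le> a i" "\<And>i. i \<in> I \<Longrightarrow> 0 \<le> b i" "0 \<le> A" "0 \<le> B"
    and le: "(\<Sum>i\<in>I. a i powr p) \<le> A powr p" "(\<Sum>i\<in>I. b i powr p) \<le> B powr p"
  shows "(\<Sum>i\<in>I. (a i + b i) powr p) \<le> (A + B) powr p"
proof -
  have zero: "a i = 0" if "i \<in> I" "A = 0" "(\<Sum>i\<in>I. a i powr p) \<le> A powr p" for a :: "'i \<Rightarrow> real" and A i
  proof -
    have "a i powr p \<le> (\<Sum>i\<in>I. a i powr p)"
      using that(1) I by (intro member_le_sum) auto
    also have "\<dots> \<le> 0" using that by simp
    finally have "a i powr p \<le> 0" .
    then show ?thesis by (simp add: order_antisym_conv)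
  qed
  show ?thesis
  proof (cases "A = 0 \<or> B = 0")
    case True
    then show ?thesis using zero[of _ A a] zero[of _ B b] le by auto
  next
    case False
    then have pos: "0 < A" "0 < B" using nn by auto
    define t where "t = B / (A + B)"
    have t: "0 \<le> t" "t \<le> 1" "(A + B) * (1 - t) = A" "(A + B) * t = B"
      using pos by (auto simp: t_def field_simps)
    have "(a i + b i) powr p \<le> (A + B) powr p * ((1 - t) * (a i powr p / A powr p) + t * (b i powr p / B powr p))"
      if i: "i \<in> I" for i
    proof -
      have "a i = A * (a i / A)" "b i = B * (b i / B)" using pos by auto
      then have "a i + b i = (A + B) * ((1 - t) * (a i / A) + t * (b i / B))"
        unfolding distrib_left mult.assoc[symmetric] t by simp
      then have "(a i + b i) powr p = (A + B) powr p * ((1 - t) * (a i / A) + t * (b i / B)) powr p"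
        using pos t nn i by (simp add: powr_mult)
      also have "\<dots> \<le> (A + B) powr p * ((1 - t) * (a i / A) powr p + t * (b i / B) powr p)"
        using pos t nn i p by (intro mult_left_mono convex_powr_le) auto
      finally show ?thesis using pos nn i by (simp add: powr_divide)
    qed
    then have "(\<Sum>i\<in>I. (a i + b i) powr p) \<le>
        (\<Sum>i\<in>I. (A + B) powr p * ((1 - t) * (a i powr p / A powr p) + t * (b i powr p / B powr p)))"
      by (rule sum_mono)
    also have "\<dots> = (A + B) powr p * ((1 - t) * ((\<Sum>i\<in>I. a i powr p) / A powr p) + t * ((\<Sum>i\<in>I. b i powr p) / B powr p))"
      by (simp only: sum_distrib_left[symmetric] sum.distrib sum_divide_distrib[symmetric])
    also have "\<dots> \<le> (A + B) powr p * ((1 - t) * 1 + t * 1)"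
      using le pos t by (intro mult_left_mono add_mono) (auto simp: divide_le_eq)
    finally show ?thesis by simp
  qed
qed

context
  fixes X :: "nat \<Rightarrow> ('k::{real_normed_field, euclidean_space}, 'a::ab_group_add) nspace" and p :: real
  assumes X: "\<And>i. normed_space_on (X i)" and p: "1 \<le> p"
begin

lemma lp_carr:
  "x \<in> carr (lp_sum p X) \<longleftrightarrow> (\<forall>i. x i \<in> carr (X i)) \<and> summable (\<lambda>i. nrm (X i) (x i) powr p)"
  by (simp add: lp_sum_def)

lemma lp_nrm_nonneg: "0 \<le> nrm (lp_sum p X) x"
  by (simp add: lp_sum_def)

lemma lp_nrm_powr:
  assumes "x \<in> carr (lp_sum p X)"
  shows "nrm (lp_sum p X) x powr p = (\<Sum>i. nrm (X i) (x i) powr p)"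
  using assms p suminf_nonneg[of "\<lambda>i. nrm (X i) (x i) powr p"] by (simp add: lp_sum_def powr_powr)

lemma lp_partial_sum_le:
  assumes "x \<in> carr (lp_sum p X)" "finite I"
  shows "(\<Sum>i\<in>I. nrm (X i) (x i) powr p) \<le> nrm (lp_sum p X) x powr p"
  unfolding lp_nrm_powr[OF assms(1)] using assms by (intro sum_le_suminf) (auto simp: lp_carr)

lemma lp_nrm_le:
  assumes x: "\<And>i. x i \<in> carr (X i)" and B: "0 \<le> B"
    and le: "\<And>n. (\<Sum>i<n. nrm (X i) (x i) powr p) \<le> B powr p"
  shows "x \<in> carr (lp_sum p X) \<and> nrm (lp_sum p X) x \<le> B"
proof -
  have s: "summable (\<lambda>i. nrm (X i) (x i) powr p)"
  proof (rule bounded_imp_summable)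
    show "(\<Sum>i\<le>n. nrm (X i) (x i) powr p) \<le> B powr p" for n
      using le[of "Suc n"] by (simp only: lessThan_Suc_atMost)
  qed simp
  then have c: "x \<in> carr (lp_sum p X)" using x by (simp add: lp_carr)
  have "nrm (lp_sum p X) x powr p \<le> B powr p"
    unfolding lp_nrm_powr[OF c] by (rule suminf_le_const[OF s le])
  then have "nrm (lp_sum p X) x \<le> B"
    using powr_less_mono2[of p B "nrm (lp_sum p X) x"] p B by linarith
  then show ?thesis using c by blast
qed

lemma normed_space_lp: "normed_space_on (lp_sum p X)"
proof (rule normed_space_onI)
  note [simp] = normed_space_on.carr_zero[OF X] normed_space_on.nrm_zero[OF X]
    normed_space_on.carr_add[OF X] normed_space_on.carr_scl[OF X] normed_space_on.nrm_scl[OF X]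
    normed_space_on.nrm_nonneg[OF X]
  have scl: "scl (lp_sum p X) = (\<lambda>c x i. scl (X i) c (x i))" by (simp add: lp_sum_def)
  show "vector_space (scl (lp_sum p X))"
    unfolding scl by (rule vector_space_componentwise[OF X])
  show "0 \<in> carr (lp_sum p X)" by (simp add: lp_carr)
  fix x assume x: "x \<in> carr (lp_sum p X)"
  then have xi: "x i \<in> carr (X i)" for i by (simp add: lp_carr)
  show "0 \<le> nrm (lp_sum p X) x" by (rule lp_nrm_nonneg)
  show "x = 0" if 0: "nrm (lp_sum p X) x = 0"
  proof
    fix i
    have "nrm (X i) (x i) powr p \<le> 0"
      using lp_partial_sum_le[OF x, of "{i}"] 0 p by simp
    then have "nrm (X i) (x i) = 0" by (metis powr_eq_0_iff powr_ge_zero antisym)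
    then show "x i = 0 i"
      using normed_space_on.nrm_eq_0_iff[OF X xi] by simp
  qed
  show "scl (lp_sum p X) c x \<in> carr (lp_sum p X) \<and> nrm (lp_sum p X) (scl (lp_sum p X) c x) \<le> norm c * nrm (lp_sum p X) x" for c
  proof (rule lp_nrm_le)
    show "scl (lp_sum p X) c x i \<in> carr (X i)" for i using xi by (simp add: scl)
    show "0 \<le> norm c * nrm (lp_sum p X) x" by (simp add: lp_nrm_nonneg)
    fix n
    have "(\<Sum>i<n. nrm (X i) (scl (lp_sum p X) c x i) powr p) = norm c powr p * (\<Sum>i<n. nrm (X i) (x i) powr p)"
      using xi by (simp add: scl powr_mult sum_distrib_left)
    also have "\<dots> \<le> norm c powr p * nrm (lp_sum p X) x powr p"
      by (intro mult_left_mono lp_partial_sum_le x) auto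
    also have "\<dots> = (norm c * nrm (lp_sum p X) x) powr p"
      by (simp add: powr_mult lp_nrm_nonneg)
    finally show "(\<Sum>i<n. nrm (X i) (scl (lp_sum p X) c x i) powr p) \<le> (norm c * nrm (lp_sum p X) x) powr p" .
  qed
  fix y assume y: "y \<in> carr (lp_sum p X)"
  then have yi: "y i \<in> carr (X i)" for i by (simp add: lp_carr)
  show "x + y \<in> carr (lp_sum p X) \<and> nrm (lp_sum p X) (x + y) \<le> nrm (lp_sum p X) x + nrm (lp_sum p X) y"
  proof (rule lp_nrm_le)
    fix n
    have "(\<Sum>i<n. nrm (X i) ((x + y) i) powr p) \<le> (\<Sum>i<n. (nrm (X i) (x i) + nrm (X i) (y i)) powr p)"
      using p xi yi normed_space_on.nrm_triangle[OF X xi yi] by (intro sum_mono powr_mono2) auto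
    also have "\<dots> \<le> (nrm (lp_sum p X) x + nrm (lp_sum p X) y) powr p"
      using xi yi by (intro finite_Minkowski p lp_partial_sum_le x y lp_nrm_nonneg) auto
    finally show "(\<Sum>i<n. nrm (X i) ((x + y) i) powr p) \<le> (nrm (lp_sum p X) x + nrm (lp_sum p X) y) powr p" .
  qed (use xi yi lp_nrm_nonneg in auto)
qed

lemma sum_space_lp: "sum_space (lp_sum p X) X"
proof -
  interpret E: normed_space_on "lp_sum p X" by (rule normed_space_lp)
  note [simp] = normed_space_on.carr_zero[OF X] normed_space_on.nrm_zero[OF X] normed_space_on.nrm_nonneg[OF X]
  have ns: "nrm (X i) (single k y i) powr p = (if i = k then nrm (X k) y powr p else 0)" for k y i
    by (simp add: single_def)
  have single: "single k y \<in> carr (lp_sum p X) \<and> nrm (lp_sum p X) (single k y) \<le> nrm (X k) y"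
    if "y \<in> carr (X k)" for k y
  proof (rule lp_nrm_le)
    show "single k y i \<in> carr (X i)" for i using that by (simp add: single_def)
  qed (use that in \<open>auto simp: ns sum.delta\<close>)
  show ?thesis
  proof (rule sum_space.intro[OF normed_space_lp], rule sum_space_axioms.intro)
    show "normed_space_on (X k)" for k by (rule X)
    show "scl (lp_sum p X) = (\<lambda>c x i. scl (X i) c (x i))" by (simp add: lp_sum_def)
    show "x k \<in> carr (X k)" if "x \<in> carr (lp_sum p X)" for x k using that by (simp add: lp_carr)
    fix k y assume y: "y \<in> carr (X k)"
    show "single k y \<in> carr (lp_sum p X)" using single[OF y] by blast
    have "nrm (X k) y powr p \<le> nrm (lp_sum p X) (single k y) powr p"
      using lp_partial_sum_le[of "single k y" "{k}"] single[OF y] by (simp add: ns)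
    then have "nrm (X k) y \<le> nrm (lp_sum p X) (single k y)"
      using powr_less_mono2[of p "nrm (lp_sum p X) (single k y)" "nrm (X k) y"] p lp_nrm_nonneg by force
    then show "nrm (lp_sum p X) (single k y) = nrm (X k) y"
      using single[OF y] by simp
  next
    fix x assume x: "x \<in> carr (lp_sum p X)"
    then have xi: "x i \<in> carr (X i)" for i by (simp add: lp_carr)
    define a where "a i = nrm (X i) (x i) powr p" for i
    have a: "summable a" using x by (simp add: a_def[abs_def] lp_carr)
    have le: "nrm (lp_sum p X) (x - (\<Sum>k<n. single k (x k))) \<le> (suminf a - sum a {..<n}) powr (1 / p)" for n
    proof -
      have tail: "0 \<le> suminf a - sum a {..<n}"
        using sum_le_suminf[OF a, of "{..<n}"] by (simp add: a_def)
      have "x - (\<Sum>k<n. single k (x k)) \<in> carr (lp_sum p X) \<and> nrm (lp_sum p X) (x - (\<Sum>k<n. single k (x k))) \<le> (suminf a - sum a {..<n}) powr (1 / p)"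
      proof (rule lp_nrm_le)
        show "(x - (\<Sum>k<n. single k (x k))) i \<in> carr (X i)" for i
          using xi by (simp add: sum_single_apply)
        fix m
        have "(\<Sum>i<m. nrm (X i) ((x - (\<Sum>k<n. single k (x k))) i) powr p) = (\<Sum>i\<in>{n..<m}. a i)"
          by (rule sum.mono_neutral_cong_right) (auto simp: sum_single_apply a_def)
        also have "\<dots> = sum a ({..<n} \<union> {n..<m}) - sum a {..<n}"
          by (subst sum.union_disjoint) auto
        also have "\<dots> \<le> suminf a - sum a {..<n}"
          using sum_le_suminf[OF a, of "{..<n} \<union> {n..<m}"] by (simp add: a_def)
        also have "\<dots> = ((suminf a - sum a {..<n}) powr (1 / p)) powr p"
          using p tail by (simp add: powr_powr)
        finally show "(\<Sum>i<m. nrm (X i) ((x - (\<Sum>k<n. single k (x k))) i) powr p) \<le> ((suminf a - sum a {..<n}) powr (1 / p)) powr p" .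
      qed simp
      then show ?thesis by blast
    qed
    have "(\<lambda>n. suminf a - sum a {..<n}) \<longlonglongrightarrow> suminf a - suminf a"
      by (intro tendsto_diff tendsto_const summable_LIMSEQ[OF a])
    then have "(\<lambda>n. (suminf a - sum a {..<n}) powr (1 / p)) \<longlonglongrightarrow> 0"
      using p sum_le_suminf[OF a]
      by (intro tendsto_zero_powrI[where b = "1 / p"]) (auto simp: a_def intro!: always_eventually)
    then show "(\<lambda>n. nrm (lp_sum p X) (x - (\<Sum>k<n. single k (x k)))) \<longlonglongrightarrow> 0"
      by (rule tendsto_sandwich[OF _ _ tendsto_const, rotated 2]) (use le lp_nrm_nonneg in auto)
  qed
qed

text \<open>
  The upper bound is Hoelder's inequality. For the lower bound, \<open>F\<close> is tested on families with members of norm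
  \<open>\<parallel>F\<^sub>k\<parallel> powr (q - 1)\<close>, the equality case of that inequality.
\<close>

lemma lq_dual_lp:
  assumes p1: "1 < p"
  shows "lq_dual_sum_space (lp_sum p X) X (p / (p - 1))"
proof -
  interpret sum_space "lp_sum p X" X by (rule sum_space_lp)
  define q where "q = p / (p - 1)"
  have q: "1 < q" "1 / p + 1 / q = 1" "1 / q + 1 / p = 1" "(q - 1) * p = q"
    using p1 by (auto simp: q_def field_simps)
  have nn: "0 \<le> nrm (dual (X k)) f" if "f \<in> carr (dual (X k))" for k f
    by (rule normed_space_on.dual_nrm_nonneg[OF X that])
  have "lq_dual_sum_space (lp_sum p X) X q"
  proof unfold_locales
    fix F n assume F: "F \<in> carr (dual (lp_sum p X))"
    let ?a = "\<lambda>k. nrm (dual (X k)) (component X F k)"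
    have a: "0 \<le> ?a k" for k by (rule nn[OF component_dual(1)[OF F]])
    define S where "S = (\<Sum>k<n. ?a k powr q)"
    have S: "0 \<le> S" by (simp add: S_def sum_nonneg)
    have "(\<Sum>k<n. ?a k powr (q - 1) * ?a k) \<le> nrm (dual (lp_sum p X)) F * S powr (1 / p)"
    proof (rule sum_component_norms_le[OF F])
      fix x assume x: "\<And>k. x k \<in> carr (X k)" "\<And>k. k < n \<Longrightarrow> nrm (X k) (x k) \<le> ?a k powr (q - 1)"
      let ?s = "\<Sum>k<n. single k (x k)"
      have "?s \<in> carr (lp_sum p X) \<and> nrm (lp_sum p X) ?s \<le> S powr (1 / p)"
      proof (rule lp_nrm_le)
        show "?s i \<in> carr (X i)" for i
          using x normed_space_on.carr_zero[OF X] by (simp add: sum_single_apply)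
        fix m
        have "(\<Sum>i<m. nrm (X i) (?s i) powr p) = (\<Sum>i\<in>{..<m} \<inter> {..<n}. nrm (X i) (x i) powr p)"
          by (rule sum.mono_neutral_cong_right) (auto simp: sum_single_apply normed_space_on.nrm_zero[OF X])
        also have "\<dots> \<le> (\<Sum>i<n. nrm (X i) (x i) powr p)"
          by (rule sum_mono2) auto
        also have "\<dots> \<le> (\<Sum>i<n. (?a i powr (q - 1)) powr p)"
          using x p normed_space_on.nrm_nonneg[OF X x(1)] by (intro sum_mono powr_mono2) auto
        also have "\<dots> = S" by (simp add: S_def powr_powr q)
        also have "\<dots> = (S powr (1 / p)) powr p" using p S by (simp add: powr_powr)
        finally show "(\<Sum>i<m. nrm (X i) (?s i) powr p) \<le> (S powr (1 / p)) powr p" .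
      qed simp
      then show "nrm (lp_sum p X) ?s \<le> S powr (1 / p)" by blast
    qed simp
    moreover have "?a k powr (q - 1) * ?a k = ?a k powr q" for k
      using a[of k] by (cases "?a k = 0") (simp_all add: powr_mult_base powr_diff)
    ultimately have le: "S \<le> nrm (dual (lp_sum p X)) F * S powr (1 / p)" by (simp add: S_def)
    show "S \<le> nrm (dual (lp_sum p X)) F powr q"
    proof (cases "S = 0")
      case False
      then have Spos: "0 < S" using S by simp
      have "S = S powr (1 / q) * S powr (1 / p)"
        using Spos q by (simp add: powr_add[symmetric])
      then have "S powr (1 / q) \<le> nrm (dual (lp_sum p X)) F"
        using le Spos by (metis mult_le_cancel_right powr_gt_zero order_less_asym)
      then have "(S powr (1 / q)) powr q \<le> nrm (dual (lp_sum p X)) F powr q"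
        using q by (intro powr_mono2) auto
      then show ?thesis using q Spos by (simp add: powr_powr)
    qed simp
  next
    fix G M assume G: "\<And>k. G k \<in> carr (dual (X k))" and M: "0 \<le> M"
      and b: "\<And>n. (\<Sum>k<n. nrm (dual (X k)) (G k) powr q) \<le> M powr q"
    show "\<exists>F\<in>carr (dual (lp_sum p X)). (\<forall>k. component X F k = G k) \<and> nrm (dual (lp_sum p X)) F \<le> M"
    proof (rule functional_of_components[OF G M])
      fix x n assume x: "x \<in> carr (lp_sum p X)"
      then have xi: "x i \<in> carr (X i)" for i by (simp add: lp_carr)
      have "(\<Sum>k<n. norm (G k (x k))) \<le> (\<Sum>k<n. nrm (dual (X k)) (G k) * nrm (X k) (x k))"
        by (rule dual_sum_bound[OF X G xi])
      also have "\<dots> \<le> M * nrm (lp_sum p X) x"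
        using nn[OF G] normed_space_on.nrm_nonneg[OF X xi]
        by (intro finite_Hoelder[OF q(1) p1 q(3)] b M lp_nrm_nonneg lp_partial_sum_le x) auto
      finally show "(\<Sum>k<n. norm (G k (x k))) \<le> M * nrm (lp_sum p X) x" .
    qed
  qed (use q in simp)
  then show ?thesis by (simp add: q_def)
qed

lemma sup_dual_l1:
  assumes p1: "p = 1" and G: "\<And>k. G k \<in> carr (dual (X k))" and M: "0 \<le> M" "\<And>k. nrm (dual (X k)) (G k) \<le> M"
  shows "\<exists>F\<in>carr (dual (lp_sum p X)). (\<forall>k. component X F k = G k) \<and> nrm (dual (lp_sum p X)) F \<le> M"
proof -
  interpret sum_space "lp_sum p X" X by (rule sum_space_lp)
  show ?thesis
  proof (rule functional_of_components[OF G M(1)])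
    fix x n assume x: "x \<in> carr (lp_sum p X)"
    then have xi: "x i \<in> carr (X i)" for i by (simp add: lp_carr)
    note nx = normed_space_on.nrm_nonneg[OF X xi]
    have "(\<Sum>k<n. norm (G k (x k))) \<le> (\<Sum>k<n. nrm (dual (X k)) (G k) * nrm (X k) (x k))"
      by (rule dual_sum_bound[OF X G xi])
    also have "\<dots> \<le> (\<Sum>k<n. M * nrm (X k) (x k))"
      using M nx by (intro sum_mono mult_right_mono)
    also have "\<dots> = M * (\<Sum>k<n. nrm (X k) (x k))" by (simp add: sum_distrib_left)
    also have "\<dots> \<le> M * nrm (lp_sum p X) x"
      using lp_partial_sum_le[OF x, of "{..<n}"] nx lp_nrm_nonneg[of x] M p1
      by (intro mult_left_mono) auto
    finally show "(\<Sum>k<n. norm (G k (x k))) \<le> M * nrm (lp_sum p X) x" .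
  qed
qed

end

section \<open>Retractions for c_0-sums and l_p-sums\<close>

theorem corollary2p8:
  fixes X :: "nat \<Rightarrow> ('k::{real_normed_field, euclidean_space}, 'a::ab_group_add) nspace"
  assumes "\<And>i. banach_space_on (X i)"
    and "\<And>i. norm_separable (dual (X i))"
    and "\<And>i. uniformly_convex (dual (X i))"
    and "\<And>\<epsilon>. 0 < \<epsilon> \<Longrightarrow> \<epsilon> < 1 \<Longrightarrow> 0 < (INF i. modulus_of_convexity (dual (X i)) \<epsilon>)"
  shows "dual_admits_usc_retraction (c0_sum X) \<and>
         (\<forall>p::real. p \<ge> 1 \<longrightarrow> dual_admits_usc_retraction (lp_sum p X))"
proof -
  have X: "normed_space_on (X i)" for i
    using assms(1) by (rule banach_space_on.axioms)
  have conv: "\<exists>\<tau>>0. \<tau> < 1 \<and> (\<forall>i. convex_at (dual (X i)) \<epsilon> \<tau>)" if "0 < \<epsilon>" for \<epsilon>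
    by (rule uniformly_convex_at[OF normed_space_on.normed_space_on_dual[OF X] assms(4) that])
  have "\<exists>D. countable D \<and> separates_dual (X i) D" for i
    using separable_dual_imp_separating[OF X assms(2)] by blast
  then obtain D where D: "\<And>i. countable (D i)" "\<And>i. separates_dual (X i) (D i)"
    by metis
  have "dual_admits_usc_retraction (c0_sum X)"
    by (rule lq_dual_sum_space.lq_retraction[OF lq_dual_c0[OF X] D conv])
  moreover have "dual_admits_usc_retraction (lp_sum p X)" if p: "p \<ge> 1" for p
  proof (cases "p = 1")
    case True
    show ?thesis
      by (rule sum_space.retraction_if_sup_dual[OF sum_space_lp[OF X p] sup_dual_l1[OF X p True] D
            uniformly_rigid[OF X conv]])
  next
    case False
    then show ?thesis
      using p by (intro lq_dual_sum_space.lq_retraction[OF lq_dual_lp[OF X p] D conv]) auto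
  qed
  ultimately show ?thesis by blast
qed

end
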